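(* Let $d,m\ge1$ be integers, let $1\le q<\infty$, and let $U\subseteq\mathbb{R}^m$ be open and bounded. If $A_n\to A$ in $W^{1,q}(U,\mathrm{Herm}(d))$ as $n\to\infty$, then, for all $1\le j\le m$, $$\big\|\,\|\partial_j(\mathcal{E}(A))\|_2-\|\partial_j(\mathcal{E}(A_n))\|_2\,\big\|_{L^q(U)}\to0$$ and $$\|\partial_j(\mathcal{E}(A_n))\|_{L^q(U,\mathbb{R}^d)}\to\|\partial_j(\mathcal{E}(A))\|_{L^q(U,\mathbb{R}^d)}$$ as $n\to\infty$.
   Context: $M_d(\mathbb{C})$ is the space of complex $d\times d$ matrices with the Frobenius norm $\|A\|_2=(\sum_{i,j}|a_{ij}|^2)^{1/2}$, and $\mathrm{Herm}(d)=\{A\in M_d(\mathbb{C}):A^*=A\}$. The map $\lambda^{\uparrow}:\mathrm{Herm}(d)\to\mathbb{R}^d$ assigns to $A$ its eigenvalues (with multiplicity) in increasing order; it is $1$-Lipschitz for the $2$-norms. The characteristic map is $\mathcal{E}(A)=\lambda^\uparrow\circ A$, which sends $W^{1,q}(U,\mathrm{Herm}(d))$ into $W^{1,q}(U,\mathbb{R}^d)$. $W^{1,q}(U,V)$ for a finite-dimensional real vector space $V$ with Euclidean norm $\|\cdot\|_2$ carries the norm $\|f\|_{W^{1,q}}=\|f\|_{L^q}+\sum_{i=1}^m\|\partial_i f\|_{L^q}$, where $\|f\|_{L^q(U,V)}=\big\|\,\|f\|_2\,\big\|_{L^q(U)}$ and $\partial_i f$ are distributional derivatives. *)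

theory Defs
  imports "HOL-Analysis.Analysis" "HOL-Computational_Algebra.Computational_Algebra"
begin

section \<open>Hermitian matrices and ordered eigenvalues\<close>

text \<open>The library norm on \<^typ>\<open>complex^'d^'d\<close> is the Frobenius norm.\<close>

definition Herm :: "(complex^'d^'d) set" where
  "Herm = {A. map_matrix cnj (transpose A) = A}"

definition charpoly :: "complex^'d^'d \<Rightarrow> complex poly" where
  "charpoly A = det (mat [:0, 1:] - map_matrix (\<lambda>z. [:z:]) A)"

text \<open>The index type carries a linear order, so that ``increasing order'' makes sense; the index
  \<open>i\<close> sits at position \<open>card {k. k < i}\<close> when counting from \<open>0\<close>. Roots of the characteristic
  polynomial are counted with multiplicity. On \<^const>\<open>Herm\<close> they are real, so that \<^const>\<open>Re\<close>
  only changes the type; elsewhere the value has no significance.\<close>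

definition eigvals_incr :: "complex^('d::{finite,linorder})^('d::{finite,linorder}) \<Rightarrow> real^('d::{finite,linorder})" where
  "eigvals_incr A =
     (\<chi> i. sorted_list_of_multiset (image_mset Re (proots (charpoly A))) ! card {k. k < i})"

definition char_map ::
    "('x \<Rightarrow> complex^('d::{finite,linorder})^('d::{finite,linorder})) \<Rightarrow> 'x \<Rightarrow> real^('d::{finite,linorder})" where
  "char_map A = eigvals_incr \<circ> A"


section \<open>Lebesgue spaces\<close>

text \<open>The norm takes values in \<^typ>\<open>ennreal\<close>, so that it is \<open>\<infinity>\<close> (and not a default value \<open>0\<close>)
  on functions that are not \<open>q\<close>-integrable.\<close>

definition Lq_norm :: "real \<Rightarrow> (real^'m) set \<Rightarrow> (real^'m \<Rightarrow> 'v::real_normed_vector) \<Rightarrow> ennreal" where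
  "Lq_norm q U f =
     (let I = (\<integral>\<^sup>+ x. ennreal (norm (f x) powr q) \<partial>lebesgue_on U)
      in if I = \<infinity> then \<infinity> else ennreal (enn2real I powr (1 / q)))"

text \<open>Elements are represented by functions on the whole space of which only the values almost
  everywhere in \<open>U\<close> matter. The target \<open>V\<close> is given as a linear subspace of the type \<open>'v\<close>.\<close>

definition Lq_space :: "real \<Rightarrow> (real^'m) set \<Rightarrow> 'v::euclidean_space set \<Rightarrow> (real^'m \<Rightarrow> 'v) set" where
  "Lq_space q U V =
     {f. f \<in> borel_measurable (lebesgue_on U) \<and> (AE x in lebesgue_on U. f x \<in> V) \<and> Lq_norm q U f < \<infinity>}"


section \<open>Distributional derivatives and Sobolev spaces\<close>

definition partial :: "'m \<Rightarrow> (real^'m \<Rightarrow> real) \<Rightarrow> real^'m \<Rightarrow> real" where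
  "partial j \<phi> x = frechet_derivative \<phi> (at x) (axis j 1)"

primrec C_k :: "nat \<Rightarrow> (real^'m \<Rightarrow> real) \<Rightarrow> bool" where
  "C_k 0 \<phi> \<longleftrightarrow> continuous_on UNIV \<phi>"
| "C_k (Suc k) \<phi> \<longleftrightarrow> (\<forall>x. \<phi> differentiable (at x)) \<and> (\<forall>j. C_k k (partial j \<phi>))"

definition test_functions :: "(real^'m) set \<Rightarrow> (real^'m \<Rightarrow> real) set" where
  "test_functions U =
     {\<phi>. (\<forall>k. C_k k \<phi>) \<and> compact (closure {x. \<phi> x \<noteq> 0}) \<and> closure {x. \<phi> x \<noteq> 0} \<subseteq> U}"

definition locally_integrable :: "(real^'m) set \<Rightarrow> (real^'m \<Rightarrow> 'v::euclidean_space) \<Rightarrow> bool" where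
  "locally_integrable U f \<longleftrightarrow> (\<forall>K. compact K \<and> K \<subseteq> U \<longrightarrow> integrable (lebesgue_on K) f)"

definition has_weak_partial ::
    "(real^'m) set \<Rightarrow> 'm \<Rightarrow> (real^'m \<Rightarrow> 'v::euclidean_space) \<Rightarrow> (real^'m \<Rightarrow> 'v) \<Rightarrow> bool" where
  "has_weak_partial U j f g \<longleftrightarrow>
     locally_integrable U f \<and> locally_integrable U g \<and>
     (\<forall>\<phi>\<in>test_functions U.
        (LINT x|lebesgue_on U. partial j \<phi> x *\<^sub>R f x) = - (LINT x|lebesgue_on U. \<phi> x *\<^sub>R g x))"

text \<open>A representative of the distributional derivative, which is unique almost everywhere in \<open>U\<close>
  if it is a locally integrable function.\<close>

definition weak_partial ::
    "(real^'m) set \<Rightarrow> 'm \<Rightarrow> (real^'m \<Rightarrow> 'v::euclidean_space) \<Rightarrow> real^'m \<Rightarrow> 'v" where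
  "weak_partial U j f = (SOME g. has_weak_partial U j f g)"

definition W1q :: "real \<Rightarrow> (real^'m) set \<Rightarrow> 'v::euclidean_space set \<Rightarrow> (real^'m \<Rightarrow> 'v) set" where
  "W1q q U V =
     {f \<in> Lq_space q U V. \<forall>j. \<exists>g\<in>Lq_space q U V. has_weak_partial U j f g}"

definition W1q_norm :: "real \<Rightarrow> (real^'m) set \<Rightarrow> (real^'m \<Rightarrow> 'v::euclidean_space) \<Rightarrow> ennreal" where
  "W1q_norm q U f = Lq_norm q U f + (\<Sum>i\<in>UNIV. Lq_norm q U (weak_partial U i f))"

end

theory Submission
  imports Defs
begin

text \<open>For strictly increasing weights \<open>w\<close>, the maximum of \<open>\<Sum> w_i Re <u_i, A u_i>\<close> over orthonormal frames
  \<open>u\<close> is attained at a frame that diagonalises the Hermitian matrix \<open>A\<close> in increasing order, so it equals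
  \<open>\<Sum> w_i \<lambda>_i(A)\<close>. Hence each ordered eigenvalue is a difference of two functions that are convex and
  Lipschitz on the space of all matrices.

  For a convex Lipschitz \<open>H\<close> and a Sobolev function \<open>u\<close>, the forward and the backward difference quotients
  of \<open>H \<circ> u\<close> both converge to a weak derivative, namely to \<open>H'(u; \<partial>u)\<close> and to \<open>- H'(u; - \<partial>u)\<close>. By uniqueness of weak
  derivatives the two agree almost everywhere. At such points the directional derivative, which is
  always upper semicontinuous in the base point, is continuous, and dominated convergence along almost
  everywhere convergent subsequences gives convergence of the derivatives of the eigenvalues in \<open>L^q\<close>.\<close>

text \<open>The ordered eigenvalues need not be differentiable where they meet, and a Sobolev
  function may take such values on a set of positive measure, so almost everywhere differentiability
  of Lipschitz maps says nothing about a chain rule along it. Convexity fills the gap: one-sided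
  directional derivatives exist at every point as infima of difference quotients, and an infimum of
  functions continuous in the base point is upper semicontinuous. A difference of convex functions
  need not have this property, so oddness and continuity are proved for each convex piece and only
  then recombined.

  Strict growth of the weights is what makes every maximising frame diagonalise. With weights 0 and
  1, as for partial sums of eigenvalues, a maximiser would only split the space into two invariant
  blocks.

  In the final limit the base point and the direction are changed one at a time. The directional
  derivative is Lipschitz in the direction, uniformly in the base point; continuity in the base
  point is known only for the limiting direction, almost everywhere.\<close>

no_notation fps_nth (infixl "$" 75)

section \<open>Ordered eigenvalues as differences of convex functions\<close>

definition hip :: "complex^'d \<Rightarrow> complex^'d \<Rightarrow> complex" where
  "hip x y = (\<Sum>k\<in>UNIV. cnj (x$k) * y$k)"

lemma hip_add_left: "hip (x + y) z = hip x z + hip y z"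
  and hip_add_right: "hip z (x + y) = hip z x + hip z y"
  and hip_scale_left: "hip (c *s x) y = cnj c * hip x y"
  and hip_scale_right: "hip x (c *s y) = c * hip x y"
  and hip_diff_left: "hip (x - y) z = hip x z - hip y z"
  and hip_diff_right: "hip z (x - y) = hip z x - hip z y"
  by (simp_all add: hip_def sum.distrib sum_subtractf sum_distrib_left algebra_simps)

lemma hip_cnj: "cnj (hip x y) = hip y x"
  by (simp add: hip_def mult.commute)

lemma Herm_nth: "A \<in> Herm \<Longrightarrow> cnj (A$j$i) = A$i$j"
  unfolding Herm_def by (metis (mono_tags, lifting) mem_Collect_eq nth_map_matrix transpose_def vec_lambda_beta)

lemma hip_Herm:
  assumes "A \<in> Herm"
  shows "hip (A *v x) y = hip x (A *v y)"
proof -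
  have "hip (A *v x) y = (\<Sum>k\<in>UNIV. \<Sum>l\<in>UNIV. cnj (x$l) * (A$l$k * y$k))"
    by (simp add: hip_def matrix_vector_mult_def sum_distrib_right sum_distrib_left Herm_nth[OF assms] mult_ac)
  also have "\<dots> = hip x (A *v y)"
    by (subst sum.swap) (simp add: hip_def matrix_vector_mult_def sum_distrib_left)
  finally show ?thesis .
qed

text \<open>The vectors of a frame are the rows \<open>u$i\<close>, so a frame is a matrix and
  compactness is that of a subset of a Euclidean space. \<open>hip\<close> is used because
  \<open>\<bullet>\<close> on this type is only its real part.\<close>

definition unitary_frames :: "(complex^'d^'d) set" where
  "unitary_frames = {u. \<forall>i j. hip (u$i) (u$j) = of_bool (i = j)}"

text \<open>The real part makes this real-linear in every matrix \<open>A\<close>, Hermitian or not.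
  On a frame it is the real part of the trace of \<open>A\<close> times the sum of
  \<open>w i\<close> times the projection onto \<open>u$i\<close>.\<close>

definition weighted_trace :: "('d \<Rightarrow> real) \<Rightarrow> complex^'d^'d \<Rightarrow> complex^'d^'d \<Rightarrow> real" where
  "weighted_trace w A u = (\<Sum>i\<in>UNIV. w i * Re (hip (u$i) (A *v u$i)))"

lemma hip_self: "hip x x = of_real ((norm x)\<^sup>2)"
  by (simp add: hip_def norm_vec_def L2_set_def sum_nonneg of_real_sum complex_norm_square mult.commute del: of_real_power)

lemma norm_unitary_frame: "u \<in> unitary_frames \<Longrightarrow> norm (u$i) = 1"
proof -
  assume "u \<in> unitary_frames"
  then have "complex_of_real ((norm (u$i))\<^sup>2) = 1"
    unfolding unitary_frames_def using hip_self[of "u$i"] by auto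
  then have "(norm (u$i))\<^sup>2 = 1" using of_real_eq_1_iff by blast
  then show ?thesis by (simp add: power2_eq_1_iff) (smt (verit) norm_ge_zero)
qed

lemma continuous_on_hip [continuous_intros]:
  assumes "continuous_on S f" "continuous_on S g"
  shows "continuous_on S (\<lambda>x. hip (f x) (g x))"
  unfolding hip_def by (intro continuous_intros assms)

lemma continuous_on_matrix_vector_mult [continuous_intros]:
  fixes A :: "complex^'n^'m"
  assumes "continuous_on S f"
  shows "continuous_on S (\<lambda>x. A *v f x)"
  unfolding matrix_vector_mult_def by (intro continuous_intros assms)

lemma mat_1_unitary_frame: "mat 1 \<in> unitary_frames"
  by (auto simp: unitary_frames_def hip_def mat_def if_distrib[of cnj] if_distrib[of "\<lambda>x. x * _"] cong: if_cong)

lemma compact_unitary_frames: "compact (unitary_frames :: (complex^'d^'d) set)"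
proof (rule compact_eq_bounded_closed[THEN iffD2], intro conjI)
  have "norm u \<le> real CARD('d)" if "u \<in> unitary_frames" for u :: "complex^'d^'d"
  proof -
    have "norm u \<le> (\<Sum>i\<in>UNIV. norm (u$i))" by (simp add: norm_vec_def L2_set_le_sum)
    then show ?thesis by (simp add: norm_unitary_frame[OF that])
  qed
  then show "bounded (unitary_frames :: (complex^'d^'d) set)" unfolding bounded_iff by blast
  have "closed {u :: complex^'d^'d. hip (u$i) (u$j) = of_bool (i = j)}" for i j
    by (intro closed_Collect_eq continuous_intros)
  then have "closed (\<Inter>i j. {u :: complex^'d^'d. hip (u$i) (u$j) = of_bool (i = j)})" by blast
  then show "closed (unitary_frames :: (complex^'d^'d) set)"
    by (simp add: unitary_frames_def Collect_all_eq)
qed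

lemma weighted_trace_attains_sup:
  obtains u where "u \<in> unitary_frames" "\<And>v. v \<in> unitary_frames \<Longrightarrow> weighted_trace w A v \<le> weighted_trace w A u"
proof -
  have "continuous_on unitary_frames (weighted_trace w A)"
    unfolding weighted_trace_def by (intro continuous_intros)
  then show ?thesis
    using continuous_attains_sup[OF compact_unitary_frames] mat_1_unitary_frame that by (metis empty_iff)
qed

lemma weighted_trace_add: "weighted_trace w (A + B) u = weighted_trace w A u + weighted_trace w B u"
  by (simp add: weighted_trace_def matrix_vector_mult_add_rdistrib hip_add_right distrib_left sum.distrib)

lemma weighted_trace_scaleR: "weighted_trace w (c *\<^sub>R A) u = c * weighted_trace w A u"
proof -
  have "hip (u$i) ((c *\<^sub>R A) *v u$i) = c *\<^sub>R hip (u$i) (A *v u$i)" for i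
    by (simp add: hip_def matrix_vector_mult_def scaleR_sum_right flip: scaleR_sum_right)
  then show ?thesis by (simp add: weighted_trace_def sum_distrib_left mult_ac)
qed

lemma weighted_trace_diff: "weighted_trace w (A - B) u = weighted_trace w A u - weighted_trace w B u"
  using weighted_trace_add[of w A "-1 *\<^sub>R B" u] weighted_trace_scaleR[of w "-1" B u] by simp

lemma norm_hip_le: "norm (hip x y) \<le> real CARD('d) * (norm x * norm y)" for x y :: "complex^'d"
proof -
  have "norm (hip x y) \<le> (\<Sum>k\<in>(UNIV :: 'd set). norm x * norm y)"
    unfolding hip_def
    by (rule order_trans[OF norm_sum], rule sum_mono)
       (auto simp: norm_mult intro!: mult_mono Finite_Cartesian_Product.norm_nth_le)
  then show ?thesis by simp
qed

lemma norm_matrix_vector_mult_le: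
  fixes A :: "complex^'d^'d"
  shows "norm (A *v x) \<le> real CARD('d) * (real CARD('d) * (norm A * norm x))"
proof -
  have "norm (A *v x) \<le> (\<Sum>i\<in>UNIV. norm ((A *v x)$i))" by (simp add: norm_vec_def L2_set_le_sum)
  also have "\<dots> \<le> (\<Sum>i\<in>(UNIV::'d set). real CARD('d) * (norm A * norm x))"
  proof (rule sum_mono)
    fix i
    have "norm ((A *v x)$i) \<le> (\<Sum>j\<in>(UNIV::'d set). norm A * norm x)"
      unfolding matrix_vector_mult_def
      by (simp, rule order_trans[OF norm_sum], rule order_trans[OF sum_mono[where g="\<lambda>_. norm A * norm x"]])
         (auto simp: norm_mult intro!: mult_mono Finite_Cartesian_Product.norm_nth_le order_trans[OF Finite_Cartesian_Product.norm_nth_le Finite_Cartesian_Product.norm_nth_le])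
    then show "norm ((A *v x)$i) \<le> real CARD('d) * (norm A * norm x)" by simp
  qed
  finally show ?thesis by simp
qed

lemma weighted_trace_bound:
  obtains L where "L \<ge> 0" "\<And>A u. u \<in> unitary_frames \<Longrightarrow> \<bar>weighted_trace w A u\<bar> \<le> L * norm (A :: complex^'d^'d)"
proof -
  \<comment> \<open>One factor \<open>CARD('d)\<close> comes from \<open>norm_hip_le\<close> and two
    from \<open>norm_matrix_vector_mult_le\<close>; what matters is that the bound is uniform in the
    frame.\<close>
  define L where "L = (\<Sum>i\<in>UNIV. \<bar>w i\<bar> * (real CARD('d) ^ 3))"
  have "\<bar>weighted_trace w A u\<bar> \<le> L * norm A" if u: "u \<in> unitary_frames" for A u :: "complex^'d^'d"
  proof -
    have "\<bar>Re (hip (u$i) (A *v u$i))\<bar> \<le> real CARD('d) ^ 3 * norm A" for i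
    proof -
      have "\<bar>Re (hip (u$i) (A *v u$i))\<bar> \<le> real CARD('d) * (norm (u$i) * norm (A *v u$i))"
        using abs_Re_le_cmod norm_hip_le order_trans by blast
      also have "\<dots> \<le> real CARD('d) * (1 * (real CARD('d) * (real CARD('d) * (norm A * 1))))"
        using norm_matrix_vector_mult_le[of A "u$i"] by (auto intro!: mult_left_mono simp: norm_unitary_frame[OF u])
      finally show ?thesis by (simp add: power3_eq_cube mult_ac)
    qed
    then show ?thesis unfolding weighted_trace_def L_def sum_distrib_right
      by (intro order_trans[OF sum_abs] sum_mono) (auto simp: abs_mult mult.assoc intro!: mult_left_mono)
  qed
  moreover have "L \<ge> 0" unfolding L_def by (auto intro!: sum_nonneg)
  ultimately show ?thesis using that by blast
qed

section \<open>Plane rotations of a frame and the diagonal form at a maximum\<close>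

text \<open>A complex plane rotation of \<open>u$i\<close> and \<open>u$j\<close> with cosine
  \<open>c\<close> and sine \<open>s\<close>. The free phase \<open>\<omega>\<close> can later turn
  an off-diagonal entry into its modulus.\<close>

definition givens :: "complex^'d^'d \<Rightarrow> 'd \<Rightarrow> 'd \<Rightarrow> real \<Rightarrow> real \<Rightarrow> complex \<Rightarrow> complex^'d^'d" where
  "givens u i j c s \<omega> = (\<chi> l. if l = i then of_real c *s u$i + (of_real s * \<omega>) *s u$j
      else if l = j then (- of_real s * cnj \<omega>) *s u$i + of_real c *s u$j else u$l)"

lemma givens_unitary_frame:
  assumes u: "u \<in> unitary_frames" and ij: "i \<noteq> j" and cs: "c\<^sup>2 + s\<^sup>2 = 1" and w: "norm \<omega> = 1"
  shows "givens u i j c s \<omega> \<in> unitary_frames"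
proof -
  have h: "hip (u$a) (u$b) = of_bool (a = b)" for a b using u by (auto simp: unitary_frames_def)
  have w1: "\<omega> * cnj \<omega> = 1" "cnj \<omega> * \<omega> = 1"
    using w by (simp_all add: complex_norm_square[symmetric] mult.commute[of "cnj \<omega>"])
  have cs': "complex_of_real c * complex_of_real c + complex_of_real s * complex_of_real s = 1"
    using cs by (metis of_real_1 of_real_add of_real_mult power2_eq_square)
  have cs'': "complex_of_real c * complex_of_real c + complex_of_real s * \<omega> * (complex_of_real s * cnj \<omega>) = 1"
     "complex_of_real s * \<omega> * (complex_of_real s * cnj \<omega>) + complex_of_real c * complex_of_real c = 1"
    using cs' w1 by (metis (no_types, lifting) mult.assoc mult.left_commute mult.right_neutral add.commute)+
  show ?thesis
    unfolding unitary_frames_def givens_def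
    using ij by (auto simp: hip_add_left hip_add_right hip_diff_left hip_diff_right hip_scale_left hip_scale_right h)
      (use cs'' in \<open>simp_all add: algebra_simps\<close>)
qed

text \<open>The rotation preserves the trace of the 2 by 2 block, so entry \<open>j\<close> loses
  what entry \<open>i\<close> gains; hence the single factor \<open>w i - w j\<close>.\<close>

lemma weighted_trace_givens:
  assumes A: "A \<in> Herm" and ij: "i \<noteq> j" and cs: "c\<^sup>2 + s\<^sup>2 = 1" and w: "norm \<omega> = 1"
  shows "weighted_trace w A (givens u i j c s \<omega>) - weighted_trace w A u =
     (w i - w j) * (s\<^sup>2 * (Re (hip (u$j) (A *v u$j)) - Re (hip (u$i) (A *v u$i)))
                      + 2 * c * s * Re (\<omega> * hip (u$i) (A *v u$j)))"
proof -
  define f where "f v = (\<lambda>l. Re (hip (v$l) (A *v v$l)))" for v :: "complex^'a^'a"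
  let ?v = "givens u i j c s \<omega>"
  define m where "m = hip (u$i) (A *v u$j)"
  have m': "hip (u$j) (A *v u$i) = cnj m" by (simp add: m_def hip_cnj hip_Herm[OF A])
  have ww: "(Re \<omega>)\<^sup>2 + (Im \<omega>)\<^sup>2 = 1" using w by (simp add: cmod_def)
  have lin: "A *v (x + y) = A *v x + A *v y" "A *v (k *s x) = k *s (A *v x)" for x y k
    by (simp_all add: matrix_vector_right_distrib vector_scalar_commute)
  have lin': "A *v (x - y) = A *v x - A *v y" for x y by (rule matrix_vector_mult_diff_distrib)
  have vi: "f ?v i = c\<^sup>2 * f u i + s\<^sup>2 * f u j + 2 * c * s * Re (\<omega> * m)"
  proof -
    have "f ?v i = c\<^sup>2 * f u i + s\<^sup>2 * ((Re \<omega>)\<^sup>2 + (Im \<omega>)\<^sup>2) * f u j + 2 * c * s * Re (\<omega> * m)"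
      unfolding f_def givens_def
      by (simp add: lin hip_add_left hip_add_right hip_scale_left hip_scale_right m' flip: m_def)
         (simp add: algebra_simps power2_eq_square)
    then show ?thesis by (simp add: ww)
  qed
  have vj: "f ?v j = s\<^sup>2 * f u i + c\<^sup>2 * f u j - 2 * c * s * Re (\<omega> * m)"
  proof -
    have "f ?v j = s\<^sup>2 * ((Re \<omega>)\<^sup>2 + (Im \<omega>)\<^sup>2) * f u i + c\<^sup>2 * f u j - 2 * c * s * Re (\<omega> * m)"
      unfolding f_def givens_def using ij
      by (simp add: lin lin' hip_add_left hip_add_right hip_diff_left hip_diff_right hip_scale_left hip_scale_right m' flip: m_def)
         (simp add: algebra_simps power2_eq_square)
    then show ?thesis by (simp add: ww)
  qed
  have vl: "f ?v l = f u l" if "l \<noteq> i" "l \<noteq> j" for l using that by (simp add: f_def givens_def)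
  have split: "(\<Sum>l\<in>UNIV. g l) = g i + g j + (\<Sum>l\<in>UNIV - {i} - {j}. g l)" for g :: "'a \<Rightarrow> real"
    using ij by (simp add: sum.remove[of UNIV i] sum.remove[of "UNIV - {i}" j])
  have "weighted_trace w A ?v - weighted_trace w A u = w i * (f ?v i - f u i) + w j * (f ?v j - f u j)"
  proof -
    have tr: "weighted_trace w A v = (\<Sum>l\<in>UNIV. w l * f v l)" for v by (simp add: weighted_trace_def f_def)
    show ?thesis unfolding tr by (simp add: split vl algebra_simps)
  qed
  also have "\<dots> = (w i - w j) * (s\<^sup>2 * (f u j - f u i) + 2 * c * s * Re (\<omega> * m))"
  proof -
    have c2: "c\<^sup>2 = 1 - s\<^sup>2" using cs by simp
    show ?thesis unfolding vi vj c2 by (simp add: algebra_simps)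
  qed
  finally show ?thesis by (simp add: f_def m_def)
qed

lemma linear_dominated_by_quadratic_imp_zero:
  fixes r k :: real
  assumes "\<And>t. 2 * t * r \<le> t\<^sup>2 * k" shows "r = 0"
proof (rule ccontr)
  assume r: "r \<noteq> 0"
  \<comment> \<open>This denominator is positive and exceeds \<open>k\<close>, so for this
    \<open>t\<close> the right side is at most half of the left side.\<close>
  define t where "t = r / (\<bar>k\<bar> + 1)"
  have "2 * t * r = 2 * r\<^sup>2 / (\<bar>k\<bar> + 1)" by (simp add: t_def power2_eq_square)
  moreover have "t\<^sup>2 * k \<le> r\<^sup>2 / (\<bar>k\<bar> + 1)"
  proof -
    have "t\<^sup>2 * k \<le> t\<^sup>2 * (\<bar>k\<bar> + 1)" by (intro mult_left_mono) auto
    also have "\<dots> = r\<^sup>2 / (\<bar>k\<bar> + 1)" by (simp add: t_def power2_eq_square)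
    finally show ?thesis .
  qed
  moreover have "r\<^sup>2 / (\<bar>k\<bar> + 1) > 0" using r by (simp add: add_nonneg_pos)
  ultimately show False using assms[of t] by linarith
qed

text \<open>Rotating two frame vectors cannot increase the weighted trace. To first order in the angle this kills
  the off-diagonal entry, and for the quarter turn it yields the monotonicity of the diagonal.\<close>

lemma maximal_frame_diagonalizes:
  fixes w :: "'d::{finite,linorder} \<Rightarrow> real"
  assumes A: "A \<in> Herm" and w: "strict_mono w" and u: "u \<in> unitary_frames"
    and max: "\<And>v. v \<in> unitary_frames \<Longrightarrow> weighted_trace w A v \<le> weighted_trace w A u"
  shows "i \<noteq> j \<Longrightarrow> hip (u$i) (A *v u$j) = 0"
    and "i \<le> j \<Longrightarrow> Re (hip (u$i) (A *v u$i)) \<le> Re (hip (u$j) (A *v u$j))"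
proof -
  have key: "(w i - w j) * (s\<^sup>2 * (Re (hip (u$j) (A *v u$j)) - Re (hip (u$i) (A *v u$i)))
                      + 2 * c * s * Re (\<omega> * hip (u$i) (A *v u$j))) \<le> 0"
    if "i \<noteq> j" "c\<^sup>2 + s\<^sup>2 = 1" "norm \<omega> = 1" for c s \<omega> i j
    using weighted_trace_givens[OF A that, of w u] max[OF givens_unitary_frame[OF u that]] by linarith
  show "Re (hip (u$i) (A *v u$i)) \<le> Re (hip (u$j) (A *v u$j))" if "i \<le> j"
  proof (cases "i = j")
    case False
    then have "w i < w j" using w that by (simp add: strict_mono_def)
    \<comment> \<open>Cosine 0 and sine 1: the cross term vanishes, and the change is
      \<open>w i - w j\<close> times the difference of the two diagonal entries.\<close>
    then show ?thesis using key[OF False, of 0 1 1] by (simp add: mult_le_0_iff)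
  qed simp
  show "hip (u$i) (A *v u$j) = 0" if ij: "i \<noteq> j"
  proof (rule ccontr)
    define m where "m = hip (u$i) (A *v u$j)"
    define k where "k = Re (hip (u$i) (A *v u$i)) - Re (hip (u$j) (A *v u$j))"
    assume "hip (u$i) (A *v u$j) \<noteq> 0"
    then have m: "m \<noteq> 0" by (simp add: m_def)
    \<comment> \<open>This phase turns \<open>m\<close> into its modulus, so the first-order term in
      the angle does not vanish.\<close>
    define \<omega> where "\<omega> = cnj m / of_real (norm m)"
    have \<omega>: "norm \<omega> = 1" using m by (simp add: \<omega>_def norm_divide)
    have "\<omega> * m = of_real (norm m)"
      using m complex_norm_square[of m] by (simp add: \<omega>_def field_simps power2_eq_square)
    then have re: "Re (\<omega> * m) = norm m" by simp
    have wij: "w i - w j \<noteq> 0" using w ij by (simp add: strict_mono_eq)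
    have "2 * t * ((w i - w j) * norm m) \<le> t\<^sup>2 * ((w i - w j) * k)" for t :: real
    proof -
      \<comment> \<open>Dividing (1, t) by its length gives a point of the unit circle, so
        \<open>t\<close> is the tangent of the angle; multiplying by \<open>n\<^sup>2\<close> leaves
        a quadratic inequality in \<open>t\<close>.\<close>
      define n where "n = sqrt (1 + t\<^sup>2)"
      have n: "n > 0" "n\<^sup>2 = 1 + t\<^sup>2" by (auto simp: n_def add_pos_nonneg)
      have "(1/n)\<^sup>2 + (t/n)\<^sup>2 = 1" using n by (simp add: power_divide add_nonneg_eq_0_iff flip: add_divide_distrib)
      from key[OF ij this \<omega>] have "(w i - w j) * ((t/n)\<^sup>2 * (- k) + 2 * (1/n) * (t/n) * norm m) \<le> 0"
        unfolding m_def[symmetric] re by (simp only: k_def minus_diff_eq)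
      moreover have "(w i - w j) * ((t/n)\<^sup>2 * (- k) + 2 * (1/n) * (t/n) * norm m)
         = (2 * t * ((w i - w j) * norm m) - t\<^sup>2 * ((w i - w j) * k)) / n\<^sup>2"
        using n(1) by (simp add: field_simps power2_eq_square)
      ultimately show ?thesis using n(1) by (simp add: divide_le_0_iff)
    qed
    from linear_dominated_by_quadratic_imp_zero[OF this] show False using wij m by simp
  qed
qed

section \<open>The characteristic polynomial in a diagonalising frame\<close>

lemma map_matrix_const_poly_mult:
  fixes A :: "'a::comm_ring_1^'n^'m"
  shows "map_matrix (\<lambda>z. [:z:]) (A ** B) = map_matrix (\<lambda>z. [:z:]) A ** map_matrix (\<lambda>z. [:z:]) B"
  by (simp add: matrix_matrix_mult_def map_matrix_def vec_eq_iff mult_to_poly sum_to_poly mult.commute)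

text \<open>The scalar matrix of the variable commutes with everything, so conjugation passes to the
  characteristic matrix, and the determinants of the outer factors multiply to 1.\<close>

lemma charpoly_similar:
  fixes A P Q :: "complex^'n^'n"
  assumes "Q ** P = mat 1"
  shows "charpoly (Q ** A ** P) = charpoly A"
proof -
  let ?c = "map_matrix (\<lambda>z::complex. [:z:])"
  have dist: "X ** (Y - Z) = X ** Y - X ** Z" "(Y - Z) ** X = Y ** X - Z ** X" for X Y Z :: "complex poly^'n^'n"
    by (simp_all add: matrix_matrix_mult_def vec_eq_iff algebra_simps sum_subtractf)
  have sc: "X ** mat [:0,1:] = mat [:0,1:] ** X" for X :: "complex poly^'n^'n"
    by (simp add: matrix_matrix_mult_def vec_eq_iff mat_def if_distrib if_distribR mult.commute cong: if_cong)
  have c1: "?c (mat 1) = mat 1" by (simp add: vec_eq_iff mat_def one_pCons)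
  have QP: "?c Q ** ?c P = mat 1" using assms by (simp add: c1 flip: map_matrix_const_poly_mult)
  have "mat [:0,1:] - ?c (Q ** A ** P) = ?c Q ** (mat [:0,1:] - ?c A) ** ?c P"
  proof -
    have "?c Q ** mat [:0,1:] = mat [:0,1:] ** ?c Q" by (rule sc)
    then have "?c Q ** mat [:0,1:] ** ?c P = mat [:0,1:] ** (?c Q ** ?c P)" by (simp only: matrix_mul_assoc)
    then have "?c Q ** mat [:0,1:] ** ?c P = mat [:0,1:]" by (simp only: QP matrix_mul_rid)
    then show ?thesis by (simp only: dist map_matrix_const_poly_mult)
  qed
  then have "charpoly (Q ** A ** P) = det (?c Q) * charpoly A * det (?c P)"
    by (simp add: charpoly_def det_mul)
  also have "\<dots> = charpoly A * det (?c Q ** ?c P)" by (simp add: det_mul)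
  finally show ?thesis by (simp add: QP)
qed

lemma charpoly_diagonal:
  assumes "\<And>i j. i \<noteq> j \<Longrightarrow> D$i$j = 0"
  shows "charpoly D = (\<Prod>i\<in>UNIV. [:- D$i$i, 1:])"
  unfolding charpoly_def
  by (subst det_diagonal) (auto simp: mat_def assms)

text \<open>Entry (i, j) of \<open>Q ** A ** P\<close> is \<open>hip (u$i) (A *v u$j)\<close>, which
  vanishes off the diagonal at a maximiser. The polynomial therefore splits into linear factors, and
  the multiset records the multiplicities.\<close>

lemma proots_charpoly_Herm:
  fixes w :: "'d::{finite,linorder} \<Rightarrow> real"
  assumes A: "A \<in> Herm" and w: "strict_mono w" and u: "u \<in> unitary_frames"
    and max: "\<And>v. v \<in> unitary_frames \<Longrightarrow> weighted_trace w A v \<le> weighted_trace w A u"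
  shows "proots (charpoly A) = image_mset (\<lambda>i. hip (u$i) (A *v u$i)) (mset_set UNIV)"
proof -
  define Q where "Q = (\<chi> i k. cnj (u$i$k))"
  define P where "P = transpose u"
  have QP: "Q ** P = mat 1"
    using u by (auto simp: Q_def P_def unitary_frames_def hip_def matrix_matrix_mult_def transpose_def mat_def vec_eq_iff)
  have D: "(Q ** A ** P)$i$j = hip (u$i) (A *v u$j)" for i j
    unfolding matrix_mul_assoc[symmetric]
    by (simp add: Q_def P_def hip_def matrix_matrix_mult_def transpose_def matrix_vector_mult_def)
  have "charpoly A = charpoly (Q ** A ** P)" by (simp add: charpoly_similar[OF QP])
  also have "\<dots> = (\<Prod>i\<in>UNIV. [:- hip (u$i) (A *v u$i), 1:])"
    by (subst charpoly_diagonal) (auto simp: D maximal_frame_diagonalizes(1)[OF assms])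
  finally have eq: "charpoly A = (\<Prod>i\<in>UNIV. [:- hip (u$i) (A *v u$i), 1:])" .
  show ?thesis unfolding eq
    by (subst proots_prod) (auto simp: sum_unfold_sum_mset)
qed

text \<open>In a strictly increasing list exactly p entries lie below the entry at position p, so
  counting smaller indices recovers the position used in \<open>eigvals_incr\<close>.\<close>

lemma nth_sorted_list_of_UNIV:
  fixes i :: "'d::{finite,linorder}"
  shows "sorted_list_of_set UNIV ! card {k. k < i} = i" and "card {k. k < i} < length (sorted_list_of_set (UNIV :: 'd set))"
proof -
  define l where "l = sorted_list_of_set (UNIV :: 'd set)"
  have l: "sorted_wrt (<) l" "set l = UNIV" by (simp_all add: l_def strict_sorted_list_of_set)
  obtain p where p: "p < length l" "l ! p = i" using l(2) by (metis UNIV_I in_set_conv_nth)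
  have lt: "l ! a < l ! b \<longleftrightarrow> a < b" if "a < length l" "b < length l" for a b
    using l(1) that by (metis linorder_neqE_nat order_less_asym order_less_irrefl sorted_wrt_nth_less)
  have "{k. k < i} = (!) l ` {..<p}"
  proof (intro set_eqI iffI)
    fix k assume "k \<in> {k. k < i}"
    moreover obtain a where "a < length l" "l ! a = k" using l(2) by (metis UNIV_I in_set_conv_nth)
    ultimately show "k \<in> (!) l ` {..<p}" using lt p by blast
  qed (use lt p in auto)
  moreover have "inj_on ((!) l) {..<p}"
    using lt p(1) by (intro linorder_inj_onI') (metis dual_order.strict_trans lessThan_iff less_irrefl)
  ultimately have "card {k. k < i} = p" by (simp add: card_image)
  then show "sorted_list_of_set UNIV ! card {k. k < i} = i" "card {k. k < i} < length (sorted_list_of_set (UNIV :: 'd set))"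
    using p by (simp_all add: l_def)
qed

text \<open>A sorted list is determined by its multiset, so a monotone labelling of the roots must
  be the ordered one.\<close>

lemma eigvals_incr_eqI:
  assumes "image_mset Re (proots (charpoly A)) = image_mset m (mset_set UNIV)" "mono m"
  shows "eigvals_incr A $ i = m i"
proof -
  let ?l = "sorted_list_of_set (UNIV :: 'a set)"
  have "image_mset m (mset_set UNIV) = mset (map m ?l)" by (metis mset_map mset_sorted_list_of_multiset sorted_list_of_mset_set)
  moreover have "sorted (map m ?l)"
    using \<open>mono m\<close> by (intro sorted_map_mono) (auto simp: mono_on_def mono_def)
  ultimately have "sorted_list_of_multiset (image_mset Re (proots (charpoly A))) = map m ?l"
    by (metis assms(1) sorted_list_of_multiset_mset sort_key_id_if_sorted sorted_sort_id)
  then show ?thesis using nth_sorted_list_of_UNIV[of i] by (simp add: eigvals_incr_def)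
qed

section \<open>The maximal weighted trace as a convex Lipschitz function\<close>

text \<open>The support function of the set of Hermitian matrices with eigenvalues
  \<open>w i\<close>. As a supremum of real-linear functionals of \<open>A\<close> it is convex on
  the whole matrix space.\<close>

definition max_weighted_trace :: "('d \<Rightarrow> real) \<Rightarrow> complex^'d^'d \<Rightarrow> real" where
  "max_weighted_trace w A = (SUP u\<in>unitary_frames. weighted_trace w A u)"

lemma max_weighted_trace_attained:
  obtains u where "u \<in> unitary_frames" "max_weighted_trace w A = weighted_trace w A u"
    "\<And>v. v \<in> unitary_frames \<Longrightarrow> weighted_trace w A v \<le> weighted_trace w A u"
proof -
  obtain u where u: "u \<in> unitary_frames" "\<And>v. v \<in> unitary_frames \<Longrightarrow> weighted_trace w A v \<le> weighted_trace w A u"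
    using weighted_trace_attains_sup[of w A] by metis
  then have "max_weighted_trace w A = weighted_trace w A u"
    unfolding max_weighted_trace_def by (intro cSup_eq_maximum) auto
  with u that show ?thesis by blast
qed

lemma weighted_trace_le_max:
  assumes "v \<in> unitary_frames"
  shows "weighted_trace w A v \<le> max_weighted_trace w A"
  using max_weighted_trace_attained[of w A] assms by metis

lemma convex_on_max_weighted_trace: "convex_on UNIV (max_weighted_trace w)"
proof (intro convex_onI)
  fix t :: real and A B :: "complex^'a^'a" assume t: "0 < t" "t < 1"
  obtain u where u: "u \<in> unitary_frames"
     "max_weighted_trace w ((1 - t) *\<^sub>R A + t *\<^sub>R B) = weighted_trace w ((1 - t) *\<^sub>R A + t *\<^sub>R B) u"
    by (rule max_weighted_trace_attained)
  then show "max_weighted_trace w ((1 - t) *\<^sub>R A + t *\<^sub>R B) \<le> (1 - t) * max_weighted_trace w A + t * max_weighted_trace w B"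
    using t weighted_trace_le_max[OF u(1)]
    by (auto simp: weighted_trace_add weighted_trace_scaleR intro!: add_mono mult_left_mono)
qed auto

text \<open>A frame that is optimal for \<open>A\<close> is admissible for \<open>B\<close>, so the
  difference of the maxima is at most a weighted trace of \<open>A - B\<close>; exchanging the roles
  gives the other sign.\<close>

lemma lipschitz_max_weighted_trace:
  obtains L where "L-lipschitz_on UNIV (max_weighted_trace w)"
proof -
  obtain L where L: "L \<ge> 0" "\<And>A u. u \<in> unitary_frames \<Longrightarrow> \<bar>weighted_trace w A u\<bar> \<le> L * norm (A :: complex^'a^'a)"
    by (rule weighted_trace_bound[of w]) blast
  have le: "max_weighted_trace w A - max_weighted_trace w B \<le> L * dist A B" for A B
  proof -
    obtain u where u: "u \<in> unitary_frames" "max_weighted_trace w A = weighted_trace w A u"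
      by (rule max_weighted_trace_attained)
    have "max_weighted_trace w A - max_weighted_trace w B \<le> weighted_trace w (A - B) u"
      using u weighted_trace_le_max[OF u(1), of w B] by (simp add: weighted_trace_diff)
    also have "\<dots> \<le> L * dist A B" using L(2)[OF u(1), of "A - B"] by (simp add: dist_norm)
    finally show ?thesis .
  qed
  have "L-lipschitz_on UNIV (max_weighted_trace w)"
  proof (rule lipschitz_onI)
    fix A B :: "complex^'a^'a"
    show "dist (max_weighted_trace w A) (max_weighted_trace w B) \<le> L * dist A B"
      using le[of A B] le[of B A] by (simp add: dist_real_def dist_commute abs_le_iff)
  qed (use L(1) in auto)
  then show ?thesis using that by blast
qed

lemma max_weighted_trace_Herm:
  assumes A: "A \<in> Herm" and w: "strict_mono w"
  shows "max_weighted_trace w A = (\<Sum>i\<in>UNIV. w i * eigvals_incr A $ i)"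
proof -
  obtain u where u: "u \<in> unitary_frames" "max_weighted_trace w A = weighted_trace w A u"
    and max: "\<And>v. v \<in> unitary_frames \<Longrightarrow> weighted_trace w A v \<le> weighted_trace w A u"
    using max_weighted_trace_attained by metis
  have "eigvals_incr A $ i = Re (hip (u$i) (A *v u$i))" for i
  proof (rule eigvals_incr_eqI)
    show "image_mset Re (proots (charpoly A)) = image_mset (\<lambda>i. Re (hip (u$i) (A *v u$i))) (mset_set UNIV)"
      by (subst proots_charpoly_Herm[OF A w u(1) max]) (simp_all add: multiset.map_comp comp_def)
    show "mono (\<lambda>i. Re (hip (u$i) (A *v u$i)))"
      using maximal_frame_diagonalizes(2)[OF A w u(1) max] by (auto intro: monoI)
  qed
  then show ?thesis by (simp add: u(2) weighted_trace_def)
qed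

text \<open>Rank weights are at distance at least \<open>1\<close> from each other, so raising a single one by \<open>1/2\<close> keeps them
  strictly increasing, and twice the effect on the weighted trace is the corresponding eigenvalue.\<close>

definition rank_weight :: "'d::{finite,linorder} \<Rightarrow> real" where
  "rank_weight i = real (card {k. k < i})"

definition bumped_weight :: "'d::{finite,linorder} \<Rightarrow> 'd \<Rightarrow> real" where
  "bumped_weight i k = rank_weight k + of_bool (k = i) / 2"

lemma rank_weight_less: "i < j \<Longrightarrow> rank_weight i + 1 \<le> rank_weight j"
proof -
  assume "i < j"
  then have "{k. k < i} \<subset> {k. k < j}" by (auto dest: less_trans)
  then have "card {k. k < i} < card {k. k < j}" by (simp add: psubset_card_mono)
  then show ?thesis by (simp add: rank_weight_def)
qed

lemma strict_mono_weights: "strict_mono rank_weight" "strict_mono (bumped_weight i)"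
  by (auto intro!: strict_monoI simp: bumped_weight_def dest!: rank_weight_less split: if_splits)

lemma eigvals_incr_max_weighted_trace:
  assumes "A \<in> Herm"
  shows "eigvals_incr A $ i = 2 * max_weighted_trace (bumped_weight i) A - 2 * max_weighted_trace rank_weight A"
  unfolding max_weighted_trace_Herm[OF assms strict_mono_weights(1)] max_weighted_trace_Herm[OF assms strict_mono_weights(2)]
  by (simp add: bumped_weight_def algebra_simps sum.distrib sum_distrib_left)

section \<open>Smooth cut-off functions\<close>

lemma partial_eqI: "(\<phi> has_derivative D) (at x) \<Longrightarrow> partial j \<phi> x = D (axis j 1)"
  by (metis frechet_derivative_at partial_def)

text \<open>\<open>C_k\<close> refers to \<open>frechet_derivative\<close>; this rule accepts any
  derivative at hand and carries the induction steps below.\<close>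

lemma C_k_SucI:
  assumes "\<And>x. (\<phi> has_derivative D x) (at x)" "\<And>j. C_k k (\<lambda>x. D x (axis j 1))"
  shows "C_k (Suc k) \<phi>"
proof -
  have "partial j \<phi> = (\<lambda>x. D x (axis j 1))" for j using partial_eqI[OF assms(1)] by blast
  then show ?thesis using assms by (auto simp: differentiable_def)
qed

lemma C_k_Suc_imp: "C_k (Suc k) \<phi> \<Longrightarrow> C_k k \<phi>"
proof (induction k arbitrary: \<phi>)
  case 0
  then show ?case
    by (simp add: continuous_at_imp_continuous_on differentiable_imp_continuous_within)
qed (metis C_k.simps(2))

lemma C_k_imp_has_derivative:
  "C_k (Suc k) \<phi> \<Longrightarrow> (\<phi> has_derivative frechet_derivative \<phi> (at x)) (at x)"
  by (simp add: frechet_derivative_works)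

lemma C_k_const: "C_k k (\<lambda>x. c)"
proof (induction k arbitrary: c)
  case (Suc k)
  show ?case by (rule C_k_SucI[where D="\<lambda>_ _. 0"]) (auto intro: Suc)
qed simp

lemma C_k_add: "C_k k f \<Longrightarrow> C_k k g \<Longrightarrow> C_k k (\<lambda>x. f x + g x)"
proof (induction k arbitrary: f g)
  case (Suc k)
  show ?case
    by (rule C_k_SucI[OF has_derivative_add[OF Suc.prems[THEN C_k_imp_has_derivative]]])
       (use Suc in \<open>auto simp flip: partial_def\<close>)
qed (simp add: continuous_on_add continuous_on_mult)

lemma C_k_mult: "C_k k f \<Longrightarrow> C_k k g \<Longrightarrow> C_k k (\<lambda>x. f x * g x)"
proof (induction k arbitrary: f g)
  case (Suc k)
  show ?case
    by (rule C_k_SucI[OF has_derivative_mult[OF Suc.prems[THEN C_k_imp_has_derivative]]])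
       (use Suc Suc.prems[THEN C_k_Suc_imp] in \<open>auto simp flip: partial_def intro!: C_k_add Suc.IH\<close>)
qed (simp add: continuous_on_add continuous_on_mult)

lemma C_k_diff: "C_k k f \<Longrightarrow> C_k k g \<Longrightarrow> C_k k (\<lambda>x. f x - g x)"
  using C_k_add[of k f "\<lambda>x. -1 * g x"] C_k_mult[OF C_k_const[of k "-1"], of g] by simp

lemma C_k_power: "C_k k f \<Longrightarrow> C_k k (\<lambda>x. f x ^ n)"
  by (induction n) (auto intro: C_k_const C_k_mult)

lemma C_k_prod: "(\<And>i. i \<in> I \<Longrightarrow> C_k k (f i)) \<Longrightarrow> C_k k (\<lambda>x. \<Prod>i\<in>I. f i x)"
  by (induction I rule: infinite_finite_induct) (auto intro: C_k_const C_k_mult)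

lemma partial_translate:
  assumes "\<phi> differentiable at (x - y)"
  shows "partial j (\<lambda>x. \<phi> (x - y)) x = partial j \<phi> (x - y)"
proof -
  have "((\<lambda>x. \<phi> (x - y)) has_derivative frechet_derivative \<phi> (at (x - y))) (at x)"
    by (rule has_derivative_compose[of "\<lambda>x. x - y", where f'="\<lambda>h. h", THEN has_derivative_eq_rhs])
       (use assms in \<open>auto simp: frechet_derivative_works intro!: derivative_eq_intros\<close>)
  from partial_eqI[OF this] show ?thesis by (simp add: partial_def)
qed

lemma C_k_translate: "C_k k \<phi> \<Longrightarrow> C_k k (\<lambda>x. \<phi> (x - y))"
proof (induction k arbitrary: \<phi>)
  case 0
  have "continuous_on UNIV (\<lambda>x. \<phi> (x - y))"
    by (rule continuous_on_compose2[of UNIV \<phi>]) (use 0 in \<open>simp_all add: continuous_on_diff\<close>)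
  then show ?case by simp
next
  case (Suc k)
  have d: "\<phi> differentiable at x" for x using Suc.prems by simp
  have "((\<lambda>x. \<phi> (x - y)) has_derivative frechet_derivative \<phi> (at (x - y))) (at x)" for x
    by (rule has_derivative_compose[of "\<lambda>x. x - y", where f'="\<lambda>h. h", THEN has_derivative_eq_rhs])
       (use d[of "x - y"] in \<open>auto simp: frechet_derivative_works intro!: derivative_eq_intros\<close>)
  then show ?case
    by (rule C_k_SucI) (use Suc in \<open>auto simp flip: partial_def\<close>)
qed

section \<open>Flat functions, bumps on boxes and cut-offs\<close>

text \<open>\<open>flat 0\<close> is the classical exp(-1/t), extended by 0. The powers are included
  because the derivative of \<open>flat k\<close> combines \<open>flat (k + 2)\<close> and
  \<open>flat (k + 1)\<close>: the family is closed under differentiation up to linear combinations,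
  and smoothness becomes an induction.\<close>

definition flat :: "nat \<Rightarrow> real \<Rightarrow> real" where
  "flat k t = (if t > 0 then inverse t ^ k / exp (inverse t) else 0)"

lemma flat_tendsto_0: "(flat k \<longlongrightarrow> 0) (at 0)"
proof -
  have "((\<lambda>t::real. inverse t ^ k / exp (inverse t)) \<longlongrightarrow> 0) (at_right 0)"
    by (rule filterlim_compose[OF tendsto_power_div_exp_0 filterlim_inverse_at_top_right])
  then have "(flat k \<longlongrightarrow> 0) (at_right 0)"
    by (rule Lim_transform_eventually) (auto simp: flat_def eventually_at_filter)
  moreover have "(flat k \<longlongrightarrow> 0) (at_left 0)"
    by (rule Lim_transform_eventually[OF tendsto_const]) (auto simp: flat_def eventually_at_filter)
  ultimately show ?thesis by (simp add: filterlim_at_split)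
qed

lemma flat_has_derivative:
  "(flat k has_real_derivative flat (Suc (Suc k)) t - real k * flat (Suc k) t) (at t)"
proof (cases "t = 0")
  case True
  \<comment> \<open>At 0 the difference quotient of \<open>flat k\<close> is
    \<open>flat (Suc k)\<close>, which tends to 0.\<close>
  have "((\<lambda>h. (flat k (0 + h) - flat k 0) / h) \<longlongrightarrow> 0) (at 0)"
    by (rule Lim_transform_eventually[OF flat_tendsto_0[of "Suc k"]])
       (auto simp: flat_def eventually_at_filter field_simps)
  then have "(flat k has_real_derivative 0) (at 0)" by (simp add: DERIV_def)
  then show ?thesis using True by (simp add: flat_def)
next
  case False
  show ?thesis
  proof (cases "t > 0")
    case True
    define y where "y = inverse t"
    have "((\<lambda>t. inverse t ^ k * exp (- inverse t)) has_real_derivative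
       (real k * y ^ (k - 1) * (- (y * y))) * exp (- y) + y ^ k * (exp (- y) * (y * y))) (at t)"
      using True by (auto intro!: derivative_eq_intros simp: y_def)
    moreover have "(real k * y ^ (k - 1) * (- (y * y))) * exp (- y) + y ^ k * (exp (- y) * (y * y))
        = flat (Suc (Suc k)) t - real k * flat (Suc k) t"
      \<comment> \<open>For \<open>k = 0\<close> the exponent \<open>k - 1\<close> truncates to 0,
        and the factor \<open>real k\<close> removes the term.\<close>
      using True by (cases k) (simp_all add: flat_def exp_minus divide_inverse algebra_simps flip: y_def)
    ultimately have "((\<lambda>t. inverse t ^ k * exp (- inverse t)) has_real_derivative
       flat (Suc (Suc k)) t - real k * flat (Suc k) t) (at t)" by simp
    then show ?thesis
      by (rule has_field_derivative_transform_within_open[of _ _ _ "{0<..}"])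
         (use True in \<open>auto simp: flat_def exp_minus divide_inverse\<close>)
  next
    case neg: False
    have "((\<lambda>t. 0) has_real_derivative flat (Suc (Suc k)) t - real k * flat (Suc k) t) (at t)"
      using neg by (simp add: flat_def)
    then show ?thesis
      by (rule has_field_derivative_transform_within_open[of _ _ _ "{..<0}"])
         (use False neg in \<open>auto simp: flat_def\<close>)
  qed
qed

text \<open>The exponent \<open>n\<close> varies in the induction since differentiation raises it;
  slopes \<open>s\<close> of both signs serve opposite faces of a box.\<close>

lemma C_k_flat: "C_k k (\<lambda>x. flat n (s * x$i + c))"
proof (induction k arbitrary: n)
  case 0
  have c: "continuous_on UNIV (flat n)"
    using flat_has_derivative[THEN DERIV_isCont] by (simp add: continuous_at_imp_continuous_on)
  have "continuous_on UNIV (\<lambda>x::real^'a. flat n (s * x$i + c))"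
    by (rule continuous_on_compose2[OF c]) (intro continuous_intros, simp)
  then show ?case by simp
next
  case (Suc k)
  let ?t = "\<lambda>x::real^'a. s * x$i + c"
  show ?case
  proof (rule C_k_SucI)
    fix x :: "real^'a"
    have "(?t has_derivative (\<lambda>h. s * h$i)) (at x)"
      by (auto intro!: derivative_eq_intros bounded_linear.has_derivative[OF bounded_linear_vec_nth])
    from has_derivative_compose[OF this flat_has_derivative[unfolded has_field_derivative_def]]
    show "((\<lambda>x. flat n (?t x)) has_derivative
       (\<lambda>h. (flat (Suc (Suc n)) (?t x) - real n * flat (Suc n) (?t x)) * (s * h$i))) (at x)" .
  next
    fix j
    show "C_k k (\<lambda>x. (flat (Suc (Suc n)) (?t x) - real n * flat (Suc n) (?t x)) * (s * axis j 1 $ i))"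
      by (intro C_k_mult C_k_diff C_k_const Suc)
  qed
qed

lemma flat_0_bounds: "0 \<le> flat 0 t" "flat 0 t \<le> 1" "flat 0 t > 0 \<longleftrightarrow> t > 0" "flat 0 t = 0 \<longleftrightarrow> t \<le> 0"
  by (auto simp: flat_def divide_le_eq)

definition box_bump :: "real^'m \<Rightarrow> real^'m \<Rightarrow> real^'m \<Rightarrow> real" where
  "box_bump a b x = (\<Prod>i\<in>UNIV. flat 0 (x$i - a$i) * flat 0 (b$i - x$i))"

lemma C_k_box_bump: "C_k k (box_bump a b)"
  unfolding box_bump_def
proof (intro C_k_prod C_k_mult)
  show "C_k k (\<lambda>x. flat 0 (x$i - a$i))" for i using C_k_flat[of k 0 1 i "- a$i"] by simp
  show "C_k k (\<lambda>x. flat 0 (b$i - x$i))" for i using C_k_flat[of k 0 "-1" i "b$i"] by simp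
qed

lemma box_bump_bounds: "0 \<le> box_bump a b x" "box_bump a b x \<le> 1"
  unfolding box_bump_def by (auto intro!: prod_nonneg prod_le_1 mult_le_one simp: flat_0_bounds)

lemma box_bump_eq_0_iff: "box_bump a b x = 0 \<longleftrightarrow> x \<notin> box a b"
  by (auto simp: box_bump_def flat_0_bounds mem_box_cart not_less)

text \<open>Finitely many boxes with closures in \<open>V\<close> cover \<open>K\<close>. One minus
  the product of the complements of their bumps is positive wherever some bump is, and, unlike the
  sum of the bumps, it stays in [0, 1].\<close>

lemma test_function_compact_cutoff:
  fixes K :: "(real^'m) set"
  assumes K: "compact K" and V: "open V" "K \<subseteq> V"
  obtains b where "b \<in> test_functions V" "\<And>x. 0 \<le> b x" "\<And>x. b x \<le> 1" "\<And>x. x \<in> K \<Longrightarrow> b x > 0"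
proof -
  have "\<exists>p. x \<in> box (fst p) (snd p) \<and> cbox (fst p) (snd p) \<subseteq> V" if "x \<in> K" for x
    using open_contains_cbox[of V] V that by (metis fst_conv snd_conv subsetD)
  then obtain p where p: "\<And>x. x \<in> K \<Longrightarrow> x \<in> box (fst (p x)) (snd (p x))"
      "\<And>x. x \<in> K \<Longrightarrow> cbox (fst (p x)) (snd (p x)) \<subseteq> V" by metis
  obtain T where T: "T \<subseteq> K" "finite T" "K \<subseteq> (\<Union>x\<in>T. box (fst (p x)) (snd (p x)))"
  proof (rule compactE_image[OF K, of K "\<lambda>x. box (fst (p x)) (snd (p x))"])
    show "K \<subseteq> (\<Union>x\<in>K. box (fst (p x)) (snd (p x)))" using p(1) by blast
  qed (auto simp: open_box)
  define f where "f x = (\<Prod>t\<in>T. 1 - box_bump (fst (p t)) (snd (p t)) x)" for x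
  define b where "b x = 1 - f x" for x
  have f: "0 \<le> f x" "f x \<le> 1" for x
    unfolding f_def by (auto intro!: prod_nonneg prod_le_1 simp: box_bump_bounds)
  let ?C = "\<Union>x\<in>T. cbox (fst (p x)) (snd (p x))"
  have supp: "{x. b x \<noteq> 0} \<subseteq> ?C"
  proof
    fix x assume "x \<in> {x. b x \<noteq> 0}"
    then have "f x \<noteq> 1" by (simp add: b_def)
    have "\<exists>t\<in>T. box_bump (fst (p t)) (snd (p t)) x \<noteq> 0"
    proof (rule ccontr)
      assume "\<not> (\<exists>t\<in>T. box_bump (fst (p t)) (snd (p t)) x \<noteq> 0)"
      then have "f x = 1" unfolding f_def by (intro prod.neutral) auto
      with \<open>f x \<noteq> 1\<close> show False by simp
    qed
    then show "x \<in> ?C" using box_subset_cbox by (auto simp: box_bump_eq_0_iff)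
  qed
  have C: "compact ?C" using T(2) by (intro compact_UN) auto
  then have cl: "closure {x. b x \<noteq> 0} \<subseteq> ?C" using supp by (simp add: closure_minimal compact_imp_closed)
  show ?thesis
  proof
    have "C_k k b" for k unfolding b_def f_def by (intro C_k_diff C_k_prod C_k_const C_k_box_bump)
    moreover have "compact (closure {x. b x \<noteq> 0})" 
      using bounded_subset[OF compact_imp_bounded[OF C] supp] by simp
    moreover have "?C \<subseteq> V" using p(2) T(1) by blast
    ultimately show "b \<in> test_functions V" using cl by (auto simp: test_functions_def)
    show "0 \<le> b x" "b x \<le> 1" for x using f[of x] by (auto simp: b_def)
    show "b x > 0" if x: "x \<in> K" for x
    proof -
      obtain t where t: "t \<in> T" "x \<in> box (fst (p t)) (snd (p t))" using T(3) x by blast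
      then have "box_bump (fst (p t)) (snd (p t)) x > 0"
        using box_bump_eq_0_iff box_bump_bounds(1) by (metis order_le_imp_less_or_eq)
      moreover have "f x = (1 - box_bump (fst (p t)) (snd (p t)) x) * (\<Prod>t\<in>T-{t}. 1 - box_bump (fst (p t)) (snd (p t)) x)"
        unfolding f_def using T(2) t(1) by (simp add: prod.remove)
      moreover have "(\<Prod>t\<in>T-{t}. 1 - box_bump (fst (p t)) (snd (p t)) x) \<le> 1"
         by (auto intro!: prod_le_1 simp: box_bump_bounds)
      moreover have "(\<Prod>t\<in>T-{t}. 1 - box_bump (fst (p t)) (snd (p t)) x) \<ge> 0"
         by (auto intro!: prod_nonneg simp: box_bump_bounds)
      ultimately have "f x < 1" using box_bump_bounds[of "fst (p t)" "snd (p t)" x]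
        by (smt (verit) mult_left_le)
      then show ?thesis by (simp add: b_def)
    qed
  qed
qed

section \<open>Translations in the space of integrable functions\<close>

lemma lebesgue_distr_translate:
  fixes y :: "'a::euclidean_space"
  shows "distr lebesgue lebesgue (\<lambda>x. x + y) = lebesgue" "(\<lambda>x. x + y) \<in> lebesgue \<rightarrow>\<^sub>M lebesgue"
proof -
  \<comment> \<open>Translation as an affine map with all scalings equal to 1, hence with density
    1.\<close>
  have eq: "(\<lambda>x. y + (\<Sum>j\<in>Basis. (1 * (x \<bullet> j)) *\<^sub>R j)) = (\<lambda>x::'a. x + y)"
    by (simp add: euclidean_representation add.commute)
  show "distr lebesgue lebesgue (\<lambda>x. x + y) = lebesgue"
    using lebesgue_affine_euclidean[of "\<lambda>_. 1" y] unfolding eq by (simp add: density_1)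
  show "(\<lambda>x. x + y) \<in> lebesgue \<rightarrow>\<^sub>M lebesgue"
    using lebesgue_affine_measurable[of "\<lambda>_. 1" y] unfolding eq by simp
qed

lemma integral_lebesgue_translate:
  fixes f :: "'a::euclidean_space \<Rightarrow> 'b::{banach, second_countable_topology}"
  assumes "f \<in> borel_measurable lebesgue"
  shows "integral\<^sup>L lebesgue (\<lambda>x. f (x + y)) = integral\<^sup>L lebesgue f"
  using integral_distr[OF lebesgue_distr_translate(2) assms, of y] by (simp add: lebesgue_distr_translate(1))

lemma integrable_lebesgue_translate:
  fixes f :: "'a::euclidean_space \<Rightarrow> 'b::{banach, second_countable_topology}"
  assumes "integrable lebesgue f"
  shows "integrable lebesgue (\<lambda>x. f (x + y))"
  using integrable_distr[OF lebesgue_distr_translate(2)[of y], of f] assms by (simp add: lebesgue_distr_translate(1))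

text \<open>Inner regularity in pointwise form: up to a null set \<open>P\<close> is a countable
  union of closed sets, hence of compact ones, and the finite partial unions increase to it.\<close>

lemma lebesgue_compact_exhaustion:
  fixes P :: "'a::euclidean_space set"
  assumes "P \<in> sets lebesgue"
  obtains K where "\<And>n. compact (K n)" "\<And>n. K n \<subseteq> P"
    "AE x in lebesgue. (\<lambda>n. indicator (K n) x :: real) \<longlonglongrightarrow> indicator P x"
proof -
  obtain C T where CT: "fsigma C" "T \<in> null_sets lebesgue" "C \<union> T = P"
    using lebesgue_set_almost_fsigma[OF assms] by metis
  obtain F :: "nat \<Rightarrow> 'a set" where F: "range F \<subseteq> Collect compact" "C = \<Union>(F ` UNIV)"
    using CT(1) fsigma_Union_compact by metis
  define K where "K n = (\<Union>i\<le>n. F i)" for n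
  have "AE x in lebesgue. x \<notin> T" using CT(2) by (rule AE_not_in)
  then have "AE x in lebesgue. (\<lambda>n. indicator (K n) x :: real) \<longlonglongrightarrow> indicator P x"
  proof eventually_elim
    case (elim x)
    have "\<forall>\<^sub>F n in sequentially. indicator (K n) x = (indicator P x :: real)"
    proof (cases "x \<in> P")
      case True
      then obtain i where "x \<in> F i" using elim CT(3) F(2) by auto
      then show ?thesis unfolding eventually_sequentially K_def using True by (intro exI[of _ i]) (auto simp: indicator_def)
    next
      case False
      then show ?thesis using CT(3) F(2) by (auto simp: K_def indicator_def)
    qed
    then show ?case by (rule tendsto_eventually)
  qed
  moreover have "compact (K n)" for n unfolding K_def using F(1) by (intro compact_UN) auto
  moreover have "K n \<subseteq> P" for n using CT(3) F(2) by (auto simp: K_def)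
  ultimately show ?thesis using that by blast
qed

section \<open>The L^1 modulus of continuity\<close>

definition translation_gap :: "('a::euclidean_space \<Rightarrow> real) \<Rightarrow> 'a \<Rightarrow> real" where
  "translation_gap f y = (LINT x|lebesgue. \<bar>f (x + y) - f x\<bar>)"

lemma translation_gap_add_le:
  assumes [simp]: "integrable lebesgue f" "integrable lebesgue g"
  shows "translation_gap (\<lambda>x. f x + g x) y \<le> translation_gap f y + translation_gap g y"
proof -
  note [simp] = assms[THEN integrable_lebesgue_translate]
  have "translation_gap (\<lambda>x. f x + g x) y \<le> (LINT x|lebesgue. \<bar>f (x + y) - f x\<bar> + \<bar>g (x + y) - g x\<bar>)"
    unfolding translation_gap_def by (intro integral_mono) auto
  then show ?thesis by (simp add: translation_gap_def)
qed

lemma translation_gap_le_norm: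
  assumes [simp]: "integrable lebesgue f"
  shows "translation_gap f y \<le> 2 * (LINT x|lebesgue. \<bar>f x\<bar>)"
proof -
  note [simp] = assms[THEN integrable_lebesgue_translate]
  have "translation_gap f y \<le> (LINT x|lebesgue. \<bar>f (x + y)\<bar> + \<bar>f x\<bar>)"
    unfolding translation_gap_def by (intro integral_mono) auto
  also have "\<dots> = 2 * (LINT x|lebesgue. \<bar>f x\<bar>)"
    using integral_lebesgue_translate[of "\<lambda>x. \<bar>f x\<bar>" y] by (simp add: borel_measurable_integrable)
  finally show ?thesis .
qed

lemma translation_gap_nonneg: "translation_gap f y \<ge> 0"
  by (simp add: translation_gap_def)

text \<open>The gap of \<open>f - g\<close> is at most twice its L^1 norm, whatever the shift. An
  approximation within \<open>e / 4\<close> thus costs \<open>e / 2\<close> and leaves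
  \<open>e / 2\<close> for \<open>g\<close>.\<close>

lemma translation_gap_L1_closed:
  assumes f: "integrable lebesgue f"
    and approx: "\<And>e. e > 0 \<Longrightarrow> \<exists>g. integrable lebesgue g \<and> (LINT x|lebesgue. \<bar>f x - g x\<bar>) < e \<and>
      (\<lambda>n. translation_gap g (Y n)) \<longlonglongrightarrow> 0"
  shows "(\<lambda>n. translation_gap f (Y n)) \<longlonglongrightarrow> 0"
proof (rule LIMSEQ_I)
  fix e :: real assume "e > 0"
  then obtain g where g: "integrable lebesgue g" "(LINT x|lebesgue. \<bar>f x - g x\<bar>) < e / 4"
    "(\<lambda>n. translation_gap g (Y n)) \<longlonglongrightarrow> 0" using approx[of "e / 4"] by auto
  have le: "translation_gap f y \<le> translation_gap g y + 2 * (LINT x|lebesgue. \<bar>f x - g x\<bar>)" for y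
    using translation_gap_add_le[of g "\<lambda>x. f x - g x" y] translation_gap_le_norm[of "\<lambda>x. f x - g x" y] f g(1) by simp
  obtain N where "\<And>n. n \<ge> N \<Longrightarrow> \<bar>translation_gap g (Y n)\<bar> < e / 2"
    using LIMSEQ_D[OF g(3), of "e/2"] \<open>e > 0\<close> by auto
  then have "norm (translation_gap f (Y n) - 0) < e" if "n \<ge> N" for n
    using le[of "Y n"] g(2) that translation_gap_nonneg[of f "Y n"] by fastforce
  then show "\<exists>N. \<forall>n\<ge>N. norm (translation_gap f (Y n) - 0) < e" by blast
qed

text \<open>The difference of indicators has integral zero, so its absolute value integrates to twice its
  positive part, and only points outside the compact set have to be considered.\<close>

lemma translation_gap_compact:
  fixes K :: "'a::euclidean_space set"
  assumes K: "compact K" and Y: "Y \<longlonglongrightarrow> 0"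
  shows "(\<lambda>n. translation_gap (indicator K) (Y n)) \<longlonglongrightarrow> 0"
proof -
  let ?k = "indicator K :: 'a \<Rightarrow> real"
  have [simp]: "K \<in> sets lebesgue" using K by (simp add: borel_compact)
  have int: "integrable lebesgue ?k"
    using lmeasurable_compact[OF K] by (intro integrable_real_indicator) (auto simp: fmeasurable_def)
  note int' = int[THEN integrable_lebesgue_translate]
  obtain B where B: "\<And>x. x \<in> K \<Longrightarrow> norm x \<le> B" using compact_imp_bounded[OF K] bounded_iff by metis
  obtain D where D: "\<And>n. norm (Y n) \<le> D" using convergent_imp_bounded[OF Y] by (auto simp: bounded_iff)
  have gap: "translation_gap ?k y = 2 * (LINT x|lebesgue. max 0 (?k (x + y) - ?k x))" for y
  proof -
    have "translation_gap ?k y = (LINT x|lebesgue. 2 * max 0 (?k (x + y) - ?k x) - (?k (x + y) - ?k x))"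
      unfolding translation_gap_def by (rule Bochner_Integration.integral_cong) (auto simp: indicator_def)
    also have "\<dots> = 2 * (LINT x|lebesgue. max 0 (?k (x + y) - ?k x)) - ((LINT x|lebesgue. ?k (x + y)) - (LINT x|lebesgue. ?k x))"
      using int int' by simp
    also have "(LINT x|lebesgue. ?k (x + y)) = (LINT x|lebesgue. ?k x)"
      by (rule integral_lebesgue_translate) (use int in \<open>rule borel_measurable_integrable\<close>)
    finally show ?thesis by simp
  qed
  have "(\<lambda>n. LINT x|lebesgue. max 0 (?k (x + Y n) - ?k x)) \<longlonglongrightarrow> (LINT x::'a|lebesgue. 0)"
  \<comment> \<open>A positive part occurs only if \<open>x + Y n\<close> is in \<open>K\<close>;
    with \<open>B\<close> bounding \<open>K\<close> and \<open>D\<close> bounding the shifts this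
    forces \<open>norm x \<le> B + D\<close>.\<close>
  proof (rule integral_dominated_convergence[where w="indicator (cball 0 (B + D))"])
    show "integrable lebesgue (indicator (cball (0::'a) (B + D)) :: 'a \<Rightarrow> real)"
      using lmeasurable_cball[of "0::'a" "B + D"] by (intro integrable_real_indicator) (auto simp: fmeasurable_def)
    show "AE x in lebesgue. norm (max 0 (?k (x + Y n) - ?k x)) \<le> indicator (cball 0 (B + D)) x" for n
    proof (rule AE_I2)
      fix x
      have "norm x \<le> B + D" if "x + Y n \<in> K"
        using norm_triangle_ineq4[of "x + Y n" "Y n"] B[OF that] D[of n] by simp
      then show "norm (max 0 (?k (x + Y n) - ?k x)) \<le> indicator (cball 0 (B + D)) x"
        by (auto simp: indicator_def)
    qed
    show "AE x in lebesgue. (\<lambda>n. max 0 (?k (x + Y n) - ?k x)) \<longlonglongrightarrow> 0"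
    proof (rule AE_I2)
      fix x
      have "\<forall>\<^sub>F n in sequentially. max 0 (?k (x + Y n) - ?k x) = 0"
      proof (cases "x \<in> K")
        case False
        have "(\<lambda>n. x + Y n) \<longlonglongrightarrow> x" using tendsto_add[OF tendsto_const Y, of x] by simp
        moreover have "open (- K)" using K by (simp add: compact_imp_closed open_Compl)
        ultimately have "\<forall>\<^sub>F n in sequentially. x + Y n \<in> - K" using False by (intro topological_tendstoD) auto
        then show ?thesis by eventually_elim auto
      qed (auto simp: indicator_def)
      then show "(\<lambda>n. max 0 (?k (x + Y n) - ?k x)) \<longlonglongrightarrow> 0"
        by (rule tendsto_eventually)
    qed
  qed (use int int' in \<open>auto intro!: borel_measurable_integrable\<close>)
  then have "(\<lambda>n. 2 * (LINT x|lebesgue. max 0 (?k (x + Y n) - ?k x))) \<longlonglongrightarrow> 2 * 0"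
    by (intro tendsto_mult tendsto_const) simp
  then show ?thesis by (simp add: gap)
qed

text \<open>Induction on the construction of integrable functions: indicators are approximated in
  L^1 from inside by compact sets, and limits are approximated by their dominated sequence.\<close>

lemma translation_gap_tendsto_0:
  fixes f :: "'a::euclidean_space \<Rightarrow> real"
  assumes "integrable lebesgue f" and Y: "Y \<longlonglongrightarrow> 0"
  shows "(\<lambda>n. translation_gap f (Y n)) \<longlonglongrightarrow> 0"
  using assms(1)
proof induction
  case (base A c)
  have A: "A \<in> lmeasurable" using base by (simp add: fmeasurableI top.not_eq_extremum)
  show ?case
  proof (rule translation_gap_L1_closed)
    show "integrable lebesgue (\<lambda>x. indicator A x *\<^sub>R c)" using base by auto
    fix e :: real assume e: "e > 0"
    obtain K where K: "\<And>n. compact (K n)" "\<And>n. K n \<subseteq> A"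
      "AE x in lebesgue. (\<lambda>n. indicator (K n) x :: real) \<longlonglongrightarrow> indicator A x"
      using lebesgue_compact_exhaustion[OF base(1)] by metis
    have Km: "K n \<in> lmeasurable" for n using K(1) by (rule lmeasurable_compact)
    have [measurable]: "A \<in> sets lebesgue" "K n \<in> sets lebesgue" for n using base(1) Km by auto
    have "(\<lambda>n. LINT x|lebesgue. \<bar>indicator A x *\<^sub>R c - indicator (K n) x * c\<bar>) \<longlonglongrightarrow> (LINT x::'a|lebesgue. (0::real))"
    proof (rule integral_dominated_convergence[where w="\<lambda>x. indicator A x * \<bar>c\<bar>"])
      show "AE x in lebesgue. (\<lambda>n. \<bar>indicator A x *\<^sub>R c - indicator (K n) x * c\<bar>) \<longlonglongrightarrow> 0"
        using K(3) by eventually_elim (auto intro!: tendsto_eq_intros)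
      show "AE x in lebesgue. norm \<bar>indicator A x *\<^sub>R c - indicator (K n) x * c\<bar> \<le> indicator A x * \<bar>c\<bar>" for n
        using K(2)[of n] by (intro AE_I2) (auto simp: indicator_def)
    qed (use base(2) in simp_all)
    then have "\<forall>\<^sub>F n in sequentially. (LINT x|lebesgue. \<bar>indicator A x *\<^sub>R c - indicator (K n) x * c\<bar>) < e"
      using e by (intro order_tendstoD) auto
    then obtain n where 1: "(LINT x|lebesgue. \<bar>indicator A x *\<^sub>R c - indicator (K n) x * c\<bar>) < e"
      by (auto simp: eventually_sequentially)
    let ?g = "\<lambda>x. indicator (K n) x * c"
    have "translation_gap ?g y = \<bar>c\<bar> * translation_gap (indicator (K n)) y" for y
      unfolding translation_gap_def
      by (subst integral_mult_right_zero[symmetric], rule Bochner_Integration.integral_cong)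
         (auto simp: indicator_def)
    then have 2: "(\<lambda>n. translation_gap ?g (Y n)) \<longlonglongrightarrow> 0"
      using tendsto_mult[OF tendsto_const translation_gap_compact[OF K(1) Y], of "\<bar>c\<bar>"] by simp
    have "integrable lebesgue ?g"
      using Km[of n] by (intro integrable_mult_left integrable_real_indicator) (auto simp: fmeasurable_def)
    with 1 2 show "\<exists>g. integrable lebesgue g \<and> (LINT x|lebesgue. \<bar>indicator A x *\<^sub>R c - g x\<bar>) < e \<and> (\<lambda>n. translation_gap g (Y n)) \<longlonglongrightarrow> 0"
      by blast
  qed
next
  case (add f g)
  show ?case
    by (rule tendsto_sandwich[OF _ _ tendsto_const tendsto_add_zero[OF add.IH]])
       (use translation_gap_add_le[OF add.hyps] translation_gap_nonneg in \<open>auto intro!: always_eventually\<close>)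
next
  case (lim f s)
  show ?case
  proof (rule translation_gap_L1_closed[OF lim.hyps(4)])
    fix e :: real assume "e > 0"
    have "(\<lambda>n. LINT x|lebesgue. \<bar>f x - s n x\<bar>) \<longlonglongrightarrow> (LINT x::'a|lebesgue. (0::real))"
    \<comment> \<open>The induction supplies approximants with norm at most twice that of
      \<open>f x\<close>, so the difference is at most three times it.\<close>
    proof (rule integral_dominated_convergence[where w="\<lambda>x. 3 * \<bar>f x\<bar>"])
      show "AE x in lebesgue. (\<lambda>n. \<bar>f x - s n x\<bar>) \<longlonglongrightarrow> 0"
        using lim.hyps(2) by (intro AE_I2) (auto intro!: tendsto_eq_intros)
      show "AE x in lebesgue. norm \<bar>f x - s n x\<bar> \<le> 3 * \<bar>f x\<bar>" for n
      proof (rule AE_I2)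
        fix x show "norm \<bar>f x - s n x\<bar> \<le> 3 * \<bar>f x\<bar>" using lim.hyps(3)[of x n] by auto
      qed
    qed (use lim.hyps(1,4) in \<open>auto intro!: borel_measurable_integrable\<close>)
    then have "\<forall>\<^sub>F n in sequentially. (LINT x|lebesgue. \<bar>f x - s n x\<bar>) < e"
      using \<open>e > 0\<close> by (intro order_tendstoD) auto
    then obtain n where "(LINT x|lebesgue. \<bar>f x - s n x\<bar>) < e" by (auto simp: eventually_sequentially)
    then show "\<exists>g. integrable lebesgue g \<and> (LINT x|lebesgue. \<bar>f x - g x\<bar>) < e \<and> (\<lambda>n. translation_gap g (Y n)) \<longlonglongrightarrow> 0"
      using lim.hyps(1) lim.IH by blast
  qed
qed

lemma translation_gap_small:
  assumes "integrable lebesgue f" "e > 0"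
  obtains d where "d > 0" "\<And>y. norm y < d \<Longrightarrow> translation_gap f y < e"
proof -
  have "(translation_gap f \<longlongrightarrow> 0) (at 0)"
    using translation_gap_tendsto_0[OF assms(1)] by (simp add: tendsto_at_iff_sequentially comp_def)
  moreover have "translation_gap f 0 = 0" by (simp add: translation_gap_def)
  ultimately have "\<forall>\<^sub>F y in nhds 0. translation_gap f y < e"
    using assms(2) by (metis order_tendstoD(2) filterlim_at_within_not_equal tendsto_at_iff_tendsto_nhds)
  then show ?thesis using that by (auto simp: eventually_nhds_metric dist_norm)
qed

section \<open>Uniqueness of weak derivatives\<close>

lemma test_functionsD:
  assumes "\<phi> \<in> test_functions U"
  shows "C_k k \<phi>" "continuous_on UNIV \<phi>" "compact (closure {x. \<phi> x \<noteq> 0})" "x \<notin> U \<Longrightarrow> \<phi> x = 0"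
proof -
  have "\<And>k. C_k k \<phi>" using assms by (simp add: test_functions_def)
  then show "C_k k \<phi>" "continuous_on UNIV \<phi>" using C_k.simps(1) by blast+
  show "compact (closure {x. \<phi> x \<noteq> 0})" "x \<notin> U \<Longrightarrow> \<phi> x = 0"
    using assms closure_subset[of "{x. \<phi> x \<noteq> 0}"] by (auto simp: test_functions_def)
qed

lemma test_functions_mono: "V \<subseteq> U \<Longrightarrow> test_functions V \<subseteq> test_functions U"
  by (auto simp: test_functions_def)

lemma test_functionsI:
  assumes "\<And>k. C_k k \<phi>" "compact K" "K \<subseteq> U" "\<And>x. x \<notin> K \<Longrightarrow> \<phi> x = 0"
  shows "\<phi> \<in> test_functions U"
proof -
  have sub: "closure {x. \<phi> x \<noteq> 0} \<subseteq> K"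
    using assms by (intro closure_minimal compact_imp_closed) auto
  moreover have "bounded {x. \<phi> x \<noteq> 0}"
    using assms by (intro bounded_subset[OF compact_imp_bounded[OF assms(2)]]) auto
  ultimately show ?thesis using assms by (auto simp: test_functions_def)
qed

lemma test_functions_measurable:
  assumes "\<phi> \<in> test_functions U"
  shows "\<phi> \<in> borel_measurable (lebesgue_on V)"
  using test_functionsD(2)[OF assms]
  by (intro measurable_restrict_space1) (simp add: borel_measurable_continuous_onI measurable_completion)

lemma test_functions_bounded:
  assumes "\<phi> \<in> test_functions U"
  obtains B where "\<And>x. \<bar>\<phi> x\<bar> \<le> B"
proof -
  let ?K = "closure {x. \<phi> x \<noteq> 0}"
  have "bounded (\<phi> ` ?K)"
    using test_functionsD(2,3)[OF assms] by (intro compact_imp_bounded compact_continuous_image) (auto intro: continuous_on_subset)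
  then obtain B where B: "\<And>x. x \<in> ?K \<Longrightarrow> \<bar>\<phi> x\<bar> \<le> B" by (auto simp: bounded_iff)
  have "\<bar>\<phi> x\<bar> \<le> max B 0" for x
    using B[of x] closure_subset[of "{x. \<phi> x \<noteq> 0}"] by (cases "\<phi> x = 0") auto
  then show ?thesis using that by blast
qed

lemma test_functions_partial:
  assumes "\<phi> \<in> test_functions U"
  shows "partial j \<phi> \<in> test_functions U"
proof (rule test_functionsI)
  let ?K = "closure {x. \<phi> x \<noteq> 0}"
  show "C_k k (partial j \<phi>)" for k using test_functionsD(1)[OF assms, of "Suc k"] by simp
  show "compact ?K" using test_functionsD(3)[OF assms] .
  show "?K \<subseteq> U" using assms by (simp add: test_functions_def)
  show "partial j \<phi> x = 0" if "x \<notin> ?K" for x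
  proof -
    have "((\<lambda>x. 0) has_derivative (\<lambda>h. 0)) (at x)" by simp
    then have "(\<phi> has_derivative (\<lambda>h. 0)) (at x)"
      by (rule has_derivative_transform_within_open[of _ _ _ _ "- ?K"])
         (use that closure_subset[of "{x. \<phi> x \<noteq> 0}"] in auto)
    then show ?thesis using partial_eqI by fastforce
  qed
qed

text \<open>A single power is 1 away from the support of its cut-off and so not compactly supported
  in general; in the difference these constants cancel.\<close>

lemma cutoff_power_diff_test_function:
  assumes b: "b1 \<in> test_functions U" "b2 \<in> test_functions U"
  shows "(\<lambda>x. (1 - b2 x) ^ m - (1 - b1 x) ^ m) \<in> test_functions U"
proof (rule test_functionsI)
  let ?K = "closure {x. b1 x \<noteq> 0} \<union> closure {x. b2 x \<noteq> 0}"
  show "C_k k (\<lambda>x. (1 - b2 x) ^ m - (1 - b1 x) ^ m)" for k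
    using b test_functionsD(1) by (intro C_k_diff C_k_power C_k_const) auto
  show "compact ?K" using b test_functionsD(3) by blast
  show "?K \<subseteq> U" using b by (simp add: test_functions_def)
  show "(1 - b2 x) ^ m - (1 - b1 x) ^ m = 0" if "x \<notin> ?K" for x
  proof -
    have "b1 x = 0" "b2 x = 0"
      using that closure_subset[of "{x. b1 x \<noteq> 0}"] closure_subset[of "{x. b2 x \<noteq> 0}"] by blast+
    then show ?thesis by simp
  qed
qed

text \<open>The sign of \<open>f\<close> is approximated by differences of indicators of compact sets, these by differences of
  indicators of \<open>{b > 0}\<close> for cut-offs \<open>b\<close>, and these by the test functions \<open>(1 - b2)^m - (1 - b1)^m\<close>.\<close>

lemma L1_norm_le_test_duality:
  fixes f :: "real^'m \<Rightarrow> real"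
  assumes U: "open U" and f: "integrable (lebesgue_on U) f"
    and dual: "\<And>\<phi>. \<phi> \<in> test_functions U \<Longrightarrow> (\<And>x. \<bar>\<phi> x\<bar> \<le> 1) \<Longrightarrow> (LINT x|lebesgue_on U. \<phi> x * f x) \<le> \<omega>"
  shows "(LINT x|lebesgue_on U. \<bar>f x\<bar>) \<le> \<omega>"
proof -
  have fm [measurable]: "f \<in> borel_measurable (lebesgue_on U)" using f by (rule borel_measurable_integrable)
  have af: "integrable (lebesgue_on U) (\<lambda>x. \<bar>f x\<bar>)" using f by simp
  \<comment> \<open>The bound \<open>\<omega>\<close> survives almost everywhere limits of functions
    with values in [-1, 1], with \<open>\<bar>f x\<bar>\<close> as dominating function. Each of the
    three approximations uses this once.\<close>
  have limit: "(LINT x|lebesgue_on U. \<phi> x * f x) \<le> \<omega>"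
    if "\<And>n. \<Phi> n \<in> borel_measurable (lebesgue_on U)" "\<phi> \<in> borel_measurable (lebesgue_on U)"
      "\<And>n. (LINT x|lebesgue_on U. \<Phi> n x * f x) \<le> \<omega>" "\<And>n x. \<bar>\<Phi> n x\<bar> \<le> 1"
      "AE x in lebesgue_on U. (\<lambda>n. \<Phi> n x) \<longlonglongrightarrow> \<phi> x" for \<phi> and \<Phi> :: "nat \<Rightarrow> real^'m \<Rightarrow> real"
  proof -
    note [measurable] = that(1,2)
    have "(\<lambda>n. LINT x|lebesgue_on U. \<Phi> n x * f x) \<longlonglongrightarrow> (LINT x|lebesgue_on U. \<phi> x * f x)"
    proof (rule integral_dominated_convergence[OF _ _ af])
      show "AE x in lebesgue_on U. (\<lambda>n. \<Phi> n x * f x) \<longlonglongrightarrow> \<phi> x * f x"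
        using that(5) by eventually_elim (intro tendsto_intros)
      show "AE x in lebesgue_on U. norm (\<Phi> n x * f x) \<le> \<bar>f x\<bar>" for n
        using that(4)[of n] by (intro AE_I2) (auto simp: abs_mult mult_left_le_one_le)
    qed measurable
    then show ?thesis using that(3) by (intro LIMSEQ_le_const2) auto
  qed
  have step1: "(LINT x|lebesgue_on U. (indicator {x. b1 x > 0} x - indicator {x. b2 x > 0} x) * f x) \<le> \<omega>"
    if b: "b1 \<in> test_functions U" "b2 \<in> test_functions U"
      and b01: "\<And>x. 0 \<le> b1 x" "\<And>x. b1 x \<le> 1" "\<And>x. 0 \<le> b2 x" "\<And>x. b2 x \<le> 1" for b1 b2
  proof (rule limit)
    show "(\<lambda>x. (1 - b2 x) ^ m - (1 - b1 x) ^ m) \<in> borel_measurable (lebesgue_on U)" for m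
      by (rule test_functions_measurable[OF cutoff_power_diff_test_function[OF b]])
    have [measurable]: "b1 \<in> borel_measurable (lebesgue_on U)" "b2 \<in> borel_measurable (lebesgue_on U)"
      using b by (auto intro: test_functions_measurable)
    have "(\<lambda>x. indicator {0<..} (b1 x) - indicator {0<..} (b2 x) :: real) \<in> borel_measurable (lebesgue_on U)" by measurable
    then show "(\<lambda>x. indicator {x. b1 x > 0} x - indicator {x. b2 x > 0} x :: real) \<in> borel_measurable (lebesgue_on U)"
      by (simp add: indicator_def)
    have pw: "0 \<le> (1 - b x) ^ m" "(1 - b x) ^ m \<le> 1" if "b \<in> {b1, b2}" for b x m
      using that b01 by (auto intro!: power_le_one)
    \<comment> \<open>Both powers lie in [0, 1], so their difference is admissible in
      \<open>dual\<close>.\<close>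
    show bd: "\<bar>(1 - b2 x) ^ m - (1 - b1 x) ^ m\<bar> \<le> 1" for m x
      using pw[of b1 x m] pw[of b2 x m] by auto
    show "(LINT x|lebesgue_on U. ((1 - b2 x) ^ m - (1 - b1 x) ^ m) * f x) \<le> \<omega>" for m
      by (rule dual[OF cutoff_power_diff_test_function[OF b] bd])
    show "AE x in lebesgue_on U. (\<lambda>m. (1 - b2 x) ^ m - (1 - b1 x) ^ m) \<longlonglongrightarrow> indicator {x. b1 x > 0} x - indicator {x. b2 x > 0} x"
    proof (rule AE_I2)
      fix x
      have lim: "(\<lambda>m. (1 - b x) ^ m) \<longlonglongrightarrow> 1 - indicator {x. b x > 0} x" if "b \<in> {b1, b2}" for b
      proof (cases "b x > 0")
        case True
        then show ?thesis using that b01[of x] by (auto intro!: LIMSEQ_power_zero)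
      next
        case False
        then have "b x = 0" using that b01[of x] by auto
        then show ?thesis by simp
      qed
      show "(\<lambda>m. (1 - b2 x) ^ m - (1 - b1 x) ^ m) \<longlonglongrightarrow> indicator {x. b1 x > 0} x - indicator {x. b2 x > 0} x"
        using tendsto_diff[OF lim[of b2] lim[of b1]] by simp
    qed
  qed
  have cutoffs: "\<exists>b. (\<forall>n. b n \<in> test_functions U) \<and> (\<forall>n x. 0 \<le> b n x \<and> b n x \<le> (1::real)) \<and>
      (\<forall>x. (\<lambda>n. indicator {x. b n x > 0} x :: real) \<longlonglongrightarrow> indicator K x)"
    if K: "compact K" "K \<subseteq> U" for K
  proof -
    \<comment> \<open>These neighbourhoods shrink to \<open>K\<close>, and the positivity set of a
      cut-off for \<open>V n\<close> lies between \<open>K\<close> and \<open>V n\<close>.\<close>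
    define V where "V n = U \<inter> (\<Union>x\<in>K. ball x (1 / Suc n))" for n
    have "\<exists>b. b \<in> test_functions (V n) \<and> (\<forall>x. 0 \<le> b x \<and> b x \<le> 1) \<and> (\<forall>x\<in>K. b x > 0)" for n
    proof -
      have "open (V n)" "K \<subseteq> V n" using U K by (auto simp: V_def intro!: bexI)
      from test_function_compact_cutoff[OF K(1) this] show ?thesis by metis
    qed
    then obtain b where b: "\<And>n. b n \<in> test_functions (V n)" "\<And>n x. 0 \<le> b n x \<and> b n x \<le> 1" "\<And>n x. x \<in> K \<Longrightarrow> b n x > 0"
      by metis
    have "(\<lambda>n. indicator {x. b n x > 0} x :: real) \<longlonglongrightarrow> indicator K x" for x
    proof (cases "x \<in> K")
      case False
      then obtain e where e: "e > 0" "ball x e \<inter> K = {}"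
        using compact_imp_closed[OF K(1)] by (metis Compl_iff closed_def open_contains_ball disjoint_eq_subset_Compl)
      then obtain N where N: "1 / real (Suc N) < e" using nat_approx_posE by metis
      have "b n x = 0" if "n \<ge> N" for n
      proof (rule test_functionsD(4)[OF b(1)])
        have le: "1 / real (Suc n) \<le> 1 / real (Suc N)" using that by (simp add: frac_le)
        have "x \<notin> ball y (1 / real (Suc n))" if "y \<in> K" for y
        proof
          assume "x \<in> ball y (1 / real (Suc n))"
          then have "dist x y < 1 / real (Suc n)" by (simp only: mem_ball dist_commute)
          then have "y \<in> ball x e" using N le by (simp only: mem_ball)
          then show False using e(2) that by blast
        qed
        then show "x \<notin> V n" by (auto simp: V_def)
      qed
      then have "\<forall>\<^sub>F n in sequentially. indicator {x. b n x > 0} x = (indicator K x :: real)"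
        unfolding eventually_sequentially using False by (intro exI[of _ N]) auto
      then show ?thesis by (rule tendsto_eventually)
    qed (use b(3) in simp)
    moreover have "b n \<in> test_functions U" for n using b(1) test_functions_mono[of "V n" U] by (auto simp: V_def)
    ultimately show ?thesis using b(2) by (intro exI[of _ b]) auto
  qed
  have ind [measurable]: "(indicator S :: _ \<Rightarrow> real) \<in> borel_measurable (lebesgue_on U)" if "S \<in> sets lebesgue" for S
    using that by (intro measurable_restrict_space1) simp
  have step2: "(LINT x|lebesgue_on U. (indicator K1 x - indicator K2 x) * f x) \<le> \<omega>"
    if K: "compact K1" "K1 \<subseteq> U" "compact K2" "K2 \<subseteq> U" for K1 K2
  proof -
    obtain b1 where b1: "\<And>n. b1 n \<in> test_functions U" "\<And>n x. 0 \<le> b1 n x" "\<And>n x. b1 n x \<le> 1"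
        "\<And>x. (\<lambda>n. indicator {x. b1 n x > 0} x :: real) \<longlonglongrightarrow> indicator K1 x" using cutoffs[OF K(1,2)] by blast
    obtain b2 where b2: "\<And>n. b2 n \<in> test_functions U" "\<And>n x. 0 \<le> b2 n x" "\<And>n x. b2 n x \<le> 1"
        "\<And>x. (\<lambda>n. indicator {x. b2 n x > 0} x :: real) \<longlonglongrightarrow> indicator K2 x" using cutoffs[OF K(3,4)] by blast
    have open_pos: "{x. b x > 0} \<in> sets lebesgue" if "b \<in> test_functions U" for b
      using open_Collect_less[OF continuous_on_const test_functionsD(2)[OF that], of 0] by (simp add: lborelD)
    show ?thesis
    proof (rule limit[where \<Phi>="\<lambda>n x. indicator {x. b1 n x > 0} x - indicator {x. b2 n x > 0} x"])
      show "(\<lambda>x. indicator {x. b1 n x > 0} x - indicator {x. b2 n x > 0} x :: real) \<in> borel_measurable (lebesgue_on U)" for n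
        using open_pos[OF b1(1)] open_pos[OF b2(1)] by (intro borel_measurable_diff ind)
      show "(\<lambda>x. indicator K1 x - indicator K2 x :: real) \<in> borel_measurable (lebesgue_on U)"
        using K by (intro borel_measurable_diff ind) (auto intro: lmeasurable_compact fmeasurableD)
      show "(LINT x|lebesgue_on U. (indicator {x. b1 n x > 0} x - indicator {x. b2 n x > 0} x) * f x) \<le> \<omega>" for n
        by (rule step1) (use b1 b2 in auto)
      show "AE x in lebesgue_on U. (\<lambda>n. indicator {x. b1 n x > 0} x - indicator {x. b2 n x > 0} x :: real) \<longlonglongrightarrow> indicator K1 x - indicator K2 x"
        using b1(4) b2(4) by (intro AE_I2 tendsto_diff)
    qed (auto simp: indicator_def)
  qed
  define P where "P = {x\<in>U. f x > 0}"
  define N where "N = {x\<in>U. f x < 0}"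
  have U': "U \<in> sets lebesgue" using U by (simp add: lborelD)
  have "{x \<in> space (lebesgue_on U). f x > 0} \<in> sets (lebesgue_on U)" "{x \<in> space (lebesgue_on U). f x < 0} \<in> sets (lebesgue_on U)"
    by measurable
  then have PN: "P \<in> sets lebesgue" "N \<in> sets lebesgue"
    using U' by (auto simp: P_def N_def sets_restrict_space_iff)
  obtain K1 where K1: "\<And>n. compact (K1 n)" "\<And>n. K1 n \<subseteq> P" "AE x in lebesgue. (\<lambda>n. indicator (K1 n) x :: real) \<longlonglongrightarrow> indicator P x"
    using lebesgue_compact_exhaustion[OF PN(1)] by blast
  obtain K2 where K2: "\<And>n. compact (K2 n)" "\<And>n. K2 n \<subseteq> N" "AE x in lebesgue. (\<lambda>n. indicator (K2 n) x :: real) \<longlonglongrightarrow> indicator N x"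
    using lebesgue_compact_exhaustion[OF PN(2)] by blast
  have "(LINT x|lebesgue_on U. (indicator P x - indicator N x) * f x) \<le> \<omega>"
  proof (rule limit[where \<Phi>="\<lambda>n x. indicator (K1 n) x - indicator (K2 n) x"])
    show "(\<lambda>x. indicator (K1 n) x - indicator (K2 n) x :: real) \<in> borel_measurable (lebesgue_on U)" for n
      using K1(1) K2(1) by (intro borel_measurable_diff ind) (auto intro: lmeasurable_compact fmeasurableD)
    show "(\<lambda>x. indicator P x - indicator N x :: real) \<in> borel_measurable (lebesgue_on U)"
      using PN by (intro borel_measurable_diff ind)
    show "(LINT x|lebesgue_on U. (indicator (K1 n) x - indicator (K2 n) x) * f x) \<le> \<omega>" for n
      using K1(1)[of n] K1(2)[of n] K2(1)[of n] K2(2)[of n] by (intro step2) (auto simp: P_def N_def)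
    have "AE x in lebesgue. (\<lambda>n. indicator (K1 n) x - indicator (K2 n) x :: real) \<longlonglongrightarrow> indicator P x - indicator N x"
      using K1(3) K2(3) by eventually_elim (rule tendsto_diff)
    then show "AE x in lebesgue_on U. (\<lambda>n. indicator (K1 n) x - indicator (K2 n) x :: real) \<longlonglongrightarrow> indicator P x - indicator N x"
      using U' by (auto simp: AE_restrict_space_iff elim: eventually_mono)
  qed (auto simp: indicator_def)
  also have "(LINT x|lebesgue_on U. (indicator P x - indicator N x) * f x) = (LINT x|lebesgue_on U. \<bar>f x\<bar>)"
    by (rule Bochner_Integration.integral_cong) (auto simp: P_def N_def indicator_def)
  finally show ?thesis .
qed

lemma integrable_lebesgue_on_subset:
  fixes f :: "'a::euclidean_space \<Rightarrow> 'b::{banach, second_countable_topology}"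
  assumes "integrable (lebesgue_on T) f" "S \<subseteq> T" "S \<in> sets lebesgue" "T \<in> sets lebesgue"
  shows "integrable (lebesgue_on S) f"
proof -
  have "integrable lebesgue (\<lambda>x. indicator T x *\<^sub>R f x)"
    using assms by (simp add: integrable_restrict_space)
  then have "integrable lebesgue (\<lambda>x. indicator S x *\<^sub>R (indicator T x *\<^sub>R f x))"
    using assms(3) integrable_mult_indicator by blast
  also have "(\<lambda>x. indicator S x *\<^sub>R (indicator T x *\<^sub>R f x)) = (\<lambda>x. indicator S x *\<^sub>R f x)"
    using assms(2) by (auto simp: indicator_def fun_eq_iff)
  finally show ?thesis using assms by (simp add: integrable_restrict_space)
qed

lemma integrable_test_function_scaleR:
  fixes f :: "real^'m \<Rightarrow> 'v::euclidean_space"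
  assumes "\<phi> \<in> test_functions U" "integrable (lebesgue_on V) f"
  shows "integrable (lebesgue_on V) (\<lambda>x. \<phi> x *\<^sub>R f x)"
proof -
  obtain B where B: "\<And>x. \<bar>\<phi> x\<bar> \<le> B" using test_functions_bounded[OF assms(1)] by blast
  show ?thesis
  proof (rule Bochner_Integration.integrable_bound)
    show "integrable (lebesgue_on V) (\<lambda>x. B * norm (f x))" using assms(2) by simp
    show "AE x in lebesgue_on V. norm (\<phi> x *\<^sub>R f x) \<le> norm (B * norm (f x))"
      using B by (intro AE_I2) (auto simp: abs_mult intro!: mult_right_mono order_trans[OF B])
    show "(\<lambda>x. \<phi> x *\<^sub>R f x) \<in> borel_measurable (lebesgue_on V)"
      using test_functions_measurable[OF assms(1)] borel_measurable_integrable[OF assms(2)]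
      by (rule borel_measurable_scaleR)
  qed
qed

lemma integral_test_function_support:
  fixes f :: "real^'m \<Rightarrow> 'v::euclidean_space"
  assumes "\<phi> \<in> test_functions V" "V \<subseteq> U" "V \<in> sets lebesgue" "U \<in> sets lebesgue"
  shows "(LINT x|lebesgue_on U. \<phi> x *\<^sub>R f x) = (LINT x|lebesgue_on V. \<phi> x *\<^sub>R f x)"
proof -
  have "indicator U x *\<^sub>R (\<phi> x *\<^sub>R f x) = indicator V x *\<^sub>R (\<phi> x *\<^sub>R f x)" for x
    using test_functionsD(4)[OF assms(1), of x] assms(2) by (auto simp: indicator_def)
  then have "(LINT x|lebesgue. indicator U x *\<^sub>R (\<phi> x *\<^sub>R f x)) = (LINT x|lebesgue. indicator V x *\<^sub>R (\<phi> x *\<^sub>R f x))"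
    by (intro Bochner_Integration.integral_cong refl)
  then show ?thesis using assms(3,4) by (simp add: integral_restrict_space del: scaleR_scaleR)
qed

text \<open>Weak derivatives are only locally integrable, so L^1 duality is applied with bound 0 on
  the interiors of an exhaustion by compact sets, one coordinate at a time.\<close>

lemma has_weak_partial_unique:
  fixes f :: "real^'m \<Rightarrow> 'v::euclidean_space"
  assumes U: "open U" and g: "has_weak_partial U j f g" "has_weak_partial U j f g'"
  shows "AE x in lebesgue_on U. g x = g' x"
proof -
  obtain C where C: "\<And>n. compact (C n)" "\<And>n. C n \<subseteq> U" "\<And>n. C n \<subseteq> interior (C (Suc n))" "\<Union>(range C) = U"
    using open_Union_compact_subsets[OF U] by metis
  define V where "V n = interior (C n)" for n
  have V: "open (V n)" "V n \<subseteq> C n" "V n \<subseteq> U" for n using C(2)[of n] interior_subset[of "C n"] by (auto simp: V_def)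
  have Vm: "V n \<in> sets lebesgue" "U \<in> sets lebesgue" "C n \<in> sets lebesgue" for n
    using V(1) U C(1) by (auto simp: lborelD lmeasurable_compact fmeasurableD)
  have UV: "U = (\<Union>n. V n)" using C(3,4) V(3) by (fastforce simp: V_def)
  have "AE x in lebesgue. x \<in> V n \<longrightarrow> (g x - g' x) \<bullet> b = 0" for n b
  proof -
    have int: "integrable (lebesgue_on (V n)) h" if "locally_integrable U h" for h :: "real^'m \<Rightarrow> 'v"
      using that C(1,2) V Vm integrable_lebesgue_on_subset[of "C n" h "V n"] by (auto simp: locally_integrable_def)
    have gi: "integrable (lebesgue_on (V n)) g" "integrable (lebesgue_on (V n)) g'"
      using g by (auto simp: has_weak_partial_def intro: int)
    have "(LINT x|lebesgue_on (V n). \<bar>(g x - g' x) \<bullet> b\<bar>) \<le> 0"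
    proof (rule L1_norm_le_test_duality[OF V(1)])
      show "integrable (lebesgue_on (V n)) (\<lambda>x. (g x - g' x) \<bullet> b)" using gi by simp
      fix \<phi> assume \<phi>: "\<phi> \<in> test_functions (V n)"
      then have \<phi>U: "\<phi> \<in> test_functions U" using test_functions_mono[OF V(3)] by blast
      have "(LINT x|lebesgue_on U. \<phi> x *\<^sub>R g x) = (LINT x|lebesgue_on U. \<phi> x *\<^sub>R g' x)"
        using g \<phi>U by (auto simp: has_weak_partial_def)
      then have eq: "(LINT x|lebesgue_on (V n). \<phi> x *\<^sub>R g x) = (LINT x|lebesgue_on (V n). \<phi> x *\<^sub>R g' x)"
        unfolding integral_test_function_support[OF \<phi> V(3) Vm(1,2)] .
      note i = gi[THEN integrable_test_function_scaleR[OF \<phi>]]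
      have "(LINT x|lebesgue_on (V n). \<phi> x * ((g x - g' x) \<bullet> b)) = (LINT x|lebesgue_on (V n). (\<phi> x *\<^sub>R g x - \<phi> x *\<^sub>R g' x) \<bullet> b)"
        by (simp add: inner_diff_left right_diff_distrib)
      also have "\<dots> = (LINT x|lebesgue_on (V n). \<phi> x *\<^sub>R g x - \<phi> x *\<^sub>R g' x) \<bullet> b"
        using i by (intro integral_inner_left) auto
      also have "\<dots> = 0" using i eq by simp
      finally show "(LINT x|lebesgue_on (V n). \<phi> x * ((g x - g' x) \<bullet> b)) \<le> 0" by simp
    qed
    moreover have "(LINT x|lebesgue_on (V n). \<bar>(g x - g' x) \<bullet> b\<bar>) \<ge> 0" by simp
    ultimately have "(LINT x|lebesgue_on (V n). \<bar>(g x - g' x) \<bullet> b\<bar>) = 0" by linarith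
    then have "AE x in lebesgue_on (V n). \<bar>(g x - g' x) \<bullet> b\<bar> = 0"
      using gi by (subst (asm) integral_nonneg_eq_0_iff_AE) auto
    then show ?thesis using Vm by (simp add: AE_restrict_space_iff)
  qed
  then have "AE x in lebesgue. \<forall>n. \<forall>b\<in>Basis. x \<in> V n \<longrightarrow> (g x - g' x) \<bullet> b = 0"
    by (intro AE_all_countable[THEN iffD2] allI AE_finite_allI finite_Basis)
  then have "AE x in lebesgue. x \<in> U \<longrightarrow> g x = g' x"
  proof eventually_elim
    case (elim x)
    show ?case
    proof
      assume "x \<in> U"
      then obtain n where "x \<in> V n" unfolding UV by blast
      then have "g x \<bullet> b = g' x \<bullet> b" if "b \<in> Basis" for b using elim that by (auto simp: inner_diff_left)
      then show "g x = g' x" by (rule euclidean_eqI)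
    qed
  qed
  then show ?thesis using Vm by (simp add: AE_restrict_space_iff)
qed

lemma has_weak_partial_weak_partial:
  "has_weak_partial U j f g \<Longrightarrow> has_weak_partial U j f (weak_partial U j f)"
  unfolding weak_partial_def by (rule someI[of "has_weak_partial U j f"])

text \<open>This removes the choice operator: any weak derivative found explicitly may replace the
  chosen representative under integrals.\<close>

lemma AE_weak_partial_eq:
  assumes "open U" "has_weak_partial U j f g"
  shows "AE x in lebesgue_on U. weak_partial U j f x = g x"
  by (rule has_weak_partial_unique[OF assms(1) has_weak_partial_weak_partial[OF assms(2)] assms(2)])

section \<open>Weak derivatives of Lipschitz compositions\<close>

lemma integral_lebesgue_on_eq:
  fixes f :: "'a::euclidean_space \<Rightarrow> 'b::euclidean_space"
  assumes "U \<in> sets lebesgue"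
  shows "(LINT x|lebesgue_on U. \<phi> x *\<^sub>R f x) = (LINT x|lebesgue. \<phi> x *\<^sub>R (indicator U x *\<^sub>R f x))"
  using assms by (simp add: integral_restrict_space mult.commute)

lemma test_function_translate:
  assumes \<phi>: "\<phi> \<in> test_functions V" and sub: "\<And>x. x \<in> V \<Longrightarrow> x + y \<in> U"
  shows "(\<lambda>x. \<phi> (x - y)) \<in> test_functions U"
proof (rule test_functionsI)
  let ?K = "closure {x. \<phi> x \<noteq> 0}"
  show "C_k k (\<lambda>x. \<phi> (x - y))" for k by (rule C_k_translate[OF test_functionsD(1)[OF \<phi>]])
  show "compact ((+) y ` ?K)" using test_functionsD(3)[OF \<phi>] by (rule compact_translation)
  show "(+) y ` ?K \<subseteq> U" using \<phi> sub by (auto simp: test_functions_def add.commute)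
  show "\<phi> (x - y) = 0" if "x \<notin> (+) y ` ?K" for x
  proof (rule ccontr)
    assume "\<phi> (x - y) \<noteq> 0"
    then have "x - y \<in> ?K" using closure_subset[of "{x. \<phi> x \<noteq> 0}"] by blast
    then have "y + (x - y) \<in> (+) y ` ?K" by (rule imageI)
    then show False using that by simp
  qed
qed

lemma test_function_line_derivative:
  assumes \<phi>: "\<phi> \<in> test_functions V"
  shows "((\<lambda>t. \<phi> (x - t *\<^sub>R axis j 1)) has_real_derivative - partial j \<phi> (x - t *\<^sub>R axis j 1)) (at t)"
proof -
  let ?y = "x - t *\<^sub>R axis j 1"
  have d: "(\<phi> has_derivative frechet_derivative \<phi> (at ?y)) (at ?y)"
    using C_k_imp_has_derivative test_functionsD(1)[OF \<phi>, of "Suc 0"] by blast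
  have l: "((\<lambda>t. x - t *\<^sub>R axis j 1) has_derivative (\<lambda>h. h *\<^sub>R (- axis j 1))) (at t)"
    by (auto intro!: derivative_eq_intros)
  interpret bounded_linear "frechet_derivative \<phi> (at ?y)" using d by (rule has_derivative_bounded_linear)
  have eq: "frechet_derivative \<phi> (at ?y) (h *\<^sub>R (- axis j 1)) = - partial j \<phi> ?y * h" for h
    by (simp add: partial_def scaleR neg)
  show ?thesis
    unfolding has_field_derivative_def
    by (rule has_derivative_eq_rhs[OF has_derivative_compose[OF l d]]) (use eq in \<open>simp add: fun_eq_iff\<close>)
qed

text \<open>By the mean value inequality the quotients of the shifted test function are bounded by a
  bound \<open>B\<close> for its partial derivative, so dominated convergence differentiates under
  the integral. The derivative falls on \<open>\<phi>\<close> alone, and \<open>w\<close> may be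
  merely integrable.\<close>

lemma test_translate_integral_quotient:
  fixes w :: "real^'m \<Rightarrow> 'w::euclidean_space"
  assumes \<phi>: "\<phi> \<in> test_functions V" and w: "integrable lebesgue w"
  shows "((\<lambda>s. ((LINT x|lebesgue. \<phi> (x - s *\<^sub>R axis j 1) *\<^sub>R w x)
        - (LINT x|lebesgue. \<phi> (x - t *\<^sub>R axis j 1) *\<^sub>R w x)) /\<^sub>R (s - t)) \<longlongrightarrow>
     - (LINT x|lebesgue. partial j \<phi> (x - t *\<^sub>R axis j 1) *\<^sub>R w x)) (at t)"
proof -
  let ?e = "axis j 1 :: real^'m"
  have tr: "(\<lambda>x. \<psi> (x - y)) \<in> test_functions UNIV" if "\<psi> \<in> test_functions V" for \<psi> y
    using test_function_translate[OF that] by blast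
  have meas [measurable]: "(\<lambda>x. \<psi> (x - y)) \<in> borel_measurable lebesgue" if "\<psi> \<in> test_functions V" for \<psi> and y :: "real^'m"
    using test_functions_measurable[OF tr[OF that], where V=UNIV] by (simp add: lebesgue_on_UNIV_eq)
  have int: "integrable lebesgue (\<lambda>x. \<psi> (x - y) *\<^sub>R w x)" if "\<psi> \<in> test_functions V" for \<psi> y
    using integrable_test_function_scaleR[OF tr[OF that], where V=UNIV and f=w, of y] w by (simp add: lebesgue_on_UNIV_eq)
  note \<phi>' = test_functions_partial[OF \<phi>, of j]
  have [measurable]: "w \<in> borel_measurable lebesgue" using w by (rule borel_measurable_integrable)
  obtain B where B: "\<And>x. \<bar>partial j \<phi> x\<bar> \<le> B" using test_functions_bounded[OF \<phi>'] by blast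
  have lip: "\<bar>\<phi> (x - s *\<^sub>R ?e) - \<phi> (x - t *\<^sub>R ?e)\<bar> \<le> B * \<bar>s - t\<bar>" for x s
    using field_differentiable_bound[of UNIV "\<lambda>t. \<phi> (x - t *\<^sub>R ?e)" "\<lambda>t. - partial j \<phi> (x - t *\<^sub>R ?e)" B s t]
      test_function_line_derivative[OF \<phi>] B by simp
  let ?g = "\<lambda>t. LINT x|lebesgue. \<phi> (x - t *\<^sub>R ?e) *\<^sub>R w x"
  let ?q = "\<lambda>s x. (\<phi> (x - s *\<^sub>R ?e) - \<phi> (x - t *\<^sub>R ?e)) / (s - t)"
  have q: "(?g s - ?g t) /\<^sub>R (s - t) = (LINT x|lebesgue. ?q s x *\<^sub>R w x)" for s
  proof -
    have "(LINT x|lebesgue. ?q s x *\<^sub>R w x) = (LINT x|lebesgue. (1 / (s - t)) *\<^sub>R (\<phi> (x - s *\<^sub>R ?e) *\<^sub>R w x - \<phi> (x - t *\<^sub>R ?e) *\<^sub>R w x))"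
      by (intro Bochner_Integration.integral_cong refl) (simp add: algebra_simps diff_divide_distrib)
    also have "\<dots> = (?g s - ?g t) /\<^sub>R (s - t)"
      using int[OF \<phi>] by (simp add: divide_inverse)
    finally show ?thesis by simp
  qed
  have "((\<lambda>s. (?g s - ?g t) /\<^sub>R (s - t)) \<longlongrightarrow> (LINT x|lebesgue. (- partial j \<phi> (x - t *\<^sub>R ?e)) *\<^sub>R w x)) (at t)"
    unfolding tendsto_at_iff_sequentially comp_def q
  proof (intro allI impI)
    fix X :: "nat \<Rightarrow> real" assume X: "\<forall>i. X i \<in> UNIV - {t}" "X \<longlonglongrightarrow> t"
    show "(\<lambda>i. LINT x|lebesgue. ?q (X i) x *\<^sub>R w x) \<longlonglongrightarrow> (LINT x|lebesgue. (- partial j \<phi> (x - t *\<^sub>R ?e)) *\<^sub>R w x)"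
    proof (rule integral_dominated_convergence[where w="\<lambda>x. B * norm (w x)"])
      show "(\<lambda>x. (- partial j \<phi> (x - t *\<^sub>R ?e)) *\<^sub>R w x) \<in> borel_measurable lebesgue"
        using meas[OF \<phi>', of "t *\<^sub>R ?e"] by measurable
      show "(\<lambda>x. ?q (X i) x *\<^sub>R w x) \<in> borel_measurable lebesgue" for i
        using meas[OF \<phi>, of "X i *\<^sub>R ?e"] meas[OF \<phi>, of "t *\<^sub>R ?e"] by measurable
      show "integrable lebesgue (\<lambda>x. B * norm (w x))" using w by simp
      show "AE x in lebesgue. (\<lambda>i. ?q (X i) x *\<^sub>R w x) \<longlonglongrightarrow> (- partial j \<phi> (x - t *\<^sub>R ?e)) *\<^sub>R w x"
      proof (rule AE_I2)
        fix x
        have "(\<lambda>i. ?q (X i) x) \<longlonglongrightarrow> - partial j \<phi> (x - t *\<^sub>R ?e)"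
          using test_function_line_derivative[OF \<phi>, of x j t] X
          unfolding has_field_derivative_iff tendsto_at_iff_sequentially comp_def by blast
        then show "(\<lambda>i. ?q (X i) x *\<^sub>R w x) \<longlonglongrightarrow> (- partial j \<phi> (x - t *\<^sub>R ?e)) *\<^sub>R w x"
          by (intro tendsto_intros)
      qed
      show "AE x in lebesgue. norm (?q (X i) x *\<^sub>R w x) \<le> B * norm (w x)" for i
      proof (rule AE_I2)
        fix x
        have "X i - t \<noteq> 0" using X(1) by auto
        then have "\<bar>?q (X i) x\<bar> \<le> B" using lip[of x "X i"] by (simp add: abs_divide divide_le_eq)
        then show "norm (?q (X i) x *\<^sub>R w x) \<le> B * norm (w x)"
          by (simp only: norm_scaleR real_norm_def) (intro mult_right_mono norm_ge_zero)
      qed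
    qed
  qed
  then show ?thesis by simp
qed

text \<open>Tested against \<open>\<phi>\<close>, the difference quotient is \<open>(g h - g 0) / h\<close> with \<open>g' t\<close> the integral of
  \<open>\<phi> (x - t e)\<close> against \<open>v\<close>, so that the mean value theorem leaves a translate of \<open>v\<close> to be compared with \<open>v\<close>.\<close>

lemma difference_quotient_L1_le:
  fixes u v :: "real^'m \<Rightarrow> real" and j :: 'm
  defines "e \<equiv> axis j 1"
  assumes U: "open U" "open V" "V \<subseteq> U"
    and uv: "integrable (lebesgue_on U) u" "integrable (lebesgue_on U) v" "has_weak_partial U j u v"
    and h: "h \<noteq> 0" "\<And>x t. x \<in> V \<Longrightarrow> \<bar>t\<bar> \<le> \<bar>h\<bar> \<Longrightarrow> x + t *\<^sub>R e \<in> U"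
    and gap: "\<And>t. \<bar>t\<bar> \<le> \<bar>h\<bar> \<Longrightarrow> translation_gap (\<lambda>x. indicator U x *\<^sub>R v x) (t *\<^sub>R e) \<le> \<omega>"
  shows "(LINT x|lebesgue_on V. \<bar>(u (x + h *\<^sub>R e) - u x) / h - v x\<bar>) \<le> \<omega>"
    and "integrable (lebesgue_on V) (\<lambda>x. (u (x + h *\<^sub>R e) - u x) / h - v x)"
proof -
  \<comment> \<open>Extension by zero makes all translates integrable on the whole space; for points
    of \<open>V\<close> the quotient only sees values in \<open>U\<close>, which are
    unchanged.\<close>
  define u0 where "u0 x = indicator U x *\<^sub>R u x" for x
  define v0 where "v0 x = indicator U x *\<^sub>R v x" for x
  have Um: "U \<in> sets lebesgue" "V \<in> sets lebesgue" using U by (auto simp: lborelD)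
  have u0: "integrable lebesgue u0" and v0: "integrable lebesgue v0"
    using uv(1,2) Um unfolding u0_def[abs_def] v0_def[abs_def] by (simp_all add: integrable_restrict_space)
  note u0h = u0[THEN integrable_lebesgue_translate] and v0h = v0[THEN integrable_lebesgue_translate]
  let ?q = "\<lambda>x. (u0 (x + h *\<^sub>R e) - u0 x) / h - v0 x"
  have q: "integrable lebesgue ?q" using u0 u0h v0 by auto
  have eq: "?q x = (u (x + h *\<^sub>R e) - u x) / h - v x" if "x \<in> V" for x
    using h(2)[OF that, of h] that U(3) by (auto simp: u0_def v0_def indicator_def)
  have qV: "integrable (lebesgue_on V) ?q"
    using q Um integrable_lebesgue_on_subset[of UNIV ?q V] by (simp add: lebesgue_on_UNIV_eq)
  then show "integrable (lebesgue_on V) (\<lambda>x. (u (x + h *\<^sub>R e) - u x) / h - v x)"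
    by (rule Bochner_Integration.integrable_cong[THEN iffD1, OF refl, rotated]) (simp add: eq)
  have "(LINT x|lebesgue_on V. \<bar>?q x\<bar>) \<le> \<omega>"
  proof (rule L1_norm_le_test_duality[OF U(2) qV])
    fix \<phi> assume \<phi>: "\<phi> \<in> test_functions V" and \<phi>1: "\<And>x. \<bar>\<phi> x\<bar> \<le> 1"
    define g where "g t = (LINT x|lebesgue. \<phi> (x - t *\<^sub>R e) *\<^sub>R u0 x)" for t
    define G where "G t = (LINT x|lebesgue. \<phi> (x - t *\<^sub>R e) *\<^sub>R v0 x)" for t
    have int: "integrable lebesgue (\<lambda>x. \<phi> x *\<^sub>R w x)" if "integrable lebesgue w" for w :: "real^'m \<Rightarrow> real"
      using integrable_test_function_scaleR[OF \<phi>, where V=UNIV and f=w] that by (simp add: lebesgue_on_UNIV_eq)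
    \<comment> \<open>The translate of \<open>\<phi>\<close> is still a test function of
      \<open>U\<close>, so the weak derivative moves the derivative from \<open>\<phi>\<close> to
      \<open>v\<close>.\<close>
    have dg: "(g has_real_derivative G t) (at t)" if t: "\<bar>t\<bar> \<le> \<bar>h\<bar>" for t
    proof -
      have T: "(\<lambda>x. \<phi> (x - t *\<^sub>R e)) \<in> test_functions U"
        using test_function_translate[OF \<phi>] h(2) t by blast
      have "partial j (\<lambda>x. \<phi> (x - t *\<^sub>R e)) x = partial j \<phi> (x - t *\<^sub>R e)" for x
        using test_functionsD(1)[OF \<phi>, of "Suc 0"] by (intro partial_translate) simp
      moreover have "(LINT x|lebesgue_on U. partial j (\<lambda>x. \<phi> (x - t *\<^sub>R e)) x *\<^sub>R u x) = - (LINT x|lebesgue_on U. \<phi> (x - t *\<^sub>R e) *\<^sub>R v x)"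
        using uv(3) T by (simp add: has_weak_partial_def)
      ultimately have "- (LINT x|lebesgue. partial j \<phi> (x - t *\<^sub>R e) *\<^sub>R u0 x) = G t"
        unfolding integral_lebesgue_on_eq[OF Um(1)] G_def by (simp add: u0_def v0_def)
      with test_translate_integral_quotient[OF \<phi> u0, where j=j and t=t] show ?thesis
        unfolding has_field_derivative_iff by (simp add: g_def e_def divide_inverse mult.commute)
    qed
    \<comment> \<open>Rescaled to [0, 1], the mean value theorem covers steps \<open>h\<close> of
      both signs.\<close>
    have "((\<lambda>s. g (s * h)) has_real_derivative G (s * h) * h) (at s)" if "0 \<le> s" "s \<le> 1" for s
    proof -
      have "\<bar>s * h\<bar> \<le> \<bar>h\<bar>" using that by (simp add: abs_mult mult_left_le_one_le)
      then show ?thesis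
        by (intro DERIV_chain2[where f=g and g="\<lambda>s. s * h"] dg) (auto intro!: derivative_eq_intros)
    qed
    then obtain s where s: "0 < s" "s < 1" "g (1 * h) - g (0 * h) = (1 - 0) * (G (s * h) * h)"
      using MVT2[of 0 1 "\<lambda>s. g (s * h)" "\<lambda>s. G (s * h) * h"] by auto
    define t where "t = s * h"
    have t: "\<bar>t\<bar> \<le> \<bar>h\<bar>" using s(1,2) by (simp add: t_def abs_mult mult_left_le_one_le)
    have gG: "(g h - g 0) / h = G t" using s(3) h(1) by (simp add: t_def)
    have shift: "(LINT x|lebesgue. \<phi> (x - y) *\<^sub>R w x) = (LINT x|lebesgue. \<phi> x * w (x + y))"
      if "integrable lebesgue w" for w :: "real^'m \<Rightarrow> real" and y
    proof -
      have "(\<lambda>x. \<phi> x *\<^sub>R w (x + y)) \<in> borel_measurable lebesgue"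
        by (intro borel_measurable_integrable int integrable_lebesgue_translate that)
      from integral_lebesgue_translate[OF this, of "- y"] show ?thesis by simp
    qed
    have "(LINT x|lebesgue_on V. \<phi> x * ?q x) = (LINT x|lebesgue. \<phi> x * ?q x)"
      using integral_test_function_support[OF \<phi>, where U=UNIV and f="?q"] Um by (simp add: lebesgue_on_UNIV_eq)
    also have "\<dots> = (LINT x|lebesgue. (\<phi> x * u0 (x + h *\<^sub>R e) - \<phi> x * u0 x) / h - \<phi> x * v0 x)"
      by (intro Bochner_Integration.integral_cong refl) (simp add: algebra_simps diff_divide_distrib)
    also have "\<dots> = (g h - g 0) / h - G 0"
      using int[OF u0] int[OF u0h] int[OF v0] shift[OF u0, of "h *\<^sub>R e"] by (simp add: g_def G_def)
    also have "\<dots> = (LINT x|lebesgue. \<phi> x * v0 (x + t *\<^sub>R e)) - (LINT x|lebesgue. \<phi> x * v0 x)"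
      unfolding gG using shift[OF v0, of "t *\<^sub>R e"] by (simp add: G_def)
    also have "\<dots> = (LINT x|lebesgue. \<phi> x * (v0 (x + t *\<^sub>R e) - v0 x))"
      using int[OF v0] int[OF v0h] by (simp add: right_diff_distrib)
    also have "\<dots> \<le> translation_gap v0 (t *\<^sub>R e)"
      unfolding translation_gap_def
    proof (rule integral_mono)
      show "integrable lebesgue (\<lambda>x. \<phi> x * (v0 (x + t *\<^sub>R e) - v0 x))"
        using int[of "\<lambda>x. v0 (x + t *\<^sub>R e) - v0 x"] v0 v0h by simp
      show "integrable lebesgue (\<lambda>x. \<bar>v0 (x + t *\<^sub>R e) - v0 x\<bar>)" using v0 v0h by simp
      fix x
      have "\<phi> x * (v0 (x + t *\<^sub>R e) - v0 x) \<le> \<bar>\<phi> x\<bar> * \<bar>v0 (x + t *\<^sub>R e) - v0 x\<bar>" by (simp flip: abs_mult)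
      also have "\<dots> \<le> \<bar>v0 (x + t *\<^sub>R e) - v0 x\<bar>" using \<phi>1[of x] by (intro mult_left_le_one_le) auto
      finally show "\<phi> x * (v0 (x + t *\<^sub>R e) - v0 x) \<le> \<bar>v0 (x + t *\<^sub>R e) - v0 x\<bar>" .
    qed
    also have "\<dots> \<le> \<omega>" using gap[OF t] unfolding v0_def[abs_def] .
    finally show "(LINT x|lebesgue_on V. \<phi> x * ?q x) \<le> \<omega>" .
  qed
  also have "(LINT x|lebesgue_on V. \<bar>?q x\<bar>) = (LINT x|lebesgue_on V. \<bar>(u (x + h *\<^sub>R e) - u x) / h - v x\<bar>)"
    by (intro Bochner_Integration.integral_cong refl) (simp add: eq)
  finally show "(LINT x|lebesgue_on V. \<bar>(u (x + h *\<^sub>R e) - u x) / h - v x\<bar>) \<le> \<omega>" .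
qed

text \<open>The error is controlled by the modulus of continuity of \<open>v\<close> extended by
  zero, which is uniformly small over all shifts up to \<open>\<bar>h n\<bar>\<close> once
  \<open>h n\<close> is small.\<close>

lemma difference_quotient_tendsto_L1:
  fixes u v :: "real^'m \<Rightarrow> real" and j :: 'm
  defines "e \<equiv> axis j 1"
  assumes U: "open U" "open V" "V \<subseteq> U"
    and uv: "integrable (lebesgue_on U) u" "integrable (lebesgue_on U) v" "has_weak_partial U j u v"
    and \<delta>: "\<And>n x t. x \<in> V \<Longrightarrow> \<bar>t\<bar> \<le> \<bar>h n\<bar> \<Longrightarrow> x + t *\<^sub>R e \<in> U"
    and h: "\<And>n. h n \<noteq> 0" "h \<longlonglongrightarrow> 0"
  shows "(\<lambda>n. LINT x|lebesgue_on V. \<bar>(u (x + h n *\<^sub>R e) - u x) / h n - v x\<bar>) \<longlonglongrightarrow> 0"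
proof (rule LIMSEQ_I)
  fix r :: real assume r: "r > 0"
  have "integrable lebesgue (\<lambda>x. indicator U x *\<^sub>R v x)"
    using uv(2) U(1) by (simp add: integrable_restrict_space lborelD)
  then obtain d where d: "d > 0" "\<And>y. norm y < d \<Longrightarrow> translation_gap (\<lambda>x. indicator U x *\<^sub>R v x) y < r / 2"
    using translation_gap_small[of _ "r / 2"] r by (metis half_gt_zero)
  obtain N where N: "\<And>n. n \<ge> N \<Longrightarrow> \<bar>h n\<bar> < d" using LIMSEQ_D[OF h(2) d(1)] by auto
  have "(LINT x|lebesgue_on V. \<bar>(u (x + h n *\<^sub>R e) - u x) / h n - v x\<bar>) \<le> r / 2" if "n \<ge> N" for n
    unfolding e_def
  proof (rule difference_quotient_L1_le[OF U uv h(1)])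
    show "x + t *\<^sub>R axis j 1 \<in> U" if "x \<in> V" "\<bar>t\<bar> \<le> \<bar>h n\<bar>" for x t using \<delta>[OF that] by (simp add: e_def)
    fix t assume "\<bar>t\<bar> \<le> \<bar>h n\<bar>"
    then have "norm (t *\<^sub>R axis j 1 :: real^'m) < d" using N[OF that] by (simp add: norm_axis_1)
    then show "translation_gap (\<lambda>x. indicator U x *\<^sub>R v x) (t *\<^sub>R axis j 1) \<le> r / 2"
      using d(2) less_imp_le by blast
  qed
  then have "norm ((LINT x|lebesgue_on V. \<bar>(u (x + h n *\<^sub>R e) - u x) / h n - v x\<bar>) - 0) < r" if "n \<ge> N" for n
    using that r by fastforce
  then show "\<exists>N. \<forall>n\<ge>N. norm ((LINT x|lebesgue_on V. \<bar>(u (x + h n *\<^sub>R e) - u x) / h n - v x\<bar>) - 0) < r" by blast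
qed

lemma has_weak_partial_inner:
  fixes u v :: "real^'m \<Rightarrow> 'v::euclidean_space"
  assumes U: "U \<in> sets lebesgue" and u: "integrable (lebesgue_on U) u" and v: "integrable (lebesgue_on U) v"
    and w: "has_weak_partial U j u v"
  shows "has_weak_partial U j (\<lambda>x. u x \<bullet> b) (\<lambda>x. v x \<bullet> b)"
proof -
  have loc: "locally_integrable U (\<lambda>x. f x \<bullet> b)" if "locally_integrable U f" for f :: "real^'m \<Rightarrow> 'v"
    using that by (simp add: locally_integrable_def)
  have int: "(LINT x|lebesgue_on U. \<phi> x *\<^sub>R (f x \<bullet> b)) = (LINT x|lebesgue_on U. \<phi> x *\<^sub>R f x) \<bullet> b"
    if "\<phi> \<in> test_functions U" "integrable (lebesgue_on U) f" for \<phi> and f :: "real^'m \<Rightarrow> 'v"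
    using integral_inner_left[OF integrable_test_function_scaleR[OF that], of b] by simp
  show ?thesis
    using w by (auto simp: has_weak_partial_def loc int[OF _ v] int[OF test_functions_partial u] simp del: real_scaleR_def)
qed

lemma locally_integrableI:
  fixes f :: "real^'m \<Rightarrow> 'v::euclidean_space"
  assumes "U \<in> sets lebesgue" "integrable (lebesgue_on U) f"
  shows "locally_integrable U f"
  using assms integrable_lebesgue_on_subset[OF assms(2)]
  by (auto simp: locally_integrable_def lmeasurable_compact fmeasurableD)

lemma norm_divideR_le:
  fixes y :: "'a::real_normed_vector"
  assumes "h \<noteq> 0" "norm y \<le> \<bar>h\<bar> * c"
  shows "norm (y /\<^sub>R h) \<le> c"
proof -
  have "norm (y /\<^sub>R h) = norm y / \<bar>h\<bar>" by (simp add: divide_inverse_commute)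
  then show ?thesis using assms by (simp add: pos_divide_le_eq mult.commute)
qed

section \<open>Chain rule for Lipschitz maps\<close>

lemma lipschitz_directional_le:
  fixes H :: "'v::euclidean_space \<Rightarrow> 'w::euclidean_space"
  assumes lip: "L-lipschitz_on UNIV H" and D: "(\<lambda>n. (H (a + h n *\<^sub>R b) - H a) /\<^sub>R h n) \<longlonglongrightarrow> D"
    and h: "\<And>n. h n \<noteq> 0"
  shows "norm ((H (a + h n *\<^sub>R b) - H a) /\<^sub>R h n) \<le> L * norm b" "norm D \<le> L * norm b"
proof -
  show le: "norm ((H (a + h n *\<^sub>R b) - H a) /\<^sub>R h n) \<le> L * norm b" for n
  proof -
    have "norm (H (a + h n *\<^sub>R b) - H a) \<le> L * norm (h n *\<^sub>R b)"
      using lipschitz_onD[OF lip, of "a + h n *\<^sub>R b" a] by (simp add: dist_norm)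
    then show ?thesis using h[of n] by (intro norm_divideR_le) (simp_all add: mult_ac)
  qed
  show "norm D \<le> L * norm b"
    by (rule LIMSEQ_le_const2[OF tendsto_norm[OF D]]) (use le in auto)
qed

text \<open>A Lipschitz map has linear growth, and the constant \<open>norm (H 0)\<close> is
  integrable because a bounded \<open>U\<close> has finite measure.\<close>

lemma integrable_lipschitz_compose:
  fixes u :: "'a::euclidean_space \<Rightarrow> 'v::euclidean_space" and H :: "'v \<Rightarrow> 'w::euclidean_space"
  assumes U: "U \<in> sets lebesgue" "bounded U" and u: "integrable (lebesgue_on U) u" and lip: "L-lipschitz_on UNIV H"
  shows "integrable (lebesgue_on U) (\<lambda>x. H (u x))"
proof -
  have L0: "L \<ge> 0" using lip by (rule lipschitz_on_nonneg)
  have [measurable]: "u \<in> borel_measurable (lebesgue_on U)" using u by (rule borel_measurable_integrable)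
  have [measurable]: "H \<in> borel_measurable borel"
    using lip by (intro borel_measurable_continuous_onI lipschitz_on_continuous_on)
  have fin: "finite_measure (lebesgue_on U)"
    using bounded_set_imp_lmeasurable[OF U(2,1)] by (simp add: finite_measure_lebesgue_on)
  show ?thesis
  proof (rule Bochner_Integration.integrable_bound)
    show "integrable (lebesgue_on U) (\<lambda>x. norm (H 0) + L * norm (u x))"
      using u finite_measure.integrable_const[OF fin] by (intro Bochner_Integration.integrable_add) auto
    have "norm (H (u x)) \<le> norm (H 0) + L * norm (u x)" for x
    proof -
      have "norm (H (u x) - H 0) \<le> L * norm (u x)" using lipschitz_onD[OF lip, of "u x" 0] by (simp add: dist_norm)
      then show ?thesis using norm_triangle_sub[of "H (u x)" "H 0"] by linarith
    qed
    then show "AE x in lebesgue_on U. norm (H (u x)) \<le> norm (norm (H 0) + L * norm (u x))"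
      using L0 by (intro AE_I2) (simp add: abs_of_nonneg)
  qed measurable
qed

text \<open>Replacing the increment of \<open>u\<close> by \<open>h v\<close> changes the difference quotient of \<open>H \<circ> u\<close> by at most \<open>L\<close> times the
  distance from the difference quotient of \<open>u\<close> to \<open>v\<close>, which tends to \<open>0\<close> in \<open>L^1\<close>. Steps \<open>h n\<close> of either sign
  are allowed, and \<open>D\<close> may depend on that choice.\<close>

lemma has_weak_partial_lipschitz_compose:
  fixes u v :: "real^'m \<Rightarrow> 'v::euclidean_space" and H :: "'v \<Rightarrow> 'w::euclidean_space"
  assumes U: "open U" "bounded U"
    and u: "integrable (lebesgue_on U) u" and v: "integrable (lebesgue_on U) v"
    and w: "has_weak_partial U j u v"
    and lip: "L-lipschitz_on UNIV H"
    and h: "\<And>n. h n \<noteq> 0" "h \<longlonglongrightarrow> 0"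
    and D: "\<And>a b. (\<lambda>n. (H (a + h n *\<^sub>R b) - H a) /\<^sub>R h n) \<longlonglongrightarrow> D a b"
  shows "has_weak_partial U j (\<lambda>x. H (u x)) (\<lambda>x. D (u x) (v x))"
proof -
  let ?e = "axis j 1 :: real^'m"
  have Um: "U \<in> sets lebesgue" using U by (simp add: lborelD)
  have L0: "L \<ge> 0" using lip by (rule lipschitz_on_nonneg)
  have [measurable]: "u \<in> borel_measurable (lebesgue_on U)" "v \<in> borel_measurable (lebesgue_on U)"
    using u v by (auto intro: borel_measurable_integrable)
  have Hc: "continuous_on UNIV H" using lip by (rule lipschitz_on_continuous_on)
  have [measurable]: "H \<in> borel_measurable borel" using Hc by (rule borel_measurable_continuous_onI)
  define f where "f x = H (u x)" for x
  define g where "g x = D (u x) (v x)" for x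
  have f: "integrable (lebesgue_on U) f"
    unfolding f_def by (rule integrable_lipschitz_compose[OF Um U(2) u lip])
  have "(\<lambda>x. D (u x) (v x)) \<in> borel_measurable (lebesgue_on U)"
    by (rule borel_measurable_LIMSEQ_metric[OF _ D]) measurable
  then have [measurable]: "g \<in> borel_measurable (lebesgue_on U)" by (simp add: g_def[abs_def])
  have g_le: "norm (g x) \<le> L * norm (v x)" for x
    unfolding g_def by (rule lipschitz_directional_le(2)[OF lip D h(1)])
  have g: "integrable (lebesgue_on U) g"
    by (rule Bochner_Integration.integrable_bound[of _ "\<lambda>x. L * norm (v x)"])
       (use v g_le L0 in \<open>auto intro!: AE_I2\<close>)
  have "(LINT x|lebesgue_on U. partial j \<phi> x *\<^sub>R f x) = - (LINT x|lebesgue_on U. \<phi> x *\<^sub>R g x)"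
    if \<phi>: "\<phi> \<in> test_functions U" for \<phi>
  proof -
    define K where "K = closure {x. \<phi> x \<noteq> 0}"
    have K: "compact K" "K \<subseteq> U" using \<phi> by (auto simp: K_def test_functions_def)
    obtain \<epsilon> where \<epsilon>: "\<epsilon> > 0" "(\<Union>x\<in>K. ball x \<epsilon>) \<subseteq> U"
      using compact_subset_open_imp_ball_epsilon_subset[OF K(1) U(1) K(2)] by metis
    \<comment> \<open>The other half of the radius is kept in reserve: points of \<open>V\<close>
      may be shifted by up to \<open>\<epsilon> / 2\<close> without leaving \<open>U\<close>, and
      \<open>k\<close> is a tail of \<open>h\<close> with such steps.\<close>
    define V where "V = (\<Union>x\<in>K. ball x (\<epsilon> / 2))"
    have V: "open V" "K \<subseteq> V" using \<epsilon>(1) by (auto simp: V_def intro!: bexI)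
    have VU: "x + t *\<^sub>R ?e \<in> U" if x: "x \<in> V" and t: "\<bar>t\<bar> \<le> \<epsilon> / 2" for x t
    proof -
      obtain y where y: "y \<in> K" "dist y x < \<epsilon> / 2" using x by (auto simp: V_def)
      have "dist y (x + t *\<^sub>R ?e) \<le> dist y x + dist x (x + t *\<^sub>R ?e)" by (rule dist_triangle)
      also have "dist x (x + t *\<^sub>R ?e) = \<bar>t\<bar>" by (simp add: dist_norm norm_axis_1)
      finally have "y \<in> K" "x + t *\<^sub>R ?e \<in> ball y \<epsilon>" using y t by auto
      then show ?thesis using \<epsilon>(2) by blast
    qed
    have VsU: "V \<subseteq> U" using VU[of _ 0] \<epsilon>(1) by auto
    have Vm: "V \<in> sets lebesgue" using V(1) by (simp add: lborelD)
    have \<phi>V: "\<phi> \<in> test_functions V" using \<phi> V(2) by (auto simp: test_functions_def K_def)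
    obtain B where B: "\<And>x. \<bar>\<phi> x\<bar> \<le> B" using test_functions_bounded[OF \<phi>] by blast
    have B0: "B \<ge> 0" using B[of 0] by linarith
    obtain N where N: "\<And>n. n \<ge> N \<Longrightarrow> \<bar>h n\<bar> < \<epsilon> / 2" using LIMSEQ_D[OF h(2), of "\<epsilon> / 2"] \<epsilon>(1) by auto
    define k where "k n = h (n + N)" for n
    have k: "k n \<noteq> 0" "\<bar>k n\<bar> \<le> \<epsilon> / 2" "k \<longlonglongrightarrow> 0" for n
      using h N[of "n + N"] LIMSEQ_ignore_initial_segment[OF h(2), of N] by (auto simp: k_def[abs_def])
    have kU: "x + t *\<^sub>R ?e \<in> U" if "x \<in> V" "\<bar>t\<bar> \<le> \<bar>k n\<bar>" for x t n
      using VU[of x t] that k(2)[of n] by simp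
    have kD: "(\<lambda>n. (H (a + k n *\<^sub>R b) - H a) /\<^sub>R k n) \<longlonglongrightarrow> D a b" for a b
      using LIMSEQ_ignore_initial_segment[OF D[of a b], of N] by (simp add: k_def)
    define f0 where "f0 x = indicator U x *\<^sub>R f x" for x
    have f0: "integrable lebesgue f0" using f Um unfolding f0_def[abs_def] by (simp add: integrable_restrict_space)
    note f0k = f0[THEN integrable_lebesgue_translate]
    have on_V: "integrable (lebesgue_on V) r" if "integrable (lebesgue_on U) r" for r :: "real^'m \<Rightarrow> 'z::euclidean_space"
      by (rule integrable_lebesgue_on_subset[OF that VsU Vm Um])
    have on_V': "integrable (lebesgue_on V) r" if "integrable lebesgue r" for r :: "real^'m \<Rightarrow> 'z::euclidean_space"
      using integrable_lebesgue_on_subset[of UNIV r V] that Vm by (simp add: lebesgue_on_UNIV_eq)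
    define G where "G t = (LINT x|lebesgue. \<phi> (x - t *\<^sub>R ?e) *\<^sub>R f0 x)" for t
    \<comment> \<open>\<open>I\<close> tests the difference quotient of \<open>H \<circ> u\<close>,
      and \<open>J\<close> the one with increment \<open>k n *\<^sub>R v x\<close> in place of that
      of \<open>u\<close>. The limit of \<open>I\<close> has the derivative on
      \<open>\<phi>\<close>, that of \<open>J\<close> contains \<open>D (u x) (v x)\<close>.\<close>
    define I where "I n = (LINT x|lebesgue_on V. \<phi> x *\<^sub>R ((f0 (x + k n *\<^sub>R ?e) - f0 x) /\<^sub>R k n))" for n
    have I_eq: "I n = (G (k n) - G 0) /\<^sub>R k n" for n
    proof -
      have int: "integrable lebesgue (\<lambda>x. \<phi> x *\<^sub>R r x)" if "integrable lebesgue r" for r :: "real^'m \<Rightarrow> 'w"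
        using integrable_test_function_scaleR[OF \<phi>, where V=UNIV and f=r] that by (simp add: lebesgue_on_UNIV_eq)
      have "(\<lambda>x. \<phi> x *\<^sub>R f0 (x + k n *\<^sub>R ?e)) \<in> borel_measurable lebesgue"
        by (intro borel_measurable_integrable int f0k)
      from integral_lebesgue_translate[OF this, of "- (k n *\<^sub>R ?e)"]
      have sh: "G (k n) = (LINT x|lebesgue. \<phi> x *\<^sub>R f0 (x + k n *\<^sub>R ?e))" by (simp add: G_def)
      have "I n = (LINT x|lebesgue. \<phi> x *\<^sub>R ((f0 (x + k n *\<^sub>R ?e) - f0 x) /\<^sub>R k n))"
        using integral_test_function_support[OF \<phi>V, where U=UNIV and f="\<lambda>x. (f0 (x + k n *\<^sub>R ?e) - f0 x) /\<^sub>R k n"] Vm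
        unfolding I_def lebesgue_on_UNIV_eq by simp
      also have "\<dots> = (LINT x|lebesgue. (\<phi> x *\<^sub>R f0 (x + k n *\<^sub>R ?e) - \<phi> x *\<^sub>R f0 x) /\<^sub>R k n)"
        by (intro Bochner_Integration.integral_cong refl) (simp add: algebra_simps)
      also have "\<dots> = (G (k n) - G 0) /\<^sub>R k n"
        using int[OF f0] int[OF f0k] by (simp add: sh) (simp add: G_def)
      finally show ?thesis .
    qed
    have "((\<lambda>s. (G s - G 0) /\<^sub>R s) \<longlongrightarrow> - (LINT x|lebesgue. partial j \<phi> x *\<^sub>R f0 x)) (at 0)"
      using test_translate_integral_quotient[OF \<phi> f0, where j=j and t=0] by (simp add: G_def)
    then have lim1: "I \<longlonglongrightarrow> - (LINT x|lebesgue. partial j \<phi> x *\<^sub>R f0 x)"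
      unfolding tendsto_at_iff_sequentially comp_def I_eq[abs_def] using k by auto
    define q where "q n x = (H (u x + k n *\<^sub>R v x) - H (u x)) /\<^sub>R k n" for n x
    have [measurable]: "q n \<in> borel_measurable (lebesgue_on U)" for n unfolding q_def by measurable
    have q_le: "norm (q n x) \<le> L * norm (v x)" for n x
      unfolding q_def by (rule lipschitz_directional_le(1)[OF lip kD k(1)])
    have q: "integrable (lebesgue_on U) (q n)" for n
      by (rule Bochner_Integration.integrable_bound[of _ "\<lambda>x. L * norm (v x)"])
         (use v q_le L0 in \<open>auto intro!: AE_I2\<close>)
    define J where "J n = (LINT x|lebesgue_on V. \<phi> x *\<^sub>R q n x)" for n
    have lim2: "J \<longlonglongrightarrow> (LINT x|lebesgue_on V. \<phi> x *\<^sub>R g x)"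
      unfolding J_def
    proof (rule integral_dominated_convergence[where w="\<lambda>x. B * (L * norm (v x))"])
      show "(\<lambda>x. \<phi> x *\<^sub>R g x) \<in> borel_measurable (lebesgue_on V)" "(\<lambda>x. \<phi> x *\<^sub>R q n x) \<in> borel_measurable (lebesgue_on V)" for n
        by (intro borel_measurable_integrable integrable_test_function_scaleR[OF \<phi>] on_V g q)+
      show "integrable (lebesgue_on V) (\<lambda>x. B * (L * norm (v x)))" using on_V[OF v] by simp
      show "AE x in lebesgue_on V. (\<lambda>n. \<phi> x *\<^sub>R q n x) \<longlonglongrightarrow> \<phi> x *\<^sub>R g x"
        unfolding q_def g_def by (intro AE_I2 tendsto_intros kD)
      show "AE x in lebesgue_on V. norm (\<phi> x *\<^sub>R q n x) \<le> B * (L * norm (v x))" for n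
        by (intro AE_I2) (simp only: norm_scaleR real_norm_def, intro mult_mono B q_le B0 norm_ge_zero)
    qed
    define R where "R n = (\<Sum>b\<in>Basis. (LINT x|lebesgue_on V. \<bar>(u (x + k n *\<^sub>R ?e) \<bullet> b - u x \<bullet> b) / k n - v x \<bullet> b\<bar>))" for n
    have ub: "integrable (lebesgue_on U) (\<lambda>x. u x \<bullet> b)" "integrable (lebesgue_on U) (\<lambda>x. v x \<bullet> b)" for b using u v by auto
    note wb = has_weak_partial_inner[OF Um u v w]
    have Rint: "integrable (lebesgue_on V) (\<lambda>x. (u (x + k n *\<^sub>R ?e) \<bullet> b - u x \<bullet> b) / k n - v x \<bullet> b)" for n b
    \<comment> \<open>Only integrability is extracted here, so any finite bound for the gap will
      do.\<close>
    proof (rule difference_quotient_L1_le(2)[OF U(1) V(1) VsU ub wb k(1) kU])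
      show "translation_gap (\<lambda>x. indicator U x *\<^sub>R (v x \<bullet> b)) (t *\<^sub>R ?e) \<le> 2 * (LINT x|lebesgue. \<bar>indicator U x *\<^sub>R (v x \<bullet> b)\<bar>)" for t
        using ub(2) Um by (intro translation_gap_le_norm) (simp add: integrable_restrict_space)
    qed
    have "R \<longlonglongrightarrow> (\<Sum>b\<in>(Basis :: 'v set). 0)"
      unfolding R_def by (intro tendsto_sum difference_quotient_tendsto_L1[OF U(1) V(1) VsU ub wb kU k(1,3)])
    then have R: "R \<longlonglongrightarrow> 0" by simp
    have IJ: "norm (I n - J n) \<le> B * (L * R n)" for n
    proof -
      have i1: "integrable (lebesgue_on V) (\<lambda>x. \<phi> x *\<^sub>R ((f0 (x + k n *\<^sub>R ?e) - f0 x) /\<^sub>R k n))"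
        using f0 f0k by (intro integrable_test_function_scaleR[OF \<phi>] on_V') simp
      have i2: "integrable (lebesgue_on V) (\<lambda>x. \<phi> x *\<^sub>R q n x)"
        by (intro integrable_test_function_scaleR[OF \<phi>] on_V q)
      have "norm (I n - J n) = norm (LINT x|lebesgue_on V. \<phi> x *\<^sub>R ((f0 (x + k n *\<^sub>R ?e) - f0 x) /\<^sub>R k n) - \<phi> x *\<^sub>R q n x)"
        unfolding I_def J_def using i1 i2 by simp
      also have "\<dots> \<le> (LINT x|lebesgue_on V. B * (L * (\<Sum>b\<in>Basis. \<bar>(u (x + k n *\<^sub>R ?e) \<bullet> b - u x \<bullet> b) / k n - v x \<bullet> b\<bar>)))"
      proof (rule order_trans[OF integral_norm_bound], rule integral_mono)
        show "integrable (lebesgue_on V) (\<lambda>x. norm (\<phi> x *\<^sub>R ((f0 (x + k n *\<^sub>R ?e) - f0 x) /\<^sub>R k n) - \<phi> x *\<^sub>R q n x))"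
          using i1 i2 by (intro integrable_norm Bochner_Integration.integrable_diff)
        show "integrable (lebesgue_on V) (\<lambda>x. B * (L * (\<Sum>b\<in>Basis. \<bar>(u (x + k n *\<^sub>R ?e) \<bullet> b - u x \<bullet> b) / k n - v x \<bullet> b\<bar>)))"
          using Rint by (intro integrable_mult_right Bochner_Integration.integrable_sum integrable_abs)
      next
        fix x assume "x \<in> space (lebesgue_on V)"
        then have x: "x \<in> V" by simp
        have xU: "x \<in> U" "x + k n *\<^sub>R ?e \<in> U" using x VsU kU[OF x, of "k n" n] by auto
        let ?d = "(u (x + k n *\<^sub>R ?e) - u x) /\<^sub>R k n - v x"
        have "norm (H (u (x + k n *\<^sub>R ?e)) - H (u x + k n *\<^sub>R v x)) \<le> L * norm (u (x + k n *\<^sub>R ?e) - (u x + k n *\<^sub>R v x))"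
          using lipschitz_onD[OF lip] by (simp add: dist_norm)
        also have "u (x + k n *\<^sub>R ?e) - (u x + k n *\<^sub>R v x) = k n *\<^sub>R ?d" using k(1)[of n] by (simp add: algebra_simps)
        finally have "norm (H (u (x + k n *\<^sub>R ?e)) - H (u x + k n *\<^sub>R v x)) \<le> \<bar>k n\<bar> * (L * norm ?d)" by (simp add: mult_ac)
        then have "norm ((H (u (x + k n *\<^sub>R ?e)) - H (u x + k n *\<^sub>R v x)) /\<^sub>R k n) \<le> L * norm ?d"
          using k(1)[of n] by (intro norm_divideR_le)
        moreover have "norm ?d \<le> (\<Sum>b\<in>Basis. \<bar>(u (x + k n *\<^sub>R ?e) \<bullet> b - u x \<bullet> b) / k n - v x \<bullet> b\<bar>)"
          using norm_le_l1[of ?d] by (simp add: inner_diff_left divide_inverse mult.commute)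
        ultimately have 1: "norm ((H (u (x + k n *\<^sub>R ?e)) - H (u x + k n *\<^sub>R v x)) /\<^sub>R k n)
            \<le> L * (\<Sum>b\<in>Basis. \<bar>(u (x + k n *\<^sub>R ?e) \<bullet> b - u x \<bullet> b) / k n - v x \<bullet> b\<bar>)"
          using L0 by (meson mult_left_mono order_trans)
        have "\<phi> x *\<^sub>R ((f0 (x + k n *\<^sub>R ?e) - f0 x) /\<^sub>R k n) - \<phi> x *\<^sub>R q n x = \<phi> x *\<^sub>R ((H (u (x + k n *\<^sub>R ?e)) - H (u x + k n *\<^sub>R v x)) /\<^sub>R k n)"
          using xU by (simp add: f0_def f_def q_def algebra_simps)
        then have "norm (\<phi> x *\<^sub>R ((f0 (x + k n *\<^sub>R ?e) - f0 x) /\<^sub>R k n) - \<phi> x *\<^sub>R q n x)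
          = \<bar>\<phi> x\<bar> * norm ((H (u (x + k n *\<^sub>R ?e)) - H (u x + k n *\<^sub>R v x)) /\<^sub>R k n)" by (simp add: abs_mult)
        also have "\<dots> \<le> B * (L * (\<Sum>b\<in>Basis. \<bar>(u (x + k n *\<^sub>R ?e) \<bullet> b - u x \<bullet> b) / k n - v x \<bullet> b\<bar>))"
          using 1 B[of x] B0 by (intro mult_mono) auto
        finally show "norm (\<phi> x *\<^sub>R ((f0 (x + k n *\<^sub>R ?e) - f0 x) /\<^sub>R k n) - \<phi> x *\<^sub>R q n x)
          \<le> B * (L * (\<Sum>b\<in>Basis. \<bar>(u (x + k n *\<^sub>R ?e) \<bullet> b - u x \<bullet> b) / k n - v x \<bullet> b\<bar>))" .
      qed
      also have "\<dots> = B * (L * R n)" unfolding R_def using Rint by (simp add: Bochner_Integration.integral_sum)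
      finally show ?thesis .
    qed
    have "(\<lambda>n. I n - J n) \<longlonglongrightarrow> 0"
      by (rule Lim_null_comparison[where g="\<lambda>n. B * (L * R n)"])
         (use IJ R in \<open>auto intro!: always_eventually tendsto_mult_right_zero\<close>)
    then have "I \<longlonglongrightarrow> (LINT x|lebesgue_on V. \<phi> x *\<^sub>R g x)"
      using tendsto_add[OF _ lim2] by fastforce
    then have "- (LINT x|lebesgue. partial j \<phi> x *\<^sub>R f0 x) = (LINT x|lebesgue_on V. \<phi> x *\<^sub>R g x)"
      using lim1 LIMSEQ_unique by blast
    then show ?thesis
      unfolding integral_test_function_support[OF \<phi>V VsU Vm Um] integral_lebesgue_on_eq[OF Um, of "partial j \<phi>"]
      by (simp add: f0_def minus_equation_iff)
  qed
  then show "has_weak_partial U j (\<lambda>x. H (u x)) (\<lambda>x. D (u x) (v x))"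
    unfolding has_weak_partial_def f_def[symmetric] g_def[symmetric]
    using locally_integrableI[OF Um f] locally_integrableI[OF Um g] by simp
qed

section \<open>Directional derivatives of convex functions\<close>

definition step :: "nat \<Rightarrow> real" where "step n = 1 / real (Suc n)"

lemma step_pos: "step n > 0" and step_nz: "step n \<noteq> 0" and step_tendsto: "step \<longlonglongrightarrow> 0"
proof -
  have "(\<lambda>n. 1 / real (Suc n)) \<longlonglongrightarrow> 0" by (rule LIMSEQ_Suc[OF lim_1_over_n])
  then show "step \<longlonglongrightarrow> 0" by (simp add: step_def[abs_def])
qed (auto simp: step_def)

text \<open>For convex \<open>H\<close> the quotients are monotone in the step, so the limit along
  one sequence is the one-sided derivative; elsewhere \<open>lim\<close> has significance only if
  the limit exists.\<close>

definition directional :: "('v::euclidean_space \<Rightarrow> 'w::euclidean_space) \<Rightarrow> 'v \<Rightarrow> 'v \<Rightarrow> 'w" where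
  "directional H a b = lim (\<lambda>n. (H (a + step n *\<^sub>R b) - H a) /\<^sub>R step n)"

text \<open>The nearer point is the convex combination of \<open>a\<close> and the farther point
  with weight \<open>s / t\<close> on the latter.\<close>

lemma convex_quotient_mono:
  fixes H :: "'v::real_vector \<Rightarrow> real"
  assumes H: "convex_on UNIV H" and st: "0 < s" "s \<le> t"
  shows "(H (a + s *\<^sub>R b) - H a) / s \<le> (H (a + t *\<^sub>R b) - H a) / t"
proof -
  define r where "r = s / t"
  have r: "0 \<le> r" "r \<le> 1" "r * t = s" using st by (auto simp: r_def)
  have "a + s *\<^sub>R b = (1 - r) *\<^sub>R a + r *\<^sub>R (a + t *\<^sub>R b)"
    using r(3) by (simp add: algebra_simps)
  then have "H (a + s *\<^sub>R b) \<le> (1 - r) * H a + r * H (a + t *\<^sub>R b)"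
    using convex_onD[OF H r(1,2)] by simp
  then have "H (a + s *\<^sub>R b) - H a \<le> s / t * (H (a + t *\<^sub>R b) - H a)" by (simp add: r_def algebra_simps)
  then show ?thesis using st by (simp add: divide_simps mult_ac)
qed

text \<open>\<open>a\<close> lies between the backward and the forward point, with weights
  \<open>t / (s + t)\<close> and \<open>s / (s + t)\<close>.\<close>

lemma convex_quotient_lower_bound:
  fixes H :: "'v::real_vector \<Rightarrow> real"
  assumes H: "convex_on UNIV H" and st: "0 < s" "0 < t"
  shows "- ((H (a + s *\<^sub>R (- b)) - H a) / s) \<le> (H (a + t *\<^sub>R b) - H a) / t"
proof -
  define r where "r = s / (s + t)"
  have r: "0 \<le> r" "r \<le> 1" using st by (auto simp: r_def)
  have "r * t - (1 - r) * s = 0" using st by (simp add: r_def field_simps)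
  moreover have "(1 - r) *\<^sub>R (a + s *\<^sub>R (- b)) + r *\<^sub>R (a + t *\<^sub>R b) = a + (r * t - (1 - r) * s) *\<^sub>R b"
    by (simp add: algebra_simps)
  ultimately have "(1 - r) *\<^sub>R (a + s *\<^sub>R (- b)) + r *\<^sub>R (a + t *\<^sub>R b) = a" by simp
  then have "H a \<le> (1 - r) * H (a + s *\<^sub>R (- b)) + r * H (a + t *\<^sub>R b)"
    using convex_onD[OF H r, of "a + s *\<^sub>R (- b)" "a + t *\<^sub>R b"] by simp
  then have "(s + t) * H a \<le> (s + t) * ((1 - r) * H (a + s *\<^sub>R (- b)) + r * H (a + t *\<^sub>R b))"
    using st by (intro mult_left_mono) auto
  moreover have "(s + t) * r = s" using st by (simp add: r_def)
  moreover from this have "(s + t) * (1 - r) = t" by (simp add: right_diff_distrib)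
  ultimately have "(s + t) * H a \<le> t * H (a + s *\<^sub>R (- b)) + s * H (a + t *\<^sub>R b)"
    by (simp only: distrib_left[of "s + t"] mult.assoc[symmetric])
  then show ?thesis using st by (simp add: divide_simps algebra_simps)
qed

text \<open>The quotients decrease along \<open>step\<close> and are bounded below by minus the
  quotient with step 1 in the opposite direction. That the limit lies below each of them,
  \<open>directional_le\<close>, is the source of semicontinuity.\<close>

lemma convex_directional:
  fixes H :: "'v::euclidean_space \<Rightarrow> real"
  assumes H: "convex_on UNIV H"
  shows directional_tendsto: "(\<lambda>n. (H (a + step n *\<^sub>R b) - H a) /\<^sub>R step n) \<longlonglongrightarrow> directional H a b"
    and directional_le: "directional H a b \<le> (H (a + step n *\<^sub>R b) - H a) / step n"
proof -
  let ?q = "\<lambda>n. (H (a + step n *\<^sub>R b) - H a) /\<^sub>R step n"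
  have q: "?q n = (H (a + step n *\<^sub>R b) - H a) / step n" for n by (simp add: divide_inverse mult.commute)
  have dec: "decseq ?q"
  proof (rule decseq_SucI)
    fix n
    have "step (Suc n) \<le> step n" by (simp add: step_def frac_le)
    then show "?q (Suc n) \<le> ?q n" unfolding q by (intro convex_quotient_mono[OF H] step_pos)
  qed
  have lb: "- ((H (a + 1 *\<^sub>R (- b)) - H a) / 1) \<le> ?q n" for n
    unfolding q by (rule convex_quotient_lower_bound[OF H _ step_pos]) simp
  obtain l where "?q \<longlonglongrightarrow> l"
    by (rule decseq_convergent[OF dec, of "- ((H (a + 1 *\<^sub>R (- b)) - H a) / 1)"]) (use lb in blast)
  then have "convergent ?q" by (rule convergentI)
  then show lim: "?q \<longlonglongrightarrow> directional H a b" unfolding directional_def by (simp add: convergent_LIMSEQ_iff)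
  show "directional H a b \<le> (H (a + step n *\<^sub>R b) - H a) / step n"
    using decseq_ge[OF dec lim, of n] by (simp only: q)
qed

lemma directional_minus_le:
  fixes H :: "'v::euclidean_space \<Rightarrow> real"
  assumes H: "convex_on UNIV H"
  shows "- directional H a (- b) \<le> directional H a b"
proof (rule LIMSEQ_le[OF tendsto_minus[OF directional_tendsto[OF H]] directional_tendsto[OF H]])
  show "\<exists>N. \<forall>n\<ge>N. - ((H (a + step n *\<^sub>R (- b)) - H a) /\<^sub>R step n) \<le> (H (a + step n *\<^sub>R b) - H a) /\<^sub>R step n"
    using convex_quotient_lower_bound[OF H step_pos step_pos] by (simp add: divide_inverse mult.commute)
qed

text \<open>The directional derivative of a convex function is upper semicontinuous in the base point; where
  it is odd in the direction this applies to both directions and gives continuity.\<close>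

lemma directional_continuous_at_odd:
  fixes H :: "'v::euclidean_space \<Rightarrow> real"
  assumes H: "convex_on UNIV H" "continuous_on UNIV H"
    and x: "x \<longlonglongrightarrow> a" and odd: "directional H a b = - directional H a (- b)"
  shows "(\<lambda>n. directional H (x n) b) \<longlonglongrightarrow> directional H a b"
proof -
  have cont: "(\<lambda>n. H (x n + c)) \<longlonglongrightarrow> H (a + c)" for c
    by (rule continuous_on_tendsto_compose[OF H(2)]) (auto intro: tendsto_add[OF x tendsto_const])
  have usc: "\<forall>\<^sub>F n in sequentially. directional H (x n) c < directional H a c + e" if "e > 0" for c e
  proof -
    have "\<forall>\<^sub>F k in sequentially. (H (a + step k *\<^sub>R c) - H a) /\<^sub>R step k < directional H a c + e"
      using directional_tendsto[OF H(1)] that by (intro order_tendstoD(2)[where y="directional H a c"]) auto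
    \<comment> \<open>The step is fixed before \<open>n\<close>: at a fixed step the quotient is
      continuous in the base point and dominates the directional derivative there.\<close>
    then obtain k where k: "(H (a + step k *\<^sub>R c) - H a) / step k < directional H a c + e"
      by (auto simp: eventually_sequentially divide_inverse mult.commute)
    have "(\<lambda>n. (H (x n + step k *\<^sub>R c) - H (x n)) / step k) \<longlonglongrightarrow> (H (a + step k *\<^sub>R c) - H a) / step k"
      using cont cont[of 0] step_nz by (auto intro!: tendsto_intros)
    from order_tendstoD(2)[OF this k] show ?thesis
      by eventually_elim (rule le_less_trans[OF directional_le[OF H(1)]])
  qed
  show ?thesis
  proof (rule LIMSEQ_I)
    fix e :: real assume e: "e > 0"
    have "\<forall>\<^sub>F n in sequentially. norm (directional H (x n) b - directional H a b) < e"
      using usc[OF e, of b] usc[OF e, of "- b"]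
    proof eventually_elim
      case (elim n)
      \<comment> \<open>The lower bound is semicontinuity in direction \<open>- b\<close>, reversed
        by \<open>directional_minus_le\<close> at \<open>x n\<close> and by oddness at
        \<open>a\<close>.\<close>
      then show ?case using directional_minus_le[OF H(1), of "x n" b] odd by auto
    qed
    then show "\<exists>N. \<forall>n\<ge>N. norm (directional H (x n) b - directional H a b) < e" by (simp add: eventually_sequentially)
  qed
qed

section \<open>Lebesgue norms\<close>

text \<open>If \<open>X\<close> left a neighbourhood of \<open>l\<close> infinitely often, the
  subsequence of those indices would have no further subsequence tending to \<open>l\<close>. This
  suits almost everywhere convergence, which is available only along subsequences.\<close>

lemma tendsto_subsequence_principle:
  fixes X :: "nat \<Rightarrow> 'a::topological_space"
  assumes "\<And>r :: nat \<Rightarrow> nat. strict_mono r \<Longrightarrow> \<exists>s :: nat \<Rightarrow> nat. strict_mono s \<and> (\<lambda>n. X (r (s n))) \<longlonglongrightarrow> l"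
  shows "X \<longlonglongrightarrow> l"
proof (rule topological_tendstoI, rule ccontr)
  fix S assume S: "open S" "l \<in> S" and ev: "\<not> (\<forall>\<^sub>F n in sequentially. X n \<in> S)"
  define I where "I = {n. X n \<notin> S}"
  have I: "infinite I"
    using ev unfolding I_def by (auto simp: eventually_cofinite simp flip: cofinite_eq_sequentially)
  obtain s :: "nat \<Rightarrow> nat" where s: "strict_mono s" "(\<lambda>n. X (enumerate I (s n))) \<longlonglongrightarrow> l"
    using assms[OF strict_mono_enumerate[OF I]] by blast
  have "\<forall>\<^sub>F n in sequentially. X (enumerate I (s n)) \<in> S" by (rule topological_tendstoD[OF s(2) S])
  then obtain n where "X (enumerate I (s n)) \<in> S" by (auto simp: eventually_sequentially)
  then show False using enumerate_in_set[OF I, of "s n"] by (simp add: I_def)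
qed

lemma ennreal_tendsto_0_iff_real:
  fixes X :: "'a \<Rightarrow> ennreal"
  shows "(X \<longlongrightarrow> 0) F \<longleftrightarrow> (\<forall>e>0. \<forall>\<^sub>F n in F. X n < ennreal e)"
proof
  assume "(X \<longlongrightarrow> 0) F"
  then show "\<forall>e>0. \<forall>\<^sub>F n in F. X n < ennreal e" by (auto intro: order_tendstoD(2))
next
  assume *: "\<forall>e>0. \<forall>\<^sub>F n in F. X n < ennreal e"
  show "(X \<longlongrightarrow> 0) F"
  proof (rule order_tendstoI)
    fix a :: ennreal assume "0 < a"
    then obtain c where c: "0 < c" "c < a" using dense by blast
    then obtain e where "c = ennreal e" "e \<ge> 0" by (cases c) auto
    with c have "e > 0" "ennreal e < a" by auto
    from * \<open>e > 0\<close> have "\<forall>\<^sub>F n in F. X n < ennreal e" by blast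
    then show "\<forall>\<^sub>F n in F. X n < a"
      by eventually_elim (auto intro: less_trans[OF _ \<open>ennreal e < a\<close>])
  qed simp
qed

text \<open>The q-th power of the norm, the form to which dominated convergence applies.\<close>

definition Lq_integral :: "real \<Rightarrow> (real^'m) set \<Rightarrow> (real^'m \<Rightarrow> 'v::real_normed_vector) \<Rightarrow> ennreal" where
  "Lq_integral q U f = (\<integral>\<^sup>+ x. ennreal (norm (f x) powr q) \<partial>lebesgue_on U)"

lemma Lq_norm_eq: "Lq_norm q U f = (if Lq_integral q U f = \<infinity> then \<infinity> else ennreal (enn2real (Lq_integral q U f) powr (1 / q)))"
  by (simp add: Lq_norm_def Lq_integral_def Let_def)

lemma Lq_norm_finite_iff: "Lq_norm q U f < \<infinity> \<longleftrightarrow> Lq_integral q U f < \<infinity>"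
  by (auto simp: Lq_norm_eq less_top)

lemma Lq_norm_le_iff:
  assumes "q > 0" "c \<ge> 0"
  shows "Lq_norm q U f \<le> ennreal c \<longleftrightarrow> Lq_integral q U f \<le> ennreal (c powr q)"
proof (cases "Lq_integral q U f")
  case (real I)
  then have "Lq_norm q U f = ennreal (I powr (1 / q))" by (simp add: Lq_norm_eq)
  moreover have "I powr (1 / q) \<le> c \<longleftrightarrow> I \<le> c powr q"
  proof
    assume "I powr (1 / q) \<le> c"
    then have "(I powr (1 / q)) powr q \<le> c powr q" using assms by (intro powr_mono2) auto
    then show "I \<le> c powr q" using assms real by (simp add: powr_powr)
  next
    assume "I \<le> c powr q"
    then have "I powr (1 / q) \<le> (c powr q) powr (1 / q)" using assms real by (intro powr_mono2) auto
    then show "I powr (1 / q) \<le> c" using assms by (simp add: powr_powr)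
  qed
  ultimately show ?thesis using assms real by (simp add: ennreal_le_iff)
qed (simp add: Lq_norm_eq top_unique)

lemma Lq_norm_tendsto_0_iff:
  assumes q: "q > 0"
  shows "((\<lambda>n. Lq_norm q U (f n)) \<longlongrightarrow> 0) F \<longleftrightarrow> ((\<lambda>n. Lq_integral q U (f n)) \<longlongrightarrow> 0) F"
proof
  assume lim: "((\<lambda>n. Lq_norm q U (f n)) \<longlongrightarrow> 0) F"
  show "((\<lambda>n. Lq_integral q U (f n)) \<longlongrightarrow> 0) F"
    unfolding ennreal_tendsto_0_iff_real
  proof (intro allI impI)
    fix e :: real assume e: "e > 0"
    define c where "c = (e / 2) powr (1 / q)"
    have c: "c > 0" "c powr q = e / 2" using e q by (auto simp: c_def powr_powr)
    have "\<forall>\<^sub>F n in F. Lq_norm q U (f n) < ennreal c" using lim c(1) by (simp add: ennreal_tendsto_0_iff_real)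
    then show "\<forall>\<^sub>F n in F. Lq_integral q U (f n) < ennreal e"
    proof eventually_elim
      case (elim n)
      then have "Lq_integral q U (f n) \<le> ennreal (c powr q)"
        using c(1) by (intro Lq_norm_le_iff[OF q, THEN iffD1]) auto
      also have "\<dots> < ennreal e" using c(2) e by (simp add: ennreal_less_iff)
      finally show ?case .
    qed
  qed
next
  assume lim: "((\<lambda>n. Lq_integral q U (f n)) \<longlongrightarrow> 0) F"
  show "((\<lambda>n. Lq_norm q U (f n)) \<longlongrightarrow> 0) F"
    unfolding ennreal_tendsto_0_iff_real
  proof (intro allI impI)
    fix e :: real assume e: "e > 0"
    have "\<forall>\<^sub>F n in F. Lq_integral q U (f n) < ennreal ((e / 2) powr q)" using lim e by (simp add: ennreal_tendsto_0_iff_real)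
    then show "\<forall>\<^sub>F n in F. Lq_norm q U (f n) < ennreal e"
    proof eventually_elim
      case (elim n)
      then have "Lq_norm q U (f n) \<le> ennreal (e / 2)"
        using e by (intro Lq_norm_le_iff[OF q, THEN iffD2]) auto
      also have "\<dots> < ennreal e" using e by (simp add: ennreal_less_iff)
      finally show ?case .
    qed
  qed
qed

lemma Lq_norm_mono_AE:
  assumes "q > 0" "AE x in lebesgue_on U. norm (f x) \<le> norm (g x)"
  shows "Lq_norm q U f \<le> Lq_norm q U g"
proof -
  have "Lq_integral q U f \<le> Lq_integral q U g"
    unfolding Lq_integral_def
    by (rule nn_integral_mono_AE, use assms(2) in eventually_elim) (auto intro!: ennreal_leI powr_mono2 simp: assms(1) less_imp_le)
  then show ?thesis
    using assms(1) by (auto simp: Lq_norm_eq top_unique less_top intro!: ennreal_leI powr_mono2 enn2real_mono)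
qed

lemma Lq_norm_cong_AE:
  assumes "AE x in lebesgue_on U. norm (f x) = norm (g x)"
  shows "Lq_norm q U f = Lq_norm q U g"
proof -
  have "Lq_integral q U f = Lq_integral q U g"
    unfolding Lq_integral_def by (rule nn_integral_cong_AE, use assms in eventually_elim) auto
  then show ?thesis by (simp add: Lq_norm_eq)
qed

lemma Lq_integral_scale:
  assumes "f \<in> borel_measurable (lebesgue_on U)" "c \<ge> 0"
  shows "Lq_integral q U (\<lambda>x. c * norm (f x)) = ennreal (c powr q) * Lq_integral q U f"
proof -
  have [measurable]: "f \<in> borel_measurable (lebesgue_on U)" by fact
  have "Lq_integral q U (\<lambda>x. c * norm (f x)) = (\<integral>\<^sup>+ x. ennreal (c powr q) * ennreal (norm (f x) powr q) \<partial>lebesgue_on U)"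
    unfolding Lq_integral_def using assms(2) by (intro nn_integral_cong) (simp add: powr_mult flip: ennreal_mult)
  also have "\<dots> = ennreal (c powr q) * Lq_integral q U f"
    unfolding Lq_integral_def by (rule nn_integral_cmult) measurable
  finally show ?thesis .
qed

section \<open>Minkowski's inequality\<close>

lemma powr_convex_combination:
  fixes x y t q :: real
  assumes q: "q \<ge> 1" and xy: "x \<ge> 0" "y \<ge> 0" and t: "0 \<le> t" "t \<le> 1"
  shows "((1 - t) * x + t * y) powr q \<le> (1 - t) * x powr q + t * y powr q"
proof -
  have le: "(s * z) powr q \<le> s * z powr q" if "0 \<le> s" "s \<le> 1" "z \<ge> 0" for s z :: real
  proof -
    have "s powr q \<le> s powr 1" using that q by (intro powr_mono') auto
    then have "s powr q * z powr q \<le> s powr 1 * z powr q" by (intro mult_right_mono) auto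
    then show ?thesis using that by (simp add: powr_mult)
  qed
  \<comment> \<open>Convexity of the power is used for positive arguments; where one argument is 0,
    \<open>le\<close> suffices.\<close>
  consider "x = 0" | "y = 0" | "x > 0" "y > 0" using xy by linarith
  then show ?thesis
  proof cases
    case 1 then show ?thesis using le[of t y] t xy by simp
  next
    case 2 then show ?thesis using le[of "1 - t" x] t xy by simp
  next
    case 3 then show ?thesis using convex_onD[OF powr_convex[OF q], of t x y] t by simp
  qed
qed

text \<open>With \<open>a\<close>, \<open>b\<close> the two norms, this is convexity of \<open>s \<mapsto> s^q\<close> applied to the convex combination
  of \<open>x / a\<close> and \<open>y / b\<close> with weights \<open>a / (a + b)\<close> and \<open>b / (a + b)\<close>.\<close>

lemma minkowski_pointwise:
  fixes x y a b q :: real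
  assumes q: "q \<ge> 1" and xy: "x \<ge> 0" "y \<ge> 0" and ab: "a > 0" "b > 0"
  shows "(x + y) powr q \<le> (a + b) powr q * (a / (a + b) * (x powr q / a powr q) + b / (a + b) * (y powr q / b powr q))"
proof -
  define t where "t = b / (a + b)"
  have t: "0 \<le> t" "t \<le> 1" "1 - t = a / (a + b)" using ab by (auto simp: t_def field_simps)
  have eq: "x + y = (a + b) * ((1 - t) * (x / a) + t * (y / b))"
  proof -
    have "(1 - t) * (x / a) = x / (a + b)" "t * (y / b) = y / (a + b)" using ab by (simp_all add: t(3)) (simp add: t_def)
    then show ?thesis using ab by (simp flip: add_divide_distrib)
  qed
  have "(x + y) powr q = (a + b) powr q * ((1 - t) * (x / a) + t * (y / b)) powr q"
    unfolding eq using ab xy t by (intro powr_mult) 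
  also have "\<dots> \<le> (a + b) powr q * ((1 - t) * (x / a) powr q + t * (y / b) powr q)"
    using ab xy t by (intro mult_left_mono powr_convex_combination q) auto
  also have "\<dots> = (a + b) powr q * (a / (a + b) * (x powr q / a powr q) + b / (a + b) * (y powr q / b powr q))"
    using ab xy t(3) by (simp add: t_def powr_divide)
  finally show ?thesis .
qed

text \<open>Normalising divides by the norms, which may be 0. The estimate is therefore made with
  strictly positive upper bounds \<open>a\<close> and \<open>b\<close>, and the slack
  \<open>e\<close> is removed at the end.\<close>

lemma Lq_norm_triangle:
  fixes f g :: "real^'m \<Rightarrow> 'v::euclidean_space"
  assumes q: "q \<ge> 1" and [measurable]: "f \<in> borel_measurable (lebesgue_on U)" "g \<in> borel_measurable (lebesgue_on U)"
  shows "Lq_norm q U (\<lambda>x. f x + g x) \<le> Lq_norm q U f + Lq_norm q U g"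
proof (cases "Lq_norm q U f = \<infinity> \<or> Lq_norm q U g = \<infinity>")
  case False
  have q0: "q > 0" using q by simp
  have bound: "Lq_norm q U (\<lambda>x. f x + g x) \<le> ennreal (a + b)"
    if a: "a > 0" "Lq_norm q U f \<le> ennreal a" and b: "b > 0" "Lq_norm q U g \<le> ennreal b" for a b
  proof -
    define \<alpha> where "\<alpha> = (a + b) powr q * (a / (a + b)) / a powr q"
    define \<beta> where "\<beta> = (a + b) powr q * (b / (a + b)) / b powr q"
    have \<alpha>\<beta>: "\<alpha> \<ge> 0" "\<beta> \<ge> 0" using a b by (auto simp: \<alpha>_def \<beta>_def)
    have "Lq_integral q U (\<lambda>x. f x + g x) \<le> (\<integral>\<^sup>+ x. ennreal \<alpha> * ennreal (norm (f x) powr q) + ennreal \<beta> * ennreal (norm (g x) powr q) \<partial>lebesgue_on U)"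
      unfolding Lq_integral_def
    proof (rule nn_integral_mono)
      fix x
      have "norm (f x + g x) powr q \<le> (norm (f x) + norm (g x)) powr q"
        using q0 by (intro powr_mono2 norm_triangle_ineq) auto
      also have "\<dots> \<le> \<alpha> * norm (f x) powr q + \<beta> * norm (g x) powr q"
        using minkowski_pointwise[OF q, of "norm (f x)" "norm (g x)" a b] a b
        by (simp add: \<alpha>_def \<beta>_def algebra_simps)
      finally show "ennreal (norm (f x + g x) powr q) \<le> ennreal \<alpha> * ennreal (norm (f x) powr q) + ennreal \<beta> * ennreal (norm (g x) powr q)"
        using \<alpha>\<beta> by (simp add: ennreal_leI flip: ennreal_mult ennreal_plus)
    qed
    also have "\<dots> = ennreal \<alpha> * Lq_integral q U f + ennreal \<beta> * Lq_integral q U g"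
      unfolding Lq_integral_def by (simp add: nn_integral_add nn_integral_cmult)
    also have "\<dots> \<le> ennreal \<alpha> * ennreal (a powr q) + ennreal \<beta> * ennreal (b powr q)"
      using a b by (intro add_mono mult_left_mono Lq_norm_le_iff[OF q0, THEN iffD1]) auto
    also have "\<dots> = ennreal ((a + b) powr q)"
    proof -
      have "\<alpha> * a powr q = (a + b) powr q * (a / (a + b))" "\<beta> * b powr q = (a + b) powr q * (b / (a + b))"
        using a b by (simp_all add: \<alpha>_def \<beta>_def)
      then have "\<alpha> * a powr q + \<beta> * b powr q = (a + b) powr q * ((a + b) / (a + b))"
        by (simp only: add_divide_distrib distrib_left)
      also have "\<dots> = (a + b) powr q" using a b by simp
      finally show ?thesis using \<alpha>\<beta> by (simp flip: ennreal_mult ennreal_plus)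
    qed
    finally show ?thesis using a b by (intro Lq_norm_le_iff[OF q0, THEN iffD2]) auto
  qed
  obtain a0 b0 where ab: "a0 \<ge> 0" "b0 \<ge> 0" "Lq_norm q U f = ennreal a0" "Lq_norm q U g = ennreal b0"
    using False by (metis ennreal_cases infinity_ennreal_def)
  have "Lq_norm q U (\<lambda>x. f x + g x) \<le> Lq_norm q U f + Lq_norm q U g + ennreal e" if "e > 0" for e
  proof -
    have "Lq_norm q U (\<lambda>x. f x + g x) \<le> ennreal ((a0 + e / 2) + (b0 + e / 2))"
      using ab that by (intro bound) (auto intro!: ennreal_leI)
    also have "\<dots> = Lq_norm q U f + Lq_norm q U g + ennreal e"
      using ab that by (simp flip: ennreal_plus)
    finally show ?thesis .
  qed
  then show ?thesis by (rule ennreal_le_epsilon)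
qed auto

text \<open>A sandwich between the norm of \<open>g\<close> minus and plus the error; finiteness
  excludes a difference of infinities in \<open>ennreal\<close>.\<close>

lemma Lq_norm_tendsto:
  fixes g :: "real^'m \<Rightarrow> 'v::euclidean_space"
  assumes q: "q \<ge> 1" and [measurable]: "g \<in> borel_measurable (lebesgue_on U)" "\<And>n. f n \<in> borel_measurable (lebesgue_on U)"
    and fin: "Lq_norm q U g < \<infinity>" and lim: "(\<lambda>n. Lq_norm q U (\<lambda>x. f n x - g x)) \<longlonglongrightarrow> 0"
  shows "(\<lambda>n. Lq_norm q U (f n)) \<longlonglongrightarrow> Lq_norm q U g"
proof (rule tendsto_sandwich)
  have swap: "Lq_norm q U (\<lambda>x. g x - f n x) = Lq_norm q U (\<lambda>x. f n x - g x)" for n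
    by (rule Lq_norm_cong_AE) (simp add: norm_minus_commute)
  have "Lq_norm q U (f n) \<le> Lq_norm q U g + Lq_norm q U (\<lambda>x. f n x - g x)" for n
    using Lq_norm_triangle[OF q, of g U "\<lambda>x. f n x - g x"] by simp
  then show "\<forall>\<^sub>F n in sequentially. Lq_norm q U (f n) \<le> Lq_norm q U g + Lq_norm q U (\<lambda>x. f n x - g x)" by simp
  have "Lq_norm q U g \<le> Lq_norm q U (\<lambda>x. f n x - g x) + Lq_norm q U (f n)" for n
    using Lq_norm_triangle[OF q, of "f n" U "\<lambda>x. g x - f n x"] by (simp add: swap add.commute)
  then show "\<forall>\<^sub>F n in sequentially. Lq_norm q U g - Lq_norm q U (\<lambda>x. f n x - g x) \<le> Lq_norm q U (f n)"
    using fin by (intro always_eventually allI ennreal_minus_le_iff[THEN iffD2]) auto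
  show "(\<lambda>n. Lq_norm q U g + Lq_norm q U (\<lambda>x. f n x - g x)) \<longlonglongrightarrow> Lq_norm q U g"
    using tendsto_add[OF tendsto_const lim, of "Lq_norm q U g"] by simp
  show "(\<lambda>n. Lq_norm q U g - Lq_norm q U (\<lambda>x. f n x - g x)) \<longlonglongrightarrow> Lq_norm q U g"
    using tendsto_diff_ennreal[OF tendsto_const lim, of "Lq_norm q U g"] fin by simp
qed

section \<open>Derivatives of the ordered eigenvalues\<close>

text \<open>A Lipschitz extension of the ordered eigenvalues from \<open>Herm\<close> to all
  matrices, so that the chain rule can be applied with \<open>UNIV\<close> as domain.\<close>

definition spectrum :: "complex^('d::{finite,linorder})^('d::{finite,linorder}) \<Rightarrow> real^('d::{finite,linorder})" where
  "spectrum a = (\<chi> i. 2 * max_weighted_trace (bumped_weight i) a - 2 * max_weighted_trace rank_weight a)"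

definition dspectrum :: "complex^('d::{finite,linorder})^('d::{finite,linorder}) \<Rightarrow> complex^('d::{finite,linorder})^('d::{finite,linorder}) \<Rightarrow> real^('d::{finite,linorder})" where
  "dspectrum a b = (\<chi> i. 2 * directional (max_weighted_trace (bumped_weight i)) a b
     - 2 * directional (max_weighted_trace rank_weight) a b)"

lemma eigvals_incr_eq_spectrum: "a \<in> Herm \<Longrightarrow> eigvals_incr a = spectrum a"
  by (simp add: vec_eq_iff spectrum_def eigvals_incr_max_weighted_trace)

lemma spectrum_lipschitz:
  obtains L where "L-lipschitz_on UNIV (spectrum :: complex^('d::{finite,linorder})^('d::{finite,linorder}) \<Rightarrow> real^('d::{finite,linorder}))"
proof -
  have "\<exists>L. L-lipschitz_on UNIV (max_weighted_trace w)" for w :: "'d \<Rightarrow> real"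
    using lipschitz_max_weighted_trace by metis
  then obtain L where L: "(L w)-lipschitz_on UNIV (max_weighted_trace w)" for w :: "'d \<Rightarrow> real" by metis
  have L0: "L w \<ge> 0" for w using L by (rule lipschitz_on_nonneg)
  define C where "C = (\<Sum>i\<in>UNIV. 2 * L (bumped_weight i) + 2 * L rank_weight)"
  have "C-lipschitz_on UNIV (spectrum :: complex^('d::{finite,linorder})^('d::{finite,linorder}) \<Rightarrow> real^('d::{finite,linorder}))"
  proof (rule lipschitz_onI)
    fix a b :: "complex^('d::{finite,linorder})^('d::{finite,linorder})"
    have "norm (spectrum a - spectrum b) \<le> (\<Sum>i\<in>UNIV. \<bar>spectrum a $ i - spectrum b $ i\<bar>)"
      using norm_le_l1_cart[of "spectrum a - spectrum b"] by simp
    also have "\<dots> \<le> (\<Sum>i\<in>UNIV. (2 * L (bumped_weight i) + 2 * L rank_weight) * dist a b)"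
    proof (rule sum_mono)
      fix i
      have "\<bar>max_weighted_trace w a - max_weighted_trace w b\<bar> \<le> L w * dist a b" for w
        using lipschitz_onD[OF L, of a b] by (simp add: dist_real_def)
      from this[of "bumped_weight i"] this[of rank_weight]
      show "\<bar>spectrum a $ i - spectrum b $ i\<bar> \<le> (2 * L (bumped_weight i) + 2 * L rank_weight) * dist a b"
        by (simp add: spectrum_def algebra_simps)
    qed
    finally show "dist (spectrum a) (spectrum b) \<le> C * dist a b" by (simp add: C_def sum_distrib_right dist_norm)
  qed (auto simp: C_def L0 intro!: sum_nonneg)
  then show ?thesis using that by blast
qed

lemma spectrum_directional:
  "(\<lambda>n. (spectrum (a + step n *\<^sub>R b) - spectrum a) /\<^sub>R step n) \<longlonglongrightarrow> dspectrum a b"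
proof (rule vec_tendstoI)
  fix i
  have "(\<lambda>n. 2 * ((max_weighted_trace (bumped_weight i) (a + step n *\<^sub>R b) - max_weighted_trace (bumped_weight i) a) /\<^sub>R step n)
     - 2 * ((max_weighted_trace rank_weight (a + step n *\<^sub>R b) - max_weighted_trace rank_weight a) /\<^sub>R step n))
     \<longlonglongrightarrow> dspectrum a b $ i"
    unfolding dspectrum_def vec_lambda_beta
    by (intro tendsto_intros directional_tendsto convex_on_max_weighted_trace)
  then show "(\<lambda>n. ((spectrum (a + step n *\<^sub>R b) - spectrum a) /\<^sub>R step n) $ i) \<longlonglongrightarrow> dspectrum a b $ i"
    by (simp add: spectrum_def algebra_simps)
qed

text \<open>The two displaced points differ by the step times \<open>b - c\<close>, so the bound
  holds for the quotients already. It makes a change of direction harmless uniformly in the base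
  point.\<close>

lemma directional_limit_lipschitz:
  fixes H :: "'v::euclidean_space \<Rightarrow> 'w::euclidean_space"
  assumes lip: "L-lipschitz_on UNIV H"
    and D: "\<And>a b. (\<lambda>n. (H (a + step n *\<^sub>R b) - H a) /\<^sub>R step n) \<longlonglongrightarrow> D a b"
  shows "norm (D a b - D a c) \<le> L * norm (b - c)"
proof (rule LIMSEQ_le_const2[OF tendsto_norm[OF tendsto_diff[OF D D]]])
  have "norm ((H (a + step n *\<^sub>R b) - H a) /\<^sub>R step n - (H (a + step n *\<^sub>R c) - H a) /\<^sub>R step n) \<le> L * norm (b - c)" for n
  proof -
    have "norm (H (a + step n *\<^sub>R b) - H (a + step n *\<^sub>R c)) \<le> \<bar>step n\<bar> * (L * norm (b - c))"
      using lipschitz_onD[OF lip, of "a + step n *\<^sub>R b" "a + step n *\<^sub>R c"] step_pos[of n]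
      by (simp add: dist_norm mult_ac flip: scaleR_diff_right)
    from norm_divideR_le[OF step_nz this] show ?thesis by (simp add: algebra_simps)
  qed
  then show "\<exists>N. \<forall>n\<ge>N. norm ((H (a + step n *\<^sub>R b) - H a) /\<^sub>R step n - (H (a + step n *\<^sub>R c) - H a) /\<^sub>R step n) \<le> L * norm (b - c)"
    by blast
qed

text \<open>Forward and backward difference quotients both yield a weak derivative of the composition; as weak
  derivatives are unique, the one-sided directional derivatives agree almost everywhere.\<close>

lemma AE_directional_odd:
  fixes u v :: "real^'m \<Rightarrow> 'v::euclidean_space" and H :: "'v \<Rightarrow> real"
  assumes U: "open U" "bounded U"
    and u: "integrable (lebesgue_on U) u" and v: "integrable (lebesgue_on U) v"
    and w: "has_weak_partial U j u v"
    and H: "convex_on UNIV H" "L-lipschitz_on UNIV H"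
  shows "AE x in lebesgue_on U. directional H (u x) (v x) = - directional H (u x) (- v x)"
proof (rule has_weak_partial_unique[OF U(1)])
  show "has_weak_partial U j (\<lambda>x. H (u x)) (\<lambda>x. directional H (u x) (v x))"
    by (rule has_weak_partial_lipschitz_compose[OF U u v w H(2) step_nz step_tendsto directional_tendsto[OF H(1)]])
  \<comment> \<open>A backward quotient in direction \<open>b\<close> is minus the forward quotient
    in direction \<open>- b\<close>.\<close>
  have "(\<lambda>n. (H (a + (- step n) *\<^sub>R b) - H a) /\<^sub>R (- step n)) \<longlonglongrightarrow> - directional H a (- b)" for a b
    using tendsto_minus[OF directional_tendsto[OF H(1), of a "- b"]] by simp
  moreover have "(\<lambda>n. - step n) \<longlonglongrightarrow> 0" using tendsto_minus[OF step_tendsto] by simp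
  ultimately show "has_weak_partial U j (\<lambda>x. H (u x)) (\<lambda>x. - directional H (u x) (- v x))"
    by (intro has_weak_partial_lipschitz_compose[OF U u v w H(2), of "\<lambda>n. - step n"]) (use step_nz in auto)
qed

text \<open>Oddness concerns only \<open>u x\<close> and \<open>v x\<close>, so one null set serves
  all sequences \<open>y\<close> at once. It is the union of the finitely many null sets of the
  weights that occur in \<open>dspectrum\<close>.\<close>

lemma AE_dspectrum_continuous:
  fixes u v :: "real^'m \<Rightarrow> complex^('d::{finite,linorder})^('d::{finite,linorder})"
  assumes U: "open U" "bounded U"
    and u: "integrable (lebesgue_on U) u" and v: "integrable (lebesgue_on U) v"
    and w: "has_weak_partial U j u v"
  shows "AE x in lebesgue_on U. \<forall>y. y \<longlonglongrightarrow> u x \<longrightarrow> (\<lambda>n. dspectrum (y n) (v x)) \<longlonglongrightarrow> dspectrum (u x) (v x)"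
proof -
  have odd: "AE x in lebesgue_on U. directional (max_weighted_trace w) (u x) (v x) = - directional (max_weighted_trace w) (u x) (- v x)"
    for w :: "'d \<Rightarrow> real"
    using lipschitz_max_weighted_trace[of w] AE_directional_odd[OF assms convex_on_max_weighted_trace[of w]] by metis
  have "AE x in lebesgue_on U. \<forall>i::'d\<in>UNIV. directional (max_weighted_trace (bumped_weight i)) (u x) (v x)
      = - directional (max_weighted_trace (bumped_weight i)) (u x) (- v x)"
    by (intro AE_finite_allI odd) auto
  then show ?thesis
    using odd[of rank_weight]
  proof eventually_elim
    case (elim x)
    have cont: "continuous_on UNIV (max_weighted_trace w)" for w :: "'d \<Rightarrow> real"
      using lipschitz_max_weighted_trace[of w] lipschitz_on_continuous_on by metis
    show ?case
    proof (intro allI impI vec_tendstoI)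
      fix y i assume y: "y \<longlonglongrightarrow> u x"
      show "(\<lambda>n. dspectrum (y n) (v x) $ i) \<longlonglongrightarrow> dspectrum (u x) (v x) $ i"
        unfolding dspectrum_def vec_lambda_beta using elim
        by (intro tendsto_intros directional_continuous_at_odd convex_on_max_weighted_trace cont y) auto
    qed
  qed
qed

section \<open>Almost everywhere changes and integrability in L^q\<close>

text \<open>Completeness of Lebesgue measure. It is applied to \<open>char_map u\<close>, which
  agrees with the Lipschitz map \<open>spectrum\<close> of \<open>u\<close> only where
  \<open>u\<close> is Hermitian.\<close>

lemma borel_measurable_lebesgue_on_AE:
  fixes f g :: "'a::euclidean_space \<Rightarrow> 'b::euclidean_space"
  assumes U: "U \<in> sets lebesgue" and f: "f \<in> borel_measurable (lebesgue_on U)"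
    and ae: "AE x in lebesgue_on U. f x = g x"
  shows "g \<in> borel_measurable (lebesgue_on U)"
proof -
  have "(\<lambda>x. indicator U x *\<^sub>R f x) \<in> borel_measurable lebesgue"
    using f U by (simp add: borel_measurable_restrict_space_iff)
  moreover have "AE x in lebesgue. indicator U x *\<^sub>R f x = indicator U x *\<^sub>R g x"
    using ae U by (auto simp: AE_restrict_space_iff indicator_def elim: eventually_mono)
  ultimately have "(\<lambda>x. indicator U x *\<^sub>R g x) \<in> borel_measurable lebesgue" by (rule borel_measurable_AE)
  then show ?thesis using U by (simp add: borel_measurable_restrict_space_iff)
qed

lemma has_weak_partial_cong_AE:
  fixes f f' g :: "real^'m \<Rightarrow> 'v::euclidean_space"
  assumes U: "U \<in> sets lebesgue" and f: "integrable (lebesgue_on U) f" and ae: "AE x in lebesgue_on U. f x = f' x"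
    and w: "has_weak_partial U j f g"
  shows "has_weak_partial U j f' g"
proof -
  have m: "f' \<in> borel_measurable (lebesgue_on U)"
    by (rule borel_measurable_lebesgue_on_AE[OF U borel_measurable_integrable[OF f] ae])
  have f': "integrable (lebesgue_on U) f'"
    using f integrable_cong_AE[OF borel_measurable_integrable[OF f] m ae] by simp
  have "(LINT x|lebesgue_on U. partial j \<phi> x *\<^sub>R f x) = (LINT x|lebesgue_on U. partial j \<phi> x *\<^sub>R f' x)" if "\<phi> \<in> test_functions U" for \<phi>
  proof (rule integral_cong_AE)
    note t = integrable_test_function_scaleR[OF test_functions_partial[OF that]]
    show "(\<lambda>x. partial j \<phi> x *\<^sub>R f x) \<in> borel_measurable (lebesgue_on U)" "(\<lambda>x. partial j \<phi> x *\<^sub>R f' x) \<in> borel_measurable (lebesgue_on U)"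
      by (intro borel_measurable_integrable t f f')+
  qed (use ae in \<open>auto elim: eventually_mono\<close>)
  then show ?thesis using w locally_integrableI[OF U f'] by (simp add: has_weak_partial_def)
qed

lemma has_weak_partial_diff:
  fixes f g f' g' :: "real^'m \<Rightarrow> 'v::euclidean_space"
  assumes i: "integrable (lebesgue_on U) f" "integrable (lebesgue_on U) g" "integrable (lebesgue_on U) f'" "integrable (lebesgue_on U) g'"
    and U: "U \<in> sets lebesgue"
    and w: "has_weak_partial U j f g" "has_weak_partial U j f' g'"
  shows "has_weak_partial U j (\<lambda>x. f x - f' x) (\<lambda>x. g x - g' x)"
proof -
  have "(LINT x|lebesgue_on U. partial j \<phi> x *\<^sub>R (f x - f' x)) = - (LINT x|lebesgue_on U. \<phi> x *\<^sub>R (g x - g' x))"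
    if \<phi>: "\<phi> \<in> test_functions U" for \<phi>
  proof -
    note t = integrable_test_function_scaleR[OF test_functions_partial[OF \<phi>]] integrable_test_function_scaleR[OF \<phi>]
    show ?thesis using w \<phi> by (simp add: scaleR_diff_right t i has_weak_partial_def)
  qed
  then show ?thesis
    using locally_integrableI[OF U, of "\<lambda>x. f x - f' x"] locally_integrableI[OF U, of "\<lambda>x. g x - g' x"] i
    by (simp add: has_weak_partial_def)
qed

text \<open>On a set of finite measure, s \<le> 1 + s^q puts L^q into L^1.\<close>

lemma Lq_space_integrable:
  fixes f :: "real^'m \<Rightarrow> 'v::euclidean_space"
  assumes q: "q \<ge> 1" and U: "U \<in> sets lebesgue" "bounded U" and f: "f \<in> Lq_space q U V"
  shows "integrable (lebesgue_on U) f"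
proof -
  have [measurable]: "f \<in> borel_measurable (lebesgue_on U)" using f by (simp add: Lq_space_def)
  have fin: "finite_measure (lebesgue_on U)"
    using bounded_set_imp_lmeasurable[OF U(2) U(1)] by (simp add: finite_measure_lebesgue_on)
  have "Lq_norm q U f < \<infinity>" using f by (simp add: Lq_space_def)
  then have "Lq_integral q U f < \<infinity>" by (simp only: Lq_norm_finite_iff)
  then have *: "integrable (lebesgue_on U) (\<lambda>x. norm (f x) powr q)"
    by (intro integrableI_nonneg) (auto simp: Lq_integral_def)
  show ?thesis
  proof (rule Bochner_Integration.integrable_bound)
    show "integrable (lebesgue_on U) (\<lambda>x. 1 + norm (f x) powr q)"
      using * finite_measure.integrable_const[OF fin] by (intro Bochner_Integration.integrable_add) auto
    have "s \<le> 1 + s powr q" if "s \<ge> 0" for s :: real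
    proof (cases "s \<le> 1")
      case True then show ?thesis using powr_ge_zero[of s q] by linarith
    next
      case False
      then have "s powr 1 \<le> s powr q" using q by (intro powr_mono) auto
      then show ?thesis using False by simp
    qed
    then show "AE x in lebesgue_on U. norm (f x) \<le> norm (1 + norm (f x) powr q)"
      by (intro AE_I2) auto
  qed measurable
qed

lemma dspectrum_measurable:
  fixes u v :: "'x \<Rightarrow> complex^('d::{finite,linorder})^('d::{finite,linorder})"
  assumes [measurable]: "u \<in> borel_measurable M" "v \<in> borel_measurable M"
  shows "(\<lambda>x. dspectrum (u x) (v x)) \<in> borel_measurable M"
proof -
  obtain L where "L-lipschitz_on UNIV (spectrum :: complex^('d::{finite,linorder})^('d::{finite,linorder}) \<Rightarrow> _)"
    by (rule spectrum_lipschitz)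
  then have [measurable]: "(spectrum :: complex^('d::{finite,linorder})^('d::{finite,linorder}) \<Rightarrow> _) \<in> borel_measurable borel"
    by (intro borel_measurable_continuous_onI lipschitz_on_continuous_on)
  show ?thesis by (rule borel_measurable_LIMSEQ_metric[OF _ spectrum_directional]) measurable
qed

lemma Lq_norm_diff_finite:
  fixes f g :: "real^'m \<Rightarrow> 'v::euclidean_space"
  assumes q: "q \<ge> 1" and f: "f \<in> Lq_space q U V" and g: "g \<in> Lq_space q U V'"
  shows "Lq_norm q U (\<lambda>x. f x - g x) < \<infinity>"
proof -
  have [measurable]: "f \<in> borel_measurable (lebesgue_on U)" "g \<in> borel_measurable (lebesgue_on U)"
    using f g by (simp_all add: Lq_space_def)
  have "Lq_norm q U (\<lambda>x. f x + - g x) \<le> Lq_norm q U f + Lq_norm q U (\<lambda>x. - g x)"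
    by (rule Lq_norm_triangle[OF q]) measurable
  also have "Lq_norm q U (\<lambda>x. - g x) = Lq_norm q U g" by (rule Lq_norm_cong_AE) simp
  also have "Lq_norm q U f + Lq_norm q U g < \<infinity>" using f g by (simp add: Lq_space_def)
  finally show ?thesis by simp
qed

text \<open>The L^1 statement is applied to the q-th powers of the norms, and the root of the limit
  is taken pointwise.\<close>

lemma Lq_tendsto_AE_subseq:
  fixes f :: "nat \<Rightarrow> real^'m \<Rightarrow> 'v::euclidean_space"
  assumes q: "q \<ge> 1" and [measurable]: "\<And>n. f n \<in> borel_measurable (lebesgue_on U)"
    and fin: "\<And>n. Lq_norm q U (f n) < \<infinity>" and lim: "(\<lambda>n. Lq_norm q U (f n)) \<longlonglongrightarrow> 0"
  obtains s :: "nat \<Rightarrow> nat" where "strict_mono s" "AE x in lebesgue_on U. (\<lambda>n. f (s n) x) \<longlonglongrightarrow> 0"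
proof -
  define u where "u n x = norm (f n x) powr q" for n x
  have finI: "Lq_integral q U (f n) < \<infinity>" for n using fin by (simp only: Lq_norm_finite_iff)
  have [measurable]: "u n \<in> borel_measurable (lebesgue_on U)" for n unfolding u_def by measurable
  have u: "integrable (lebesgue_on U) (u n)" for n
    using finI[of n] by (intro integrableI_nonneg) (auto simp: u_def Lq_integral_def)
  have eq: "ennreal (LINT x|lebesgue_on U. norm (u n x)) = Lq_integral q U (f n)" for n
    using nn_integral_eq_integral[OF integrable_norm[OF u[of n]]] by (simp add: u_def Lq_integral_def)
  have "(\<lambda>n. Lq_integral q U (f n)) \<longlonglongrightarrow> 0" using lim q by (simp add: Lq_norm_tendsto_0_iff)
  then have "(\<lambda>n. ennreal (LINT x|lebesgue_on U. norm (u n x))) \<longlonglongrightarrow> ennreal 0" by (simp only: eq ennreal_0)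
  then have "(\<lambda>n. LINT x|lebesgue_on U. norm (u n x)) \<longlonglongrightarrow> 0"
    by (subst (asm) tendsto_ennreal_iff) auto
  from tendsto_L1_AE_subseq[OF u this] obtain s :: "nat \<Rightarrow> nat" where
    s: "strict_mono s" "AE x in lebesgue_on U. (\<lambda>n. u (s n) x) \<longlonglongrightarrow> 0" by blast
  from s(2) have "AE x in lebesgue_on U. (\<lambda>n. f (s n) x) \<longlonglongrightarrow> 0"
  proof eventually_elim
    case (elim x)
    have "(\<lambda>n. u (s n) x powr (1 / q)) \<longlonglongrightarrow> 0"
      by (rule tendsto_zero_powrI[OF elim tendsto_const]) (use q in \<open>auto simp: u_def\<close>)
    then have "(\<lambda>n. norm (f (s n) x)) \<longlonglongrightarrow> 0" using q by (simp add: u_def powr_powr)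
    then show ?case by (rule tendsto_norm_zero_cancel)
  qed
  with s(1) show ?thesis using that by blast
qed

section \<open>Convergence of the derivatives in L^q\<close>

text \<open>\<open>p\<close> changes the direction and is bounded by \<open>L\<close> times the
  error in \<open>vs n\<close>. \<open>k\<close> changes the base point at the fixed direction
  \<open>v x\<close>, where continuity is known almost everywhere and a dominating function
  independent of \<open>n\<close> exists.\<close>

lemma dspectrum_Lq_tendsto:
  fixes u v :: "real^'m \<Rightarrow> complex^('d::{finite,linorder})^('d::{finite,linorder})"
  assumes q: "q \<ge> 1" and U: "open U" "bounded U"
    and u: "u \<in> Lq_space q U V" and v: "v \<in> Lq_space q U V" and w: "has_weak_partial U j u v"
    and us: "\<And>n. us n \<in> Lq_space q U V" and vs: "\<And>n. vs n \<in> Lq_space q U V"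
    and lim_u: "(\<lambda>n. Lq_norm q U (\<lambda>x. us n x - u x)) \<longlonglongrightarrow> 0"
    and lim_v: "(\<lambda>n. Lq_norm q U (\<lambda>x. vs n x - v x)) \<longlonglongrightarrow> 0"
  shows "(\<lambda>n. Lq_norm q U (\<lambda>x. dspectrum (us n x) (vs n x) - dspectrum (u x) (v x))) \<longlonglongrightarrow> 0"
proof -
  have Um: "U \<in> sets lebesgue" using U by (simp add: lborelD)
  have q0: "q > 0" using q by simp
  have [measurable]: "u \<in> borel_measurable (lebesgue_on U)" "v \<in> borel_measurable (lebesgue_on U)"
    "us n \<in> borel_measurable (lebesgue_on U)" "vs n \<in> borel_measurable (lebesgue_on U)" for n
    using u v us vs by (simp_all add: Lq_space_def)
  note [measurable] = dspectrum_measurable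
  obtain L where L: "L-lipschitz_on UNIV (spectrum :: complex^('d::{finite,linorder})^('d::{finite,linorder}) \<Rightarrow> _)"
    by (rule spectrum_lipschitz)
  have L0: "L \<ge> 0" using L by (rule lipschitz_on_nonneg)
  note d_lip = directional_limit_lipschitz[OF L spectrum_directional]
  note d_le = lipschitz_directional_le(2)[OF L spectrum_directional step_nz]
  define p where "p n x = dspectrum (us n x) (vs n x) - dspectrum (us n x) (v x)" for n x
  define k where "k n x = dspectrum (us n x) (v x) - dspectrum (u x) (v x)" for n x
  have [measurable]: "p n \<in> borel_measurable (lebesgue_on U)" "k n \<in> borel_measurable (lebesgue_on U)" for n
    unfolding p_def k_def by measurable
  have lim_p: "(\<lambda>n. Lq_norm q U (p n)) \<longlonglongrightarrow> 0"
  proof (rule tendsto_sandwich[OF _ _ tendsto_const])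
    have "(\<lambda>n. Lq_integral q U (\<lambda>x. vs n x - v x)) \<longlonglongrightarrow> 0" using lim_v q0 by (simp add: Lq_norm_tendsto_0_iff)
    from ennreal_tendsto_cmult[OF _ this, of "ennreal (L powr q)"]
    have "(\<lambda>n. Lq_integral q U (\<lambda>x. L * norm (vs n x - v x))) \<longlonglongrightarrow> 0"
      by (simp add: Lq_integral_scale[OF _ L0])
    then show "(\<lambda>n. Lq_norm q U (\<lambda>x. L * norm (vs n x - v x))) \<longlonglongrightarrow> 0" using q0 by (simp add: Lq_norm_tendsto_0_iff)
    have "Lq_norm q U (p n) \<le> Lq_norm q U (\<lambda>x. L * norm (vs n x - v x))" for n
      using d_lip L0 by (intro Lq_norm_mono_AE[OF q0] AE_I2) (simp add: p_def)
    then show "\<forall>\<^sub>F n in sequentially. Lq_norm q U (p n) \<le> Lq_norm q U (\<lambda>x. L * norm (vs n x - v x))" by simp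
  qed simp
  have lim_k: "(\<lambda>n. Lq_norm q U (k n)) \<longlonglongrightarrow> 0"
  proof (rule tendsto_subsequence_principle)
    fix r :: "nat \<Rightarrow> nat" assume r: "strict_mono r"
    obtain s :: "nat \<Rightarrow> nat" where s: "strict_mono s" "AE x in lebesgue_on U. (\<lambda>n. us (r (s n)) x - u x) \<longlonglongrightarrow> 0"
    proof (rule Lq_tendsto_AE_subseq[OF q, of "\<lambda>n x. us (r n) x - u x" U])
      show "Lq_norm q U (\<lambda>x. us (r n) x - u x) < \<infinity>" for n by (rule Lq_norm_diff_finite[OF q us u])
      show "(\<lambda>n. Lq_norm q U (\<lambda>x. us (r n) x - u x)) \<longlonglongrightarrow> 0"
        using LIMSEQ_subseq_LIMSEQ[OF lim_u r] by (simp add: comp_def)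
    qed auto
    have "(\<lambda>n. \<integral>\<^sup>+ x. ennreal (norm (k (r (s n)) x) powr q) \<partial>lebesgue_on U) \<longlonglongrightarrow> (\<integral>\<^sup>+ x. 0 \<partial>lebesgue_on U)"
    \<comment> \<open>Each of the two directional derivatives in \<open>k\<close> has norm at most
      \<open>L * norm (v x)\<close>; hence the factor \<open>2 * L\<close>.\<close>
    proof (rule nn_integral_dominated_convergence[where w="\<lambda>x. ennreal (norm ((2 * L) * norm (v x)) powr q)"])
      have "Lq_integral q U v < \<infinity>" using v Lq_norm_finite_iff[of q U v] by (simp add: Lq_space_def)
      then have "Lq_integral q U (\<lambda>x. (2 * L) * norm (v x)) < \<infinity>"
        using Lq_integral_scale[of v U "2 * L" q] L0 by (simp add: ennreal_mult_less_top)
      then show "(\<integral>\<^sup>+ x. ennreal (norm ((2 * L) * norm (v x)) powr q) \<partial>lebesgue_on U) < \<infinity>" by (simp add: Lq_integral_def)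
      have k_le: "norm (k n x) \<le> (2 * L) * norm (v x)" for n x
        using norm_triangle_ineq4[of "dspectrum (us n x) (v x)" "dspectrum (u x) (v x)"] d_le[of "us n x" "v x"] d_le[of "u x" "v x"]
        by (simp add: k_def)
      show "AE x in lebesgue_on U. ennreal (norm (k (r (s n)) x) powr q) \<le> ennreal (norm ((2 * L) * norm (v x)) powr q)" for n
        using k_le[of "r (s n)"] q0 L0 by (intro AE_I2 ennreal_leI powr_mono2) auto
      show "AE x in lebesgue_on U. (\<lambda>n. ennreal (norm (k (r (s n)) x) powr q)) \<longlonglongrightarrow> 0"
        using s(2) AE_dspectrum_continuous[OF U Lq_space_integrable[OF q Um U(2) u] Lq_space_integrable[OF q Um U(2) v] w]
      proof eventually_elim
        case (elim x)
        have "(\<lambda>n. us (r (s n)) x) \<longlonglongrightarrow> u x" using elim(1) by (simp add: LIM_zero_iff)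
        with elim(2) have "(\<lambda>n. dspectrum (us (r (s n)) x) (v x)) \<longlonglongrightarrow> dspectrum (u x) (v x)" by blast
        then have "(\<lambda>n. norm (k (r (s n)) x)) \<longlonglongrightarrow> 0" unfolding k_def by (intro tendsto_norm_zero) (simp add: LIM_zero_iff)
        then have "(\<lambda>n. norm (k (r (s n)) x) powr q) \<longlonglongrightarrow> 0"
          by (rule tendsto_zero_powrI[OF _ tendsto_const]) (use q0 in auto)
        then show ?case using tendsto_ennrealI by fastforce
      qed
    qed measurable
    then have "(\<lambda>n. Lq_norm q U (k (r (s n)))) \<longlonglongrightarrow> 0"
      using q0 by (simp add: Lq_norm_tendsto_0_iff Lq_integral_def)
    with s(1) show "\<exists>s :: nat \<Rightarrow> nat. strict_mono s \<and> (\<lambda>n. Lq_norm q U (k (r (s n)))) \<longlonglongrightarrow> 0" by blast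
  qed
  have "Lq_norm q U (\<lambda>x. dspectrum (us n x) (vs n x) - dspectrum (u x) (v x)) \<le> Lq_norm q U (p n) + Lq_norm q U (k n)" for n
    using Lq_norm_triangle[OF q, of "p n" U "k n"] by (simp add: p_def k_def)
  then show ?thesis
    by (intro tendsto_sandwich[OF _ _ tendsto_const tendsto_add_zero[OF lim_p lim_k]]) auto
qed

lemma has_weak_partial_char_map:
  fixes u v :: "real^'m \<Rightarrow> complex^('d::{finite,linorder})^('d::{finite,linorder})"
  assumes q: "q \<ge> 1" and U: "open U" "bounded U"
    and u: "u \<in> Lq_space q U Herm" and v: "v \<in> Lq_space q U V" and w: "has_weak_partial U j u v"
  shows "has_weak_partial U j (char_map u) (\<lambda>x. dspectrum (u x) (v x))"
proof -
  have Um: "U \<in> sets lebesgue" using U by (simp add: lborelD)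
  note ui = Lq_space_integrable[OF q Um U(2) u] and vi = Lq_space_integrable[OF q Um U(2) v]
  obtain L where L: "L-lipschitz_on UNIV (spectrum :: complex^('d::{finite,linorder})^('d::{finite,linorder}) \<Rightarrow> _)"
    by (rule spectrum_lipschitz)
  have *: "has_weak_partial U j (\<lambda>x. spectrum (u x)) (\<lambda>x. dspectrum (u x) (v x))"
    by (rule has_weak_partial_lipschitz_compose[OF U ui vi w L step_nz step_tendsto spectrum_directional])
  show ?thesis
  proof (rule has_weak_partial_cong_AE[OF Um _ _ *])
    show "integrable (lebesgue_on U) (\<lambda>x. spectrum (u x))" by (rule integrable_lipschitz_compose[OF Um U(2) ui L])
    have "AE x in lebesgue_on U. u x \<in> Herm" using u by (simp add: Lq_space_def)
    then show "AE x in lebesgue_on U. spectrum (u x) = char_map u x"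
      by eventually_elim (simp add: char_map_def eigvals_incr_eq_spectrum)
  qed
qed

theorem corollary1p4:
  fixes U :: "(real^'m) set" and q :: real
    and A :: "real^'m \<Rightarrow> complex^('d::{finite,linorder})^('d::{finite,linorder})"
    and A_seq :: "nat \<Rightarrow> real^'m \<Rightarrow> complex^('d::{finite,linorder})^('d::{finite,linorder})"
  assumes "1 \<le> q" and "open U" and "bounded U"
    and "A \<in> W1q q U Herm" and "\<And>n. A_seq n \<in> W1q q U Herm"
    and "(\<lambda>n. W1q_norm q U (\<lambda>x. A_seq n x - A x)) \<longlonglongrightarrow> 0"
  shows "\<forall>j.
     (\<lambda>n. Lq_norm q U (\<lambda>x. norm (weak_partial U j (char_map A) x)
                           - norm (weak_partial U j (char_map (A_seq n)) x))) \<longlonglongrightarrow> 0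
   \<and> (\<lambda>n. Lq_norm q U (weak_partial U j (char_map (A_seq n))))
        \<longlonglongrightarrow> Lq_norm q U (weak_partial U j (char_map A))"
proof
  fix j
  note q = assms(1) and U = assms(2,3)
  have q0: "q > 0" using q by simp
  have Um: "U \<in> sets lebesgue" using U by (simp add: lborelD)
  have A: "A \<in> Lq_space q U Herm" "\<And>n. A_seq n \<in> Lq_space q U Herm" using assms(4,5) by (auto simp: W1q_def)
  obtain B where B: "B \<in> Lq_space q U Herm" "has_weak_partial U j A B" using assms(4) by (auto simp: W1q_def)
  have "\<exists>b. b \<in> Lq_space q U Herm \<and> has_weak_partial U j (A_seq n) b" for n using assms(5)[of n] by (auto simp: W1q_def)
  then obtain Bs where Bs: "\<And>n. Bs n \<in> Lq_space q U Herm" "\<And>n. has_weak_partial U j (A_seq n) (Bs n)" by metis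
  note int = Lq_space_integrable[OF q Um U(2)]
  have lim_A: "(\<lambda>n. Lq_norm q U (\<lambda>x. A_seq n x - A x)) \<longlonglongrightarrow> 0"
    by (rule tendsto_sandwich[OF _ _ tendsto_const assms(6)]) (auto simp: W1q_norm_def intro!: always_eventually)
  \<comment> \<open>\<open>W1q_norm\<close> contains the chosen weak derivative of the difference;
    by uniqueness it equals \<open>Bs n x - B x\<close> almost everywhere.\<close>
  have "Lq_norm q U (\<lambda>x. Bs n x - B x) \<le> W1q_norm q U (\<lambda>x. A_seq n x - A x)" for n
  proof -
    have "has_weak_partial U j (\<lambda>x. A_seq n x - A x) (\<lambda>x. Bs n x - B x)"
      by (rule has_weak_partial_diff[OF int[OF A(2)] int[OF Bs(1)] int[OF A(1)] int[OF B(1)] Um Bs(2) B(2)])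
    from AE_weak_partial_eq[OF U(1) this]
    have "Lq_norm q U (\<lambda>x. Bs n x - B x) = Lq_norm q U (weak_partial U j (\<lambda>x. A_seq n x - A x))"
      by (intro Lq_norm_cong_AE) (auto elim: eventually_mono)
    also have "\<dots> \<le> (\<Sum>i\<in>UNIV. Lq_norm q U (weak_partial U i (\<lambda>x. A_seq n x - A x)))"
      by (rule member_le_sum) auto
    finally show ?thesis by (simp add: W1q_norm_def add_increasing)
  qed
  then have lim_B: "(\<lambda>n. Lq_norm q U (\<lambda>x. Bs n x - B x)) \<longlonglongrightarrow> 0"
    by (intro tendsto_sandwich[OF _ _ tendsto_const assms(6)]) auto
  define g where "g x = dspectrum (A x) (B x)" for x
  define gs where "gs n x = dspectrum (A_seq n x) (Bs n x)" for n x
  have lim: "(\<lambda>n. Lq_norm q U (\<lambda>x. gs n x - g x)) \<longlonglongrightarrow> 0"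
    unfolding g_def gs_def by (rule dspectrum_Lq_tendsto[OF q U A(1) B A(2) Bs(1) lim_A lim_B])
  have [measurable]: "g \<in> borel_measurable (lebesgue_on U)" "gs n \<in> borel_measurable (lebesgue_on U)" for n
    unfolding g_def gs_def using A B(1) Bs(1) by (auto simp: Lq_space_def intro!: dspectrum_measurable)
  have wp: "AE x in lebesgue_on U. weak_partial U j (char_map A) x = g x"
    "AE x in lebesgue_on U. weak_partial U j (char_map (A_seq n)) x = gs n x" for n
    unfolding g_def gs_def
    by (rule AE_weak_partial_eq[OF U(1) has_weak_partial_char_map[OF q U A(1) B]])
       (rule AE_weak_partial_eq[OF U(1) has_weak_partial_char_map[OF q U A(2) Bs]])
  \<comment> \<open>By the reverse triangle inequality the first claim follows from
    \<open>lim\<close>.\<close>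
  have "Lq_norm q U (\<lambda>x. norm (weak_partial U j (char_map A) x) - norm (weak_partial U j (char_map (A_seq n)) x))
      \<le> Lq_norm q U (\<lambda>x. gs n x - g x)" for n
    using wp(1) wp(2)[of n]
    by (intro Lq_norm_mono_AE[OF q0], eventually_elim) (simp add: norm_triangle_ineq3 norm_minus_commute)
  then have 1: "(\<lambda>n. Lq_norm q U (\<lambda>x. norm (weak_partial U j (char_map A) x) - norm (weak_partial U j (char_map (A_seq n)) x))) \<longlonglongrightarrow> 0"
    by (intro tendsto_sandwich[OF _ _ tendsto_const lim]) auto
  \<comment> \<open>The finiteness required by \<open>Lq_norm_tendsto\<close> is inherited from
    \<open>B\<close>, since \<open>g x\<close> has norm at most
    \<open>L * norm (B x)\<close>.\<close>
  have "Lq_norm q U g < \<infinity>"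
  proof -
    obtain L where L: "L-lipschitz_on UNIV (spectrum :: complex^('d::{finite,linorder})^('d::{finite,linorder}) \<Rightarrow> _)"
      by (rule spectrum_lipschitz)
    have L0: "L \<ge> 0" using L by (rule lipschitz_on_nonneg)
    have "Lq_integral q U (\<lambda>x. L * norm (B x)) < \<infinity>"
      using Lq_integral_scale[of B U L q] L0 B(1) Lq_norm_finite_iff[of q U B] by (simp add: Lq_space_def ennreal_mult_less_top)
    then have "Lq_norm q U (\<lambda>x. L * norm (B x)) < \<infinity>" by (simp only: Lq_norm_finite_iff)
    moreover have "Lq_norm q U g \<le> Lq_norm q U (\<lambda>x. L * norm (B x))"
      using lipschitz_directional_le(2)[OF L spectrum_directional step_nz] L0
      by (intro Lq_norm_mono_AE[OF q0] AE_I2) (simp add: g_def)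
    ultimately show ?thesis by (rule le_less_trans[rotated])
  qed
  then have "(\<lambda>n. Lq_norm q U (gs n)) \<longlonglongrightarrow> Lq_norm q U g"
    by (intro Lq_norm_tendsto[OF q _ _ _ lim]) measurable
  moreover have "Lq_norm q U (weak_partial U j (char_map A)) = Lq_norm q U g"
    "Lq_norm q U (weak_partial U j (char_map (A_seq n))) = Lq_norm q U (gs n)" for n
    by (rule Lq_norm_cong_AE, use wp(1) in eventually_elim, simp)
      (rule Lq_norm_cong_AE, use wp(2)[of n] in eventually_elim, simp)
  ultimately have 2: "(\<lambda>n. Lq_norm q U (weak_partial U j (char_map (A_seq n)))) \<longlonglongrightarrow> Lq_norm q U (weak_partial U j (char_map A))"
    by simp
  from 1 2 show "(\<lambda>n. Lq_norm q U (\<lambda>x. norm (weak_partial U j (char_map A) x)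
                           - norm (weak_partial U j (char_map (A_seq n)) x))) \<longlonglongrightarrow> 0
   \<and> (\<lambda>n. Lq_norm q U (weak_partial U j (char_map (A_seq n))))
        \<longlonglongrightarrow> Lq_norm q U (weak_partial U j (char_map A))" ..
qed

end
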